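(* Assume that the limit $\ell:=\lim_{s\uparrow+\infty}-\frac1s\ln\mathbb{P}[S_1>s]$ exists in $[0,+\infty]$. If $\mathbb{E}[e^{\rho M_1}]<+\infty$ for all $\rho>0$, then $F_t$ satisfies a full large deviation principle with the good rate function $I$ given by $I(w):=\sup_{k\in\mathbb{R}}\{wk+\varphi(k)\}$, $w\in\mathbb{R}$. Moreover, the asymptotic logarithmic moment generating function $g(k):=\lim_{t\uparrow+\infty}\frac1t\ln\mathbb{E}[e^{kF_t}]$ of $F_t$ exists for every $k\in\mathbb{R}$ and $g=-\varphi$.
   Context: Let $(\Omega,\mathcal{F},\mathbb{P})$ be a probability space with expectation $\mathbb{E}$. Let $S_1,S_2,\ldots$ (waiting times) be i.i.d. non-negative real random variables with $\mathbb{P}[S_1=0]<1$; put $T_0:=0$, $T_n:=S_1+\cdots+S_n$, and $N_t:=\sup\{n\ge 0:T_n\le t\}$ for $t\ge 0$ (almost surely finite for all $t$). Let $\{B_{1,t}\}_{t\ge 0},\{B_{2,t}\}_{t\ge 0},\ldots$ be i.i.d. $\mathbb{R}$-valued stochastic processes with measurable sample paths, independent of the waiting times. The process under resetting is $Z_t:=B_{N_t+1,\,t-T_{N_t}}$, $t\ge 0$. Let $f:\mathbb{R}\to\mathbb{R}$ be measurable, such that the time integrals below are well defined, and define $$F_t:=\int_0^t f(Z_\tau)\,d\tau,\qquad X_n:=\int_0^{S_n}f(B_{n,\tau})\,d\tau,\qquad M_n:=\int_0^{S_n}|f(B_{n,\tau})|\,d\tau .$$ For $k\in\mathbb{R}$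 define the extended real number $$\varphi(k):=\sup\Big\{\zeta\in\mathbb{R}:\ \mathbb{E}\big[e^{\zeta S_1+kX_1}\big]\le 1\Big\},$$ with $\sup\emptyset=-\infty$; also $\ln 0=-\infty$, $\ln(+\infty)=+\infty$, $\inf\emptyset=+\infty$. $F_t$ satisfies a full large deviation principle with rate function $I$ if $I$ is lower semicontinuous on $\mathbb{R}$ and $\liminf_{t\uparrow+\infty}\frac1t\ln\mathbb{P}[F_t/t\in G]\ge-\inf_{w\in G}I(w)$ for each open $G\subseteq\mathbb{R}$, and $\limsup_{t\uparrow+\infty}\frac1t\ln\mathbb{P}[F_t/t\in K]\le-\inf_{w\in K}I(w)$ for each closed $K\subseteq\mathbb{R}$. The rate function is good if $\{w\in\mathbb{R}:I(w)\le a\}$ is compact for each $a\ge 0$. *)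

theory Defs
  imports "HOL-Probability.Probability"
begin

text \<open>
  The waiting times \<open>S n\<close> and the processes \<open>B n\<close> are used for \<open>n \<ge> 1\<close> only, and \<open>B n t\<close> for
  \<open>t \<ge> 0\<close> only.
\<close>

definition renewal_time :: "(nat \<Rightarrow> 'a \<Rightarrow> real) \<Rightarrow> nat \<Rightarrow> 'a \<Rightarrow> real" where
  "renewal_time S n \<omega> = (\<Sum>i=1..n. S i \<omega>)"

text \<open>
  The set below contains \<open>0\<close> for every \<open>t \<ge> 0\<close> and is almost surely finite in the setting
  considered; \<open>Sup\<close> on \<^typ>\<open>nat\<close> is meaningless on the remaining null event.
\<close>

definition renewal_count :: "(nat \<Rightarrow> 'a \<Rightarrow> real) \<Rightarrow> real \<Rightarrow> 'a \<Rightarrow> nat" where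
  "renewal_count S t \<omega> = Sup {n. renewal_time S n \<omega> \<le> t}"

definition reset_process ::
    "(nat \<Rightarrow> 'a \<Rightarrow> real) \<Rightarrow> (nat \<Rightarrow> real \<Rightarrow> 'a \<Rightarrow> real) \<Rightarrow> real \<Rightarrow> 'a \<Rightarrow> real" where
  "reset_process S B t \<omega> =
     B (renewal_count S t \<omega> + 1) (t - renewal_time S (renewal_count S t \<omega>) \<omega>) \<omega>"

definition reset_functional ::
    "(nat \<Rightarrow> 'a \<Rightarrow> real) \<Rightarrow> (nat \<Rightarrow> real \<Rightarrow> 'a \<Rightarrow> real) \<Rightarrow> (real \<Rightarrow> real) \<Rightarrow> real \<Rightarrow> 'a \<Rightarrow> real" where
  "reset_functional S B f t \<omega> = (LINT \<tau>:{0..t}|lborel. f (reset_process S B \<tau> \<omega>))"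

definition cycle_reward ::
    "(nat \<Rightarrow> 'a \<Rightarrow> real) \<Rightarrow> (nat \<Rightarrow> real \<Rightarrow> 'a \<Rightarrow> real) \<Rightarrow> (real \<Rightarrow> real) \<Rightarrow> nat \<Rightarrow> 'a \<Rightarrow> real" where
  "cycle_reward S B f n \<omega> = (LINT \<tau>:{0..S n \<omega>}|lborel. f (B n \<tau> \<omega>))"

definition cycle_abs_reward ::
    "(nat \<Rightarrow> 'a \<Rightarrow> real) \<Rightarrow> (nat \<Rightarrow> real \<Rightarrow> 'a \<Rightarrow> real) \<Rightarrow> (real \<Rightarrow> real) \<Rightarrow> nat \<Rightarrow> 'a \<Rightarrow> real" where
  "cycle_abs_reward S B f n \<omega> = (LINT \<tau>:{0..S n \<omega>}|lborel. \<bar>f (B n \<tau> \<omega>)\<bar>)"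

text \<open>Expectation of \<open>exp Y\<close> as an element of \<open>[0, \<infinity>]\<close>.\<close>

definition exp_moment :: "'a measure \<Rightarrow> ('a \<Rightarrow> real) \<Rightarrow> ennreal" where
  "exp_moment M Y = (\<integral>\<^sup>+\<omega>. ennreal (exp (Y \<omega>)) \<partial>M)"

definition path_space :: "(real \<Rightarrow> real) measure" where
  "path_space = PiM {0..} (\<lambda>_. borel)"

definition path_of :: "(nat \<Rightarrow> real \<Rightarrow> 'a \<Rightarrow> real) \<Rightarrow> nat \<Rightarrow> 'a \<Rightarrow> real \<Rightarrow> real" where
  "path_of B n \<omega> = (\<lambda>t\<in>{0..}. B n t \<omega>)"

text \<open>
  The processes are measurable in the sense of joint measurability in time and sample point; in
  particular all sample paths are measurable.  Independence and equality in law of processes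
  refer to the product \<open>\<sigma>\<close>-algebra on paths, that is to finite-dimensional distributions.

  The assumption \<open>f_B_integrable\<close> makes the time integrals up to \<open>S n\<close> meaningful.  Almost surely,
  an interval \<open>[0, t]\<close> is covered by finitely many cycles, so that it also gives integrability
  of \<open>f (reset_process S B \<tau> \<omega>)\<close> over \<open>[0, t]\<close>.
\<close>

locale stochastic_resetting = prob_space M
  for M :: "'a measure" +
  fixes S :: "nat \<Rightarrow> 'a \<Rightarrow> real"
    and B :: "nat \<Rightarrow> real \<Rightarrow> 'a \<Rightarrow> real"
    and f :: "real \<Rightarrow> real"
  assumes S_indep: "indep_vars (\<lambda>_. borel) S {1..}"
    and S_ident: "\<And>n. n \<ge> 1 \<Longrightarrow> distr M borel (S n) = distr M borel (S 1)"
    and S_nonneg: "\<And>n \<omega>. n \<ge> 1 \<Longrightarrow> \<omega> \<in> space M \<Longrightarrow> S n \<omega> \<ge> 0"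
    and S_nontrivial: "prob {\<omega> \<in> space M. S 1 \<omega> = 0} < 1"
    and B_measurable: "\<And>n. n \<ge> 1 \<Longrightarrow>
          (\<lambda>(t, \<omega>). B n t \<omega>) \<in> borel_measurable (restrict_space borel {0..} \<Otimes>\<^sub>M M)"
    and B_indep: "indep_vars (\<lambda>_. path_space) (path_of B) {1..}"
    and B_ident: "\<And>n. n \<ge> 1 \<Longrightarrow>
          distr M path_space (path_of B n) = distr M path_space (path_of B 1)"
    and S_B_indep: "indep_set
          (sets (vimage_algebra (space M) (\<lambda>\<omega>. \<lambda>n\<in>{1..}. S n \<omega>)
             (PiM {1..} (\<lambda>_. borel))))
          (sets (vimage_algebra (space M) (\<lambda>\<omega>. \<lambda>n\<in>{1..}. path_of B n \<omega>)
             (PiM {1..} (\<lambda>_. path_space))))"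
    and f_measurable: "f \<in> borel_measurable borel"
    and f_B_integrable: "\<And>n. n \<ge> 1 \<Longrightarrow>
          AE \<omega> in M. set_integrable lborel {0..S n \<omega>} (\<lambda>\<tau>. f (B n \<tau> \<omega>))"

definition ext_ln :: "ennreal \<Rightarrow> ereal" where
  "ext_ln x = (if x = 0 then -\<infinity> else if x = \<infinity> then \<infinity> else ereal (ln (enn2real x)))"

definition phi ::
    "'a measure \<Rightarrow> (nat \<Rightarrow> 'a \<Rightarrow> real) \<Rightarrow> (nat \<Rightarrow> real \<Rightarrow> 'a \<Rightarrow> real) \<Rightarrow> (real \<Rightarrow> real) \<Rightarrow> real \<Rightarrow> ereal"
  where
  "phi M S B f k =
     Sup {ereal \<zeta> | \<zeta>. exp_moment M (\<lambda>\<omega>. \<zeta> * S 1 \<omega> + k * cycle_reward S B f 1 \<omega>) \<le> 1}"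

definition rate_function ::
    "'a measure \<Rightarrow> (nat \<Rightarrow> 'a \<Rightarrow> real) \<Rightarrow> (nat \<Rightarrow> real \<Rightarrow> 'a \<Rightarrow> real) \<Rightarrow> (real \<Rightarrow> real) \<Rightarrow> real \<Rightarrow> ereal"
  where
  "rate_function M S B f w = (SUP k::real. ereal (w * k) + phi M S B f k)"

definition lower_semicontinuous :: "(real \<Rightarrow> ereal) \<Rightarrow> bool" where
  "lower_semicontinuous I \<longleftrightarrow> (\<forall>w. I w \<le> Liminf (at w) I)"

text \<open>The full large deviation principle for \<open>F t / t\<close> as \<open>t \<rightarrow> \<infinity>\<close>.\<close>

definition full_LDP :: "'a measure \<Rightarrow> (real \<Rightarrow> 'a \<Rightarrow> real) \<Rightarrow> (real \<Rightarrow> ereal) \<Rightarrow> bool" where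
  "full_LDP M F I \<longleftrightarrow>
     lower_semicontinuous I \<and>
     (\<forall>G. open G \<longrightarrow>
        Liminf at_top (\<lambda>t. ereal (1 / t) * ext_ln (emeasure M {\<omega> \<in> space M. F t \<omega> / t \<in> G}))
          \<ge> - (INF w\<in>G. I w)) \<and>
     (\<forall>K. closed K \<longrightarrow>
        Limsup at_top (\<lambda>t. ereal (1 / t) * ext_ln (emeasure M {\<omega> \<in> space M. F t \<omega> / t \<in> K}))
          \<le> - (INF w\<in>K. I w))"

definition good_rate :: "(real \<Rightarrow> ereal) \<Rightarrow> bool" where
  "good_rate I \<longleftrightarrow> (\<forall>a\<ge>0. compact {w. I w \<le> ereal a})"

end

theory Submission
  imports Defs
begin

text \<open>
  Only the i.i.d. triples \<open>(S n, X n, R n)\<close> of duration, reward and absolute reward of the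
  cycles matter: with \<open>T n\<close> and \<open>Y n\<close> the partial sums of durations and rewards, and with
  \<open>T n \<le> t < T m\<close>, the functional \<open>F t\<close> differs from \<open>Y n\<close> by at most \<open>R (n+1) + \<dots> + R m\<close>.
  Since \<open>R\<close> has all exponential moments, the error made in a short block of cycles, in
  particular in the cycle interrupted at time \<open>t\<close>, is negligible on the exponential scale.

  Upper bounds.  If \<open>\<zeta> < \<phi>(k)\<close>, then \<open>q = E exp (\<zeta> S + k X) < 1\<close>.  Splitting
  \<open>E exp (k F t)\<close> according to the number \<open>n\<close> of complete cycles, the \<open>n\<close>-th summand is at most
  \<open>exp (- \<zeta> t) * q ^ n\<close> times a moment of the interrupted cycle, which is finite
  (\<open>last_cycle_moment_finite\<close>).  The geometric series gives \<open>E exp (k F t) \<le> C exp (- \<zeta> t)\<close>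
  (\<open>exp_moment_F_le\<close>), hence the upper half of \<open>g = - \<phi>\<close> and, by Chernoff's bound on half-lines
  and a finite cover, the upper bound of the large deviation principle.

  Lower bounds.  Call \<open>(w, r)\<close> attainable if, for all large \<open>t\<close>, some number of cycles satisfies
  \<open>(T n, Y n) \<approx> (t, w t)\<close> with probability at least \<open>exp (- r t)\<close> up to arbitrarily small
  errors in all places.  If \<open>E exp (\<zeta> S + k X) > 1\<close>, truncating the cycles and tilting their law
  by \<open>exp (\<zeta> S + k X)\<close> produces, by the law of large numbers under the tilted law, a speed \<open>w\<close>
  for which \<open>(w, \<zeta> + k w)\<close> is attainable (\<open>attainable_of_moment_gt_1\<close>).  This settles the lower
  half of \<open>g = - \<phi>\<close>.  Because independent blocks of cycles can be concatenated, the attainable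
  set is convex; it is also closed.  If \<open>(w0, r)\<close> were not attainable, a line through it would
  lie below the attainable set; comparing its slope with the attainable points just
  described gives \<open>\<phi>(k) \<ge> r - k w0\<close> for some \<open>k\<close>, that is \<open>I(w0) \<ge> r\<close>.  So every \<open>r > I(w0)\<close> is
  attainable (\<open>attainable_of_rate_less\<close>).  The linear pieces of \<open>I\<close>, which come from
  single very long cycles, are covered as well: the truncation level is arbitrary, so a
  long cycle is one of the blocks.

  It remains to see that the triples are i.i.d. although the processes are known only
  through their laws on the product \<open>\<sigma>\<close>-algebra, where time integrals of paths are not
  measurable.  By Fubini's theorem the conditional expectation of a time integral given the path
  is the same functional of the path for every cycle, and it agrees with the integral itself
  almost surely (\<open>time_integral_factorises\<close>).
\<close>

section \<open>Elementary estimates\<close>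

declare One_nat_def [simp del]

lemma exp_le_quadratic:
  fixes x :: real
  assumes "\<bar>x\<bar> \<le> 1"
  shows "exp x \<le> 1 + x + x\<^sup>2"
proof (cases "0 \<le> x")
  case True
  then show ?thesis using exp_bound[of x] assms by simp
next
  case False
  have "1 - x \<le> exp (- x)"
    using exp_ge_add_one_self[of "- x"] by simp
  then have "exp x * (1 - x) \<le> exp x * exp (- x)"
    by (intro mult_left_mono) auto
  also have "\<dots> = 1"
    by (simp add: exp_minus)
  also have "1 \<le> 1 - x * (x * x)"
    using False by (simp add: mult_nonpos_nonneg)
  also have "\<dots> = (1 + x + x\<^sup>2) * (1 - x)"
    by (simp add: algebra_simps power2_eq_square)
  finally show ?thesis
    using False by (simp only: mult_le_cancel_right)
qed

lemma mult_le_abs_mult: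
  fixes x y c :: real
  assumes "\<bar>y\<bar> \<le> c"
  shows "x * y \<le> \<bar>x\<bar> * c"
proof -
  have "x * y \<le> \<bar>x\<bar> * \<bar>y\<bar>"
    by (metis abs_ge_self abs_mult)
  also have "\<dots> \<le> \<bar>x\<bar> * c"
    using assms by (intro mult_left_mono) auto
  finally show ?thesis .
qed

lemma eventually_linear_ge:
  fixes a y :: real
  assumes "0 < a"
  shows "\<forall>\<^sub>F t in at_top. y \<le> a * t"
  using filterlim_tendsto_pos_mult_at_top[OF tendsto_const assms filterlim_ident]
  unfolding filterlim_at_top by blast

text \<open>
  A vertical separating line is replaced by a steep one: this is possible because the set
  lies in the upper half plane.
\<close>

lemma supporting_line:
  fixes A :: "(real \<times> real) set"
  assumes "convex A" "closed A" and nonneg: "\<And>w r. (w, r) \<in> A \<Longrightarrow> 0 \<le> r"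
    and up: "\<And>w r r'. (w, r) \<in> A \<Longrightarrow> r \<le> r' \<Longrightarrow> (w, r') \<in> A"
    and notin: "(w0, r0) \<notin> A"
  shows "\<exists>k. \<forall>(w, r)\<in>A. r0 + k * (w - w0) \<le> r"
proof (cases "A = {}")
  case False
  then obtain w1 r1 where 1: "(w1, r1) \<in> A" by auto
  obtain z b where sep: "inner z (w0, r0) < b" "\<forall>v\<in>A. b < inner z v"
    using separating_hyperplane_closed_point[OF assms(1,2) notin] by blast
  obtain p q where z: "z = (p, q)" by (cases z)
  have s0: "p * w0 + q * r0 < b" and s: "\<And>w r. (w, r) \<in> A \<Longrightarrow> b < p * w + q * r"
    using sep by (auto simp: z)
  have "0 \<le> q"
  proof (rule ccontr)
    assume q: "\<not> 0 \<le> q"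
    define r where "r = max r1 ((b - p * w1) / q)"
    have "(w1, r) \<in> A" using up[OF 1] by (simp add: r_def)
    from s[OF this] have "b < p * w1 + q * r" .
    moreover have "q * r \<le> q * ((b - p * w1) / q)"
      using q by (intro mult_left_mono_neg) (auto simp: r_def)
    ultimately show False using q by simp
  qed
  then consider "q > 0" | "q = 0" by linarith
  then show ?thesis
  proof cases
    case 1
    show ?thesis
    proof (intro exI[of _ "- (p / q)"] ballI, clarify)
      fix w r assume "(w, r) \<in> A"
      then have "p * w0 + q * r0 \<le> p * w + q * r" using s s0 by force
      then show "r0 + - (p / q) * (w - w0) \<le> r" using 1 by (simp add: field_simps)
    qed
  next
    case 2
    define N where "N = max 0 (r0 / (b - p * w0))"
    have N: "N \<ge> 0" "r0 \<le> N * (b - p * w0)"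
      using s0 2 by (auto simp: N_def max_def field_simps mult_le_0_iff split: if_splits)
    show ?thesis
    proof (intro exI[of _ "- (N * p)"] ballI, clarify)
      fix w r assume A: "(w, r) \<in> A"
      have "N * (b - p * w) \<le> 0"
        using s[OF A] 2 N by (intro mult_nonneg_nonpos) auto
      then show "r0 + - (N * p) * (w - w0) \<le> r"
        using nonneg[OF A] N by (simp add: algebra_simps)
    qed
  qed
qed auto

lemma le_scaled_ext_ln_iff:
  assumes "t > 0"
  shows "ereal c \<le> ereal (1 / t) * ext_ln p \<longleftrightarrow> ennreal (exp (c * t)) \<le> p"
proof (cases p)
  case (real x)
  show ?thesis
  proof (cases "x = 0")
    case False
    then have x: "x > 0" using real by simp
    have "c \<le> 1 / t * ln x \<longleftrightarrow> c * t \<le> ln x" using assms by (simp add: field_simps)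
    also have "\<dots> \<longleftrightarrow> exp (c * t) \<le> x" using x by (metis exp_le_cancel_iff exp_ln)
    finally show ?thesis using real x by (simp add: ext_ln_def)
  qed (use real assms in \<open>simp add: ext_ln_def\<close>)
qed (use assms in \<open>simp add: ext_ln_def\<close>)

lemma scaled_ext_ln_le_iff:
  assumes "t > 0"
  shows "ereal (1 / t) * ext_ln p \<le> ereal c \<longleftrightarrow> p \<le> ennreal (exp (c * t))"
proof (cases p)
  case (real x)
  show ?thesis
  proof (cases "x = 0")
    case False
    then have x: "x > 0" using real by simp
    have "1 / t * ln x \<le> c \<longleftrightarrow> ln x \<le> c * t" using assms by (simp add: field_simps)
    also have "\<dots> \<longleftrightarrow> x \<le> exp (c * t)" using x by (metis exp_le_cancel_iff exp_ln)
    finally show ?thesis using real x by (simp add: ext_ln_def)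
  qed (use real assms in \<open>simp add: ext_ln_def\<close>)
qed (use assms in \<open>simp add: ext_ln_def top_unique\<close>)

section \<open>Renewal-reward cycles and their partial sums\<close>

text \<open>
  Here \<open>S\<close> is the duration of a cycle, \<open>X\<close> its reward, and \<open>R\<close> a bound for the reward
  collected over any part of the cycle.  The triple is kept as one random vector \<open>V\<close> so that
  independence and equality in law can be used for all three at once.
\<close>

locale renewal_rewards = prob_space M
  for M :: "'a measure" +
  fixes V :: "nat \<Rightarrow> 'a \<Rightarrow> real \<times> real \<times> real"
    and S X R :: "nat \<Rightarrow> 'a \<Rightarrow> real"
  defines "S \<equiv> \<lambda>n \<omega>. fst (V n \<omega>)"
    and "X \<equiv> \<lambda>n \<omega>. fst (snd (V n \<omega>))"
    and "R \<equiv> \<lambda>n \<omega>. snd (snd (V n \<omega>))"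
  assumes V_indep: "indep_vars (\<lambda>_. borel) V {1..}"
    and V_ident: "\<And>n. n \<ge> 1 \<Longrightarrow> distr M borel (V n) = distr M borel (V 1)"
    and S_nonneg: "\<And>n \<omega>. n \<ge> 1 \<Longrightarrow> \<omega> \<in> space M \<Longrightarrow> 0 \<le> S n \<omega>"
    and X_le_R: "\<And>n \<omega>. n \<ge> 1 \<Longrightarrow> \<omega> \<in> space M \<Longrightarrow> \<bar>X n \<omega>\<bar> \<le> R n \<omega>"
    and X_zero: "\<And>n \<omega>. n \<ge> 1 \<Longrightarrow> \<omega> \<in> space M \<Longrightarrow> S n \<omega> = 0 \<Longrightarrow> X n \<omega> = 0"
    and S_nontrivial: "prob {\<omega> \<in> space M. S 1 \<omega> = 0} < 1"
    and R_moments: "\<And>\<rho>::real. \<rho> > 0 \<Longrightarrow> exp_moment M (\<lambda>\<omega>. \<rho> * R 1 \<omega>) < \<infinity>"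
begin

abbreviation T where "T \<equiv> renewal_time S"

definition Y where "Y n \<omega> = (\<Sum>i=1..n. X i \<omega>)"

lemma V_measurable: "n \<ge> 1 \<Longrightarrow> V n \<in> borel_measurable M"
  using V_indep by (auto simp: indep_vars_def)

lemma snd_snd_borel: "(\<lambda>v::real\<times>real\<times>real. snd (snd v)) \<in> borel_measurable borel"
  and fst_snd_borel: "(\<lambda>v::real\<times>real\<times>real. fst (snd v)) \<in> borel_measurable borel"
  and fst_borel: "(\<lambda>v::real\<times>real\<times>real. fst v) \<in> borel_measurable borel"
  by (intro borel_measurable_continuous_onI continuous_intros)+

lemma S_measurable: "n \<ge> 1 \<Longrightarrow> S n \<in> borel_measurable M"
  and X_measurable: "n \<ge> 1 \<Longrightarrow> X n \<in> borel_measurable M"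
  and R_measurable: "n \<ge> 1 \<Longrightarrow> R n \<in> borel_measurable M"
  unfolding S_def X_def R_def
  using measurable_compose[OF V_measurable fst_borel] measurable_compose[OF V_measurable fst_snd_borel]
    measurable_compose[OF V_measurable snd_snd_borel] by auto

lemma T_measurable [measurable]: "T n \<in> borel_measurable M"
  unfolding renewal_time_def[abs_def] by (intro borel_measurable_sum S_measurable) auto

lemma Y_measurable [measurable]: "Y n \<in> borel_measurable M"
  unfolding Y_def[abs_def] by (intro borel_measurable_sum X_measurable) auto

lemma nn_integral_V:
  assumes "n \<ge> 1" "g \<in> borel_measurable borel"
  shows "(\<integral>\<^sup>+\<omega>. g (V n \<omega>) \<partial>M) = (\<integral>\<^sup>+\<omega>. g (V 1 \<omega>) \<partial>M)"
  using nn_integral_distr[of "V n" M borel g] nn_integral_distr[of "V 1" M borel g]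
    V_measurable[of n] V_measurable[of 1] V_ident[OF assms(1)] assms by simp

lemma nn_integral_prod_V:
  assumes "finite I" "I \<subseteq> {1..}" "\<And>i. i \<in> I \<Longrightarrow> g i \<in> borel_measurable borel"
  shows "(\<integral>\<^sup>+\<omega>. (\<Prod>i\<in>I. g i (V i \<omega>)) \<partial>M) = (\<Prod>i\<in>I. \<integral>\<^sup>+\<omega>. g i (V 1 \<omega>) \<partial>M)"
proof -
  have "indep_vars (\<lambda>_. borel) (\<lambda>i \<omega>. g i (V i \<omega>)) I"
    by (rule indep_vars_compose2[OF indep_vars_subset[OF V_indep]]) (use assms in auto)
  then have "(\<integral>\<^sup>+\<omega>. (\<Prod>i\<in>I. g i (V i \<omega>)) \<partial>M) = (\<Prod>i\<in>I. \<integral>\<^sup>+\<omega>. g i (V i \<omega>) \<partial>M)"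
    using assms by (intro indep_vars_nn_integral) auto
  also have "\<dots> = (\<Prod>i\<in>I. \<integral>\<^sup>+\<omega>. g i (V 1 \<omega>) \<partial>M)"
    using assms by (intro prod.cong refl nn_integral_V) auto
  finally show ?thesis .
qed

lemma nn_integral_power_V:
  assumes "g \<in> borel_measurable borel"
  shows "(\<integral>\<^sup>+\<omega>. (\<Prod>i=1..n. g (V i \<omega>)) \<partial>M) = (\<integral>\<^sup>+\<omega>. g (V 1 \<omega>) \<partial>M) ^ n"
  by (subst nn_integral_prod_V) (use assms in auto)

text \<open>
  The weights \<open>w\<close> are not normalised: with \<open>w = 1\<close> this is Chernoff's inequality, and with
  \<open>w = exp (\<zeta> S + k X)\<close> it controls deviations under the tilted law without constructing that
  law.
\<close>

lemma weighted_chernoff: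
  fixes w :: "real \<times> real \<times> real \<Rightarrow> ennreal" and h :: "real \<times> real \<times> real \<Rightarrow> real"
  assumes [measurable]: "w \<in> borel_measurable borel" "h \<in> borel_measurable borel"
  shows "(\<integral>\<^sup>+\<omega>. (\<Prod>i=1..n. w (V i \<omega>)) * indicator {\<omega>. x \<le> (\<Sum>i=1..n. h (V i \<omega>))} \<omega> \<partial>M)
    \<le> ennreal (exp (- x)) * (\<integral>\<^sup>+\<omega>. w (V 1 \<omega>) * ennreal (exp (h (V 1 \<omega>))) \<partial>M) ^ n"
proof -
  have [measurable]: "i \<in> {1..n} \<Longrightarrow> V i \<in> borel_measurable M" for i
    using V_measurable by auto
  have "(\<integral>\<^sup>+\<omega>. (\<Prod>i=1..n. w (V i \<omega>)) * indicator {\<omega>. x \<le> (\<Sum>i=1..n. h (V i \<omega>))} \<omega> \<partial>M)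
     \<le> (\<integral>\<^sup>+\<omega>. ennreal (exp (- x)) * (\<Prod>i=1..n. w (V i \<omega>) * ennreal (exp (h (V i \<omega>)))) \<partial>M)"
  proof (intro nn_integral_mono)
    fix \<omega>
    have "indicator {\<omega>. x \<le> (\<Sum>i=1..n. h (V i \<omega>))} \<omega> \<le> ennreal (exp (- x) * exp (\<Sum>i=1..n. h (V i \<omega>)))"
      by (auto simp: indicator_def exp_add[symmetric] simp flip: ennreal_1 intro!: ennreal_leI)
    also have "\<dots> = ennreal (exp (- x)) * (\<Prod>i=1..n. ennreal (exp (h (V i \<omega>))))"
      by (subst ennreal_mult) (auto simp: exp_sum prod_ennreal intro!: prod_nonneg)
    finally have "(\<Prod>i=1..n. w (V i \<omega>)) * indicator {\<omega>. x \<le> (\<Sum>i=1..n. h (V i \<omega>))} \<omega>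
      \<le> (\<Prod>i=1..n. w (V i \<omega>)) * (ennreal (exp (- x)) * (\<Prod>i=1..n. ennreal (exp (h (V i \<omega>)))))"
      by (intro mult_left_mono) auto
    then show "(\<Prod>i=1..n. w (V i \<omega>)) * indicator {\<omega>. x \<le> (\<Sum>i=1..n. h (V i \<omega>))} \<omega>
      \<le> ennreal (exp (- x)) * (\<Prod>i=1..n. w (V i \<omega>) * ennreal (exp (h (V i \<omega>))))"
      by (simp add: prod.distrib ac_simps)
  qed
  also have "\<dots> = ennreal (exp (- x)) * (\<integral>\<^sup>+\<omega>. (\<Prod>i=1..n. w (V i \<omega>) * ennreal (exp (h (V i \<omega>)))) \<partial>M)"
    by (intro nn_integral_cmult borel_measurable_prod borel_measurable_times_ennreal
       measurable_compose[OF V_measurable]) auto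
  also have "(\<integral>\<^sup>+\<omega>. (\<Prod>i=1..n. w (V i \<omega>) * ennreal (exp (h (V i \<omega>)))) \<partial>M)
      = (\<integral>\<^sup>+\<omega>. w (V 1 \<omega>) * ennreal (exp (h (V 1 \<omega>))) \<partial>M) ^ n"
    using nn_integral_power_V[of "\<lambda>v. w v * ennreal (exp (h v))" n] by simp
  finally show ?thesis .
qed

lemma chernoff:
  fixes h :: "real \<times> real \<times> real \<Rightarrow> real"
  assumes h [measurable]: "h \<in> borel_measurable borel"
  shows "emeasure M {\<omega>\<in>space M. x \<le> (\<Sum>i=1..n. h (V i \<omega>))}
    \<le> ennreal (exp (- x)) * exp_moment M (\<lambda>\<omega>. h (V 1 \<omega>)) ^ n"
proof -
  have "(\<lambda>\<omega>. \<Sum>i=1..n. h (V i \<omega>)) \<in> borel_measurable M"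
    by (intro borel_measurable_sum measurable_compose[OF V_measurable h]) auto
  then have "{\<omega>\<in>space M. x \<le> (\<Sum>i=1..n. h (V i \<omega>))} \<in> sets M"
    by measurable
  have "emeasure M {\<omega>\<in>space M. x \<le> (\<Sum>i=1..n. h (V i \<omega>))} =
     (\<integral>\<^sup>+\<omega>. indicator {\<omega>\<in>space M. x \<le> (\<Sum>i=1..n. h (V i \<omega>))} \<omega> \<partial>M)"
    by (intro nn_integral_indicator[symmetric]) fact
  also have "\<dots> = (\<integral>\<^sup>+\<omega>. (\<Prod>i=1..n. 1) * indicator {\<omega>. x \<le> (\<Sum>i=1..n. h (V i \<omega>))} \<omega> \<partial>M)"
    by (intro nn_integral_cong) (auto simp: indicator_def)
  also have "\<dots> \<le> ennreal (exp (- x)) * exp_moment M (\<lambda>\<omega>. h (V 1 \<omega>)) ^ n"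
    using weighted_chernoff[of "\<lambda>_. 1" h n x] by (simp add: exp_moment_def)
  finally show ?thesis .
qed

lemma sum_V_measurable: "(\<lambda>\<omega>. \<Sum>i=Suc n..n+m. V i \<omega>) \<in> borel_measurable M"
  by (intro borel_measurable_sum V_measurable) auto

lemma indep_sum_blocks:
  "indep_var borel (\<lambda>\<omega>. \<Sum>i=Suc n..n+m. V i \<omega>) borel (\<lambda>\<omega>. \<Sum>i=Suc (n+m)..n+m+k. V i \<omega>)"
proof -
  let ?A = "{Suc n..n+m}" and ?B = "{Suc (n+m)..n+m+k}"
  have *: "(\<lambda>f. \<Sum>i\<in>A. f i) \<in> measurable (PiM A (\<lambda>_. borel)) (borel :: (real\<times>real\<times>real) measure)" for A :: "nat set"
    by (intro borel_measurable_sum measurable_component_singleton)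
  have "indep_var borel ((\<lambda>f. \<Sum>i\<in>?A. f i) \<circ> (\<lambda>\<omega>. restrict (\<lambda>i. V i \<omega>) ?A))
    borel ((\<lambda>f. \<Sum>i\<in>?B. f i) \<circ> (\<lambda>\<omega>. restrict (\<lambda>i. V i \<omega>) ?B))"
    by (intro indep_var_compose[OF indep_var_restrict[OF V_indep]] *) auto
  then show ?thesis
    by (simp add: comp_def cong: sum.cong_simp)
qed

text \<open>
  By induction both sides are the \<open>m\<close>-fold convolution power of the law of \<open>V 1\<close>.
\<close>

lemma distr_sum_shift:
  "distr M borel (\<lambda>\<omega>. \<Sum>i=Suc n..n+m. V i \<omega>) = distr M borel (\<lambda>\<omega>. \<Sum>i=Suc 0..m. V i \<omega>)"
proof (induction m)
  case (Suc m)
  have add: "(\<lambda>(x, y). x + y) \<in> measurable (borel \<Otimes>\<^sub>M borel) (borel :: (real\<times>real\<times>real) measure)"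
    by measurable
  have step: "distr M borel (\<lambda>\<omega>. \<Sum>i=Suc n..n+Suc m. V i \<omega>)
     = distr (distr M borel (\<lambda>\<omega>. \<Sum>i=Suc n..n+m. V i \<omega>) \<Otimes>\<^sub>M distr M borel (V 1)) borel (\<lambda>(x, y). x + y)" for n
  proof -
    have "(\<lambda>\<omega>. \<Sum>i=Suc n..n+Suc m. V i \<omega>) =
      (\<lambda>(x, y). x + y) \<circ> (\<lambda>\<omega>. (\<Sum>i=Suc n..n+m. V i \<omega>, \<Sum>i=Suc (n+m)..n+m+1. V i \<omega>))"
      by (auto simp: fun_eq_iff One_nat_def)
    then have "distr M borel (\<lambda>\<omega>. \<Sum>i=Suc n..n+Suc m. V i \<omega>) =
       distr (distr M (borel \<Otimes>\<^sub>M borel) (\<lambda>\<omega>. (\<Sum>i=Suc n..n+m. V i \<omega>, \<Sum>i=Suc (n+m)..n+m+1. V i \<omega>))) borel (\<lambda>(x, y). x + y)"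
      using sum_V_measurable[of n m] sum_V_measurable[of "n+m" 1]
      by (subst distr_distr[OF add]) (auto intro!: measurable_Pair)
    also have "distr M (borel \<Otimes>\<^sub>M borel) (\<lambda>\<omega>. (\<Sum>i=Suc n..n+m. V i \<omega>, \<Sum>i=Suc (n+m)..n+m+1. V i \<omega>))
      = distr M borel (\<lambda>\<omega>. \<Sum>i=Suc n..n+m. V i \<omega>) \<Otimes>\<^sub>M distr M borel (V (Suc (n + m)))"
      using indep_sum_blocks[of n m 1] unfolding indep_var_distribution_eq by (simp add: One_nat_def)
    also have "distr M borel (V (Suc (n + m))) = distr M borel (V 1)"
      by (rule V_ident) simp
    finally show ?thesis .
  qed
  show ?case
    using step[of n] step[of 0] Suc.IH by (simp add: One_nat_def)
qed simp

text \<open>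
  Concatenating consecutive blocks of cycles multiplies probabilities.  This is the source of
  convexity in the lower bound.
\<close>

lemma prob_blocks:
  assumes [measurable]: "A \<in> sets borel" "C \<in> sets borel"
  shows "prob {\<omega>\<in>space M. (\<Sum>i=1..n. V i \<omega>) \<in> A \<and> (\<Sum>i=Suc n..n+m. V i \<omega>) \<in> C}
    = prob {\<omega>\<in>space M. (\<Sum>i=1..n. V i \<omega>) \<in> A} * prob {\<omega>\<in>space M. (\<Sum>i=1..m. V i \<omega>) \<in> C}"
proof -
  have iv: "indep_var borel (\<lambda>\<omega>. \<Sum>i=1..n. V i \<omega>) borel (\<lambda>\<omega>. \<Sum>i=Suc n..n+m. V i \<omega>)"
    using indep_sum_blocks[of 0 n m] by (simp add: One_nat_def)
  have "prob {\<omega>\<in>space M. (\<Sum>i=1..n. V i \<omega>) \<in> A \<and> (\<Sum>i=Suc n..n+m. V i \<omega>) \<in> C}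
    = prob ((\<lambda>\<omega>. \<Sum>i=1..n. V i \<omega>) -` A \<inter> space M \<inter> ((\<lambda>\<omega>. \<Sum>i=Suc n..n+m. V i \<omega>) -` C \<inter> space M))"
    by (intro arg_cong[where f=prob]) auto
  also have "\<dots> = prob ((\<lambda>\<omega>. \<Sum>i=1..n. V i \<omega>) -` A \<inter> space M) * prob ((\<lambda>\<omega>. \<Sum>i=Suc n..n+m. V i \<omega>) -` C \<inter> space M)"
    by (rule indep_setD[OF conjunct2[OF iv[unfolded indep_var_eq]]])
       (rule sigma_sets.Basic, use assms in blast)+
  also have "prob ((\<lambda>\<omega>. \<Sum>i=Suc n..n+m. V i \<omega>) -` C \<inter> space M) = measure (distr M borel (\<lambda>\<omega>. \<Sum>i=Suc n..n+m. V i \<omega>)) C"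
    using sum_V_measurable[of n m] by (simp add: measure_distr)
  also have "\<dots> = prob ((\<lambda>\<omega>. \<Sum>i=Suc 0..m. V i \<omega>) -` C \<inter> space M)"
    unfolding distr_sum_shift using sum_V_measurable[of 0 m] by (simp add: measure_distr)
  finally show ?thesis
    by (simp add: vimage_def Collect_conj_eq Int_commute One_nat_def)
qed

section \<open>Tilted cycles\<close>

text \<open>
  Under the law with density proportional to \<open>w\<close> the variable \<open>d\<close> is bounded and centred, so
  its exponential moment at \<open>s\<close> is at most \<open>1 + s\<^sup>2 b\<^sup>2\<close>; Chernoff's bound then shows that the sum
  of \<open>n\<close> copies exceeds \<open>\<delta> n\<close> with exponentially small probability.  This replaces the law of large
  numbers.
\<close>

lemma weighted_deviation:
  fixes w d :: "real \<times> real \<times> real \<Rightarrow> real"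
  assumes w [measurable]: "w \<in> borel_measurable borel" and d [measurable]: "d \<in> borel_measurable borel"
    and w_nonneg: "\<And>v. 0 \<le> w v"
    and w_int: "integrable M (\<lambda>\<omega>. w (V 1 \<omega>))"
    and d_bound: "\<And>\<omega>. \<omega> \<in> space M \<Longrightarrow> w (V 1 \<omega>) \<noteq> 0 \<Longrightarrow> \<bar>d (V 1 \<omega>)\<bar> \<le> b"
    and d_mean: "(\<integral>\<omega>. w (V 1 \<omega>) * d (V 1 \<omega>) \<partial>M) = 0"
    and \<delta>: "0 < \<delta>" "\<delta> \<le> b"
  shows "(\<integral>\<^sup>+\<omega>. (\<Prod>i=1..n. ennreal (w (V i \<omega>))) * indicator {\<omega>. \<delta> * n \<le> (\<Sum>i=1..n. d (V i \<omega>))} \<omega> \<partial>M)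
    \<le> ennreal (((\<integral>\<omega>. w (V 1 \<omega>) \<partial>M) * exp (- (\<delta>\<^sup>2 / (4 * b\<^sup>2)))) ^ n)"
proof -
  define m where "m = (\<integral>\<omega>. w (V 1 \<omega>) \<partial>M)"
  \<comment> \<open>the minimiser of \<open>s\<^sup>2 b\<^sup>2 - s \<delta>\<close>\<close>
  define s where "s = \<delta> / (2 * b\<^sup>2)"
  have b: "0 < b" using \<delta> by simp
  have s: "0 < s" "s * b \<le> 1"
    using \<delta> b by (auto simp: s_def power2_eq_square field_simps)
  have [measurable]: "V 1 \<in> borel_measurable M"
    by (rule V_measurable) simp
  have m: "0 \<le> m"
    unfolding m_def using w_nonneg by (intro integral_nonneg_AE) auto
  have wd_int: "integrable M (\<lambda>\<omega>. w (V 1 \<omega>) * d (V 1 \<omega>))"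
  proof (rule Bochner_Integration.integrable_bound[OF integrable_mult_right[OF w_int, of b]])
    show "AE \<omega> in M. norm (w (V 1 \<omega>) * d (V 1 \<omega>)) \<le> norm (b * w (V 1 \<omega>))"
    proof (intro AE_I2)
      fix \<omega> assume "\<omega> \<in> space M"
      then show "norm (w (V 1 \<omega>) * d (V 1 \<omega>)) \<le> norm (b * w (V 1 \<omega>))"
        using d_bound[of \<omega>] b w_nonneg[of "V 1 \<omega>"]
        by (cases "w (V 1 \<omega>) = 0") (auto simp: abs_mult mult.commute mult_left_mono)
    qed
  qed measurable
  have ptw: "w (V 1 \<omega>) * exp (s * d (V 1 \<omega>)) \<le> w (V 1 \<omega>) * (1 + s\<^sup>2 * b\<^sup>2) + s * (w (V 1 \<omega>) * d (V 1 \<omega>))"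
    if "\<omega> \<in> space M" for \<omega>
  proof (cases "w (V 1 \<omega>) = 0")
    case False
    let ?x = "s * d (V 1 \<omega>)"
    have db: "\<bar>d (V 1 \<omega>)\<bar> \<le> b" using d_bound that False by auto
    then have xb: "\<bar>?x\<bar> \<le> s * b"
      using s by (auto simp: abs_mult)
    have "exp ?x \<le> 1 + ?x + ?x\<^sup>2"
      using xb s by (intro exp_le_quadratic) auto
    also have "?x\<^sup>2 \<le> s\<^sup>2 * b\<^sup>2"
      using power_mono[OF xb, of 2] by (simp add: power_mult_distrib)
    finally have "w (V 1 \<omega>) * exp ?x \<le> w (V 1 \<omega>) * (1 + ?x + s\<^sup>2 * b\<^sup>2)"
      using w_nonneg by (intro mult_left_mono) auto
    then show ?thesis by (simp add: algebra_simps)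
  qed simp
  have "(\<integral>\<^sup>+\<omega>. ennreal (w (V 1 \<omega>)) * ennreal (exp (s * d (V 1 \<omega>))) \<partial>M)
     \<le> (\<integral>\<^sup>+\<omega>. ennreal (w (V 1 \<omega>) * (1 + s\<^sup>2 * b\<^sup>2) + s * (w (V 1 \<omega>) * d (V 1 \<omega>))) \<partial>M)"
    using ptw w_nonneg by (intro nn_integral_mono) (auto simp flip: ennreal_mult intro!: ennreal_leI)
  also have "\<dots> = ennreal (\<integral>\<omega>. w (V 1 \<omega>) * (1 + s\<^sup>2 * b\<^sup>2) + s * (w (V 1 \<omega>) * d (V 1 \<omega>)) \<partial>M)"
  proof (rule nn_integral_eq_integral)
    show "integrable M (\<lambda>\<omega>. w (V 1 \<omega>) * (1 + s\<^sup>2 * b\<^sup>2) + s * (w (V 1 \<omega>) * d (V 1 \<omega>)))"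
      using w_int wd_int by auto
    show "AE \<omega> in M. 0 \<le> w (V 1 \<omega>) * (1 + s\<^sup>2 * b\<^sup>2) + s * (w (V 1 \<omega>) * d (V 1 \<omega>))"
      by (intro AE_I2 order_trans[OF _ ptw] mult_nonneg_nonneg w_nonneg) auto
  qed
  also have "(\<integral>\<omega>. w (V 1 \<omega>) * (1 + s\<^sup>2 * b\<^sup>2) + s * (w (V 1 \<omega>) * d (V 1 \<omega>)) \<partial>M) = m * (1 + s\<^sup>2 * b\<^sup>2)"
    using w_int wd_int d_mean by (simp add: m_def)
  also have "ennreal (m * (1 + s\<^sup>2 * b\<^sup>2)) \<le> ennreal (m * exp (s\<^sup>2 * b\<^sup>2))"
    using m by (intro ennreal_leI mult_left_mono exp_ge_add_one_self)
  finally have mom: "(\<integral>\<^sup>+\<omega>. ennreal (w (V 1 \<omega>)) * ennreal (exp (s * d (V 1 \<omega>))) \<partial>M) \<le> ennreal (m * exp (s\<^sup>2 * b\<^sup>2))" .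
  have "(\<integral>\<^sup>+\<omega>. (\<Prod>i=1..n. ennreal (w (V i \<omega>))) * indicator {\<omega>. \<delta> * n \<le> (\<Sum>i=1..n. d (V i \<omega>))} \<omega> \<partial>M)
     = (\<integral>\<^sup>+\<omega>. (\<Prod>i=1..n. ennreal (w (V i \<omega>))) * indicator {\<omega>. s * (\<delta> * n) \<le> (\<Sum>i=1..n. s * d (V i \<omega>))} \<omega> \<partial>M)"
    using s by (intro nn_integral_cong) (simp add: indicator_def flip: sum_distrib_left)
  also have "\<dots> \<le> ennreal (exp (- (s * (\<delta> * n)))) * (\<integral>\<^sup>+\<omega>. ennreal (w (V 1 \<omega>)) * ennreal (exp (s * d (V 1 \<omega>))) \<partial>M) ^ n"
    by (rule weighted_chernoff) auto
  also have "\<dots> \<le> ennreal (exp (- (s * (\<delta> * n)))) * ennreal (m * exp (s\<^sup>2 * b\<^sup>2)) ^ n"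
    by (intro mult_left_mono power_mono mom) auto
  also have "\<dots> = ennreal (exp (- (s * (\<delta> * n))) * (m * exp (s\<^sup>2 * b\<^sup>2)) ^ n)"
    using m by (subst ennreal_power) (simp_all only: mult_nonneg_nonneg exp_ge_zero ennreal_mult[symmetric] zero_le_power)
  also have "exp (- (s * (\<delta> * n))) * (m * exp (s\<^sup>2 * b\<^sup>2)) ^ n = (m * (exp (s\<^sup>2 * b\<^sup>2) * exp (- (s * \<delta>)))) ^ n"
    by (simp add: power_mult_distrib exp_of_nat_mult[symmetric] ac_simps)
  also have "exp (s\<^sup>2 * b\<^sup>2) * exp (- (s * \<delta>)) = exp (- (\<delta>\<^sup>2 / (4 * b\<^sup>2)))"
  proof -
    have "s\<^sup>2 * b\<^sup>2 - s * \<delta> = - (\<delta>\<^sup>2 / (4 * b\<^sup>2))"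
      using b by (simp add: s_def field_simps power2_eq_square)
    then show ?thesis by (simp add: exp_add[symmetric])
  qed
  finally show ?thesis unfolding m_def .
qed

text \<open>
  After truncation the tilted cycle is bounded, so that its mean exists even if the moment on
  the left is infinite.
\<close>

lemma truncated_moment_gt_1:
  assumes "exp_moment M (\<lambda>\<omega>. \<zeta> * S 1 \<omega> + k * X 1 \<omega>) > 1"
  obtains c :: real where "c \<ge> 0"
    "1 < (\<integral>\<^sup>+\<omega>. ennreal (exp (\<zeta> * S 1 \<omega> + k * X 1 \<omega>)) * indicator {\<omega>. S 1 \<omega> \<le> c \<and> \<bar>X 1 \<omega>\<bar> \<le> c} \<omega> \<partial>M)"
proof -
  have [measurable]: "S 1 \<in> borel_measurable M" "X 1 \<in> borel_measurable M"
    by (auto intro: S_measurable X_measurable)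
  let ?g = "\<lambda>\<omega>. ennreal (exp (\<zeta> * S 1 \<omega> + k * X 1 \<omega>))"
  let ?f = "\<lambda>(c::nat) \<omega>. ?g \<omega> * indicator {\<omega>. S 1 \<omega> \<le> c \<and> \<bar>X 1 \<omega>\<bar> \<le> c} \<omega>"
  have inc: "incseq ?f"
    by (intro incseq_SucI le_funI mult_left_mono) (auto simp: indicator_def)
  have sup: "(SUP c. ?f c \<omega>) = ?g \<omega>" for \<omega>
  proof (rule antisym)
    show "(SUP c. ?f c \<omega>) \<le> ?g \<omega>"
      by (intro SUP_least) (auto simp: indicator_def)
    obtain c :: nat where "max (S 1 \<omega>) \<bar>X 1 \<omega>\<bar> \<le> c" using real_arch_simple by blast
    then have "?g \<omega> = ?f c \<omega>" by (auto simp: indicator_def)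
    also have "\<dots> \<le> (SUP c. ?f c \<omega>)" by (rule SUP_upper) simp
    finally show "?g \<omega> \<le> (SUP c. ?f c \<omega>)" .
  qed
  have meas: "?f c \<in> borel_measurable M" for c
    by measurable
  have "(SUP c. \<integral>\<^sup>+\<omega>. ?f c \<omega> \<partial>M) = (\<integral>\<^sup>+\<omega>. (SUP c. ?f c \<omega>) \<partial>M)"
    by (rule nn_integral_monotone_convergence_SUP[OF inc meas, symmetric])
  then have "1 < (SUP c. \<integral>\<^sup>+\<omega>. ?f c \<omega> \<partial>M)"
    using assms by (simp only: sup exp_moment_def)
  then obtain c :: nat where "1 < (\<integral>\<^sup>+\<omega>. ?f c \<omega> \<partial>M)"
    unfolding less_SUP_iff by blast
  then show ?thesis by (intro that[of "real c"]) simp_all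
qed

text \<open>
  The point \<open>(a, x)\<close> is the mean of \<open>(S, X)\<close> under the truncated law tilted by
  \<open>exp (\<zeta> S + k X)\<close>.  The total tilted mass \<open>m ^ n\<close> is at least one and, by
  \<open>weighted_deviation\<close>, at least half of it sits on \<open>(T n, Y n) \<approx> (n a, n x)\<close>, where the density
  is about \<open>exp (n (\<zeta> a + k x))\<close>.  The mean duration \<open>a\<close> is positive because cycles of length
  zero carry no reward and so contribute at most one to the moment.
\<close>

lemma tilted_concentration:
  assumes gt1: "exp_moment M (\<lambda>\<omega>. \<zeta> * S 1 \<omega> + k * X 1 \<omega>) > 1"
  obtains a x :: real where "a > 0"
    "\<And>\<delta>::real. \<delta> > 0 \<Longrightarrow> \<forall>\<^sub>F n in sequentially.
       exp (- (n * (\<zeta> * a + k * x + (\<bar>\<zeta>\<bar> + \<bar>k\<bar> + 1) * \<delta>)))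
        \<le> prob {\<omega>\<in>space M. \<bar>T n \<omega> - n * a\<bar> \<le> \<delta> * n \<and> \<bar>Y n \<omega> - n * x\<bar> \<le> \<delta> * n}"
proof -
  obtain c :: real where c: "c \<ge> 0"
    and c_gt1: "1 < (\<integral>\<^sup>+\<omega>. ennreal (exp (\<zeta> * S 1 \<omega> + k * X 1 \<omega>)) * indicator {\<omega>. S 1 \<omega> \<le> c \<and> \<bar>X 1 \<omega>\<bar> \<le> c} \<omega> \<partial>M)"
    by (rule truncated_moment_gt_1[OF gt1])
  define w :: "real \<times> real \<times> real \<Rightarrow> real" where
    "w v = exp (\<zeta> * fst v + k * fst (snd v)) * indicator {v. fst v \<le> c \<and> \<bar>fst (snd v)\<bar> \<le> c} v" for v
  note [measurable] = fst_borel fst_snd_borel snd_snd_borel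
  have w_meas [measurable]: "w \<in> borel_measurable borel"
    unfolding w_def[abs_def] by measurable
  have [measurable]: "S 1 \<in> borel_measurable M" "X 1 \<in> borel_measurable M" "V 1 \<in> borel_measurable M"
    by (auto intro: S_measurable X_measurable V_measurable)
  have w_nonneg: "0 \<le> w v" for v
    by (simp add: w_def)
  have w_le: "w v \<le> exp (\<zeta> * fst v + k * fst (snd v))" for v
    by (simp add: w_def indicator_def)
  have w_supp: "S 1 \<omega> \<in> {0..c} \<and> \<bar>X 1 \<omega>\<bar> \<le> c" if "\<omega> \<in> space M" "w (V 1 \<omega>) \<noteq> 0" for \<omega>
    using that S_nonneg[of 1 \<omega>] by (auto simp: w_def S_def X_def indicator_def split: if_splits)
  have wb: "w (V 1 \<omega>) \<le> exp ((\<bar>\<zeta>\<bar> + \<bar>k\<bar>) * c)" if "\<omega> \<in> space M" for \<omega>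
  proof (cases "w (V 1 \<omega>) = 0")
    case False
    have "\<zeta> * S 1 \<omega> + k * X 1 \<omega> \<le> \<bar>\<zeta>\<bar> * c + \<bar>k\<bar> * c"
      using w_supp[OF that False] by (intro add_mono mult_le_abs_mult) auto
    then have "exp (\<zeta> * S 1 \<omega> + k * X 1 \<omega>) \<le> exp ((\<bar>\<zeta>\<bar> + \<bar>k\<bar>) * c)"
      by (simp add: distrib_right)
    with w_le[of "V 1 \<omega>"] show ?thesis
      unfolding S_def X_def by (rule order_trans)
  qed simp
  have w_int: "integrable M (\<lambda>\<omega>. w (V 1 \<omega>))"
  proof (rule integrable_const_bound[of _ "exp ((\<bar>\<zeta>\<bar> + \<bar>k\<bar>) * c)"])
    show "AE \<omega> in M. norm (w (V 1 \<omega>)) \<le> exp ((\<bar>\<zeta>\<bar> + \<bar>k\<bar>) * c)"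
      using wb w_nonneg by (intro AE_I2) simp
  qed measurable
  have prod_int: "integrable M (\<lambda>\<omega>. w (V 1 \<omega>) * u \<omega>)"
    if [measurable]: "u \<in> borel_measurable M" and ub: "\<And>\<omega>. \<omega> \<in> space M \<Longrightarrow> w (V 1 \<omega>) \<noteq> 0 \<Longrightarrow> \<bar>u \<omega>\<bar> \<le> c" for u
  proof (rule Bochner_Integration.integrable_bound[OF integrable_mult_right[OF w_int, of c]])
    show "AE \<omega> in M. norm (w (V 1 \<omega>) * u \<omega>) \<le> norm (c * w (V 1 \<omega>))"
    proof (intro AE_I2)
      fix \<omega> assume "\<omega> \<in> space M"
      then show "norm (w (V 1 \<omega>) * u \<omega>) \<le> norm (c * w (V 1 \<omega>))"
        using ub[of \<omega>] c w_nonneg[of "V 1 \<omega>"]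
        by (cases "w (V 1 \<omega>) = 0") (auto simp: abs_mult mult.commute mult_left_mono)
    qed
  qed measurable
  have wS_int: "integrable M (\<lambda>\<omega>. w (V 1 \<omega>) * S 1 \<omega>)" and wX_int: "integrable M (\<lambda>\<omega>. w (V 1 \<omega>) * X 1 \<omega>)"
    using w_supp by (auto intro!: prod_int)
  define m where "m = (\<integral>\<omega>. w (V 1 \<omega>) \<partial>M)"
  have "ennreal m = (\<integral>\<^sup>+\<omega>. ennreal (w (V 1 \<omega>)) \<partial>M)"
    unfolding m_def using w_int w_nonneg by (intro nn_integral_eq_integral[symmetric]) auto
  also have "\<dots> = (\<integral>\<^sup>+\<omega>. ennreal (exp (\<zeta> * S 1 \<omega> + k * X 1 \<omega>)) * indicator {\<omega>. S 1 \<omega> \<le> c \<and> \<bar>X 1 \<omega>\<bar> \<le> c} \<omega> \<partial>M)"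
    by (intro nn_integral_cong) (auto simp: w_def S_def X_def indicator_def)
  finally have "1 < ennreal m" using c_gt1 by simp
  then have m: "1 < m" by (metis ennreal_1 ennreal_less_iff zero_le_one)
  define a where "a = (\<integral>\<omega>. w (V 1 \<omega>) * S 1 \<omega> \<partial>M) / m"
  define x where "x = (\<integral>\<omega>. w (V 1 \<omega>) * X 1 \<omega> \<partial>M) / m"
  have "0 \<le> (\<integral>\<omega>. w (V 1 \<omega>) * S 1 \<omega> \<partial>M)"
    using w_nonneg S_nonneg by (intro integral_nonneg_AE AE_I2) auto
  moreover have "(\<integral>\<omega>. w (V 1 \<omega>) * S 1 \<omega> \<partial>M) \<noteq> 0"
  proof
    assume "(\<integral>\<omega>. w (V 1 \<omega>) * S 1 \<omega> \<partial>M) = 0"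
    then have "AE \<omega> in M. w (V 1 \<omega>) * S 1 \<omega> = 0"
      using w_nonneg S_nonneg by (subst (asm) integral_nonneg_eq_0_iff_AE[OF wS_int]) (auto intro!: AE_I2)
    then have "AE \<omega> in M. w (V 1 \<omega>) \<le> 1"
      using AE_space
    proof eventually_elim
      case (elim \<omega>)
      then show ?case
        using X_zero[of 1 \<omega>] w_le[of "V 1 \<omega>"] by (auto simp: S_def X_def)
    qed
    then have "m \<le> (\<integral>\<omega>. 1 \<partial>M)"
      unfolding m_def using w_int by (intro integral_mono_AE) auto
    then show False using m by (simp add: prob_space)
  qed
  ultimately have a: "a > 0"
    using m by (simp add: a_def)
  show ?thesis
  proof (rule that[OF a])
    fix \<delta> :: real assume \<delta>: "\<delta> > 0"
    define b where "b = max \<delta> (c + \<bar>a\<bar> + \<bar>x\<bar>)"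
    define \<kappa> where "\<kappa> = \<delta>\<^sup>2 / (4 * b\<^sup>2)"
    have b: "b > 0" "\<delta> \<le> b" using \<delta> by (auto simp: b_def)
    then have \<kappa>: "\<kappa> > 0" using \<delta> by (auto simp: \<kappa>_def)
    define G where "G n = {\<omega>\<in>space M. \<bar>T n \<omega> - n * a\<bar> \<le> \<delta> * n \<and> \<bar>Y n \<omega> - n * x\<bar> \<le> \<delta> * n}" for n :: nat
    have G_meas [measurable]: "G n \<in> sets M" for n unfolding G_def by measurable
    \<comment> \<open>the four one-sided deviations of \<open>T n\<close> and \<open>Y n\<close> from their tilted means\<close>
    define D :: "nat \<Rightarrow> real \<times> real \<times> real \<Rightarrow> real" where
      "D j v = (if j = 0 then fst v - a else if j = 1 then a - fst v else if j = 2 then fst (snd v) - x else x - fst (snd v))" for j v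
    let ?w = "\<lambda>n \<omega>. \<Prod>i=1..n. ennreal (w (V i \<omega>))"
    let ?Bad = "\<lambda>n j. {\<omega>. \<delta> * real n \<le> (\<Sum>i=1..n. D j (V i \<omega>))}"
    have D_meas [measurable]: "D j \<in> borel_measurable borel" for j
      unfolding D_def[abs_def] by measurable
    have dev: "(\<integral>\<^sup>+\<omega>. ?w n \<omega> * indicator (?Bad n j) \<omega> \<partial>M) \<le> ennreal ((m * exp (- \<kappa>)) ^ n)" for n j
      unfolding m_def \<kappa>_def
    proof (rule weighted_deviation)
      show "\<bar>D j (V 1 \<omega>)\<bar> \<le> b" if "\<omega> \<in> space M" "w (V 1 \<omega>) \<noteq> 0" for \<omega>
        using w_supp[OF that] by (auto simp: D_def b_def S_def X_def)
      show "(\<integral>\<omega>. w (V 1 \<omega>) * D j (V 1 \<omega>) \<partial>M) = 0"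
      proof -
        have D1: "D j (V 1 \<omega>) = (if j = 0 then S 1 \<omega> - a else if j = 1 then a - S 1 \<omega>
            else if j = 2 then X 1 \<omega> - x else x - X 1 \<omega>)" for \<omega>
          by (simp add: D_def S_def X_def)
        have "(\<integral>\<omega>. w (V 1 \<omega>) * S 1 \<omega> \<partial>M) = m * a" "(\<integral>\<omega>. w (V 1 \<omega>) * X 1 \<omega> \<partial>M) = m * x"
          using m by (auto simp: a_def x_def)
        then show ?thesis
          using wS_int wX_int w_int unfolding D1
          by (cases "j = 0"; cases "j = 1"; cases "j = 2") (simp_all add: right_diff_distrib m_def[symmetric])
      qed
    qed (use w_nonneg w_int \<delta> b in auto)
    have sumD: "(\<Sum>i=1..n. D 0 (V i \<omega>)) = T n \<omega> - n * a" "(\<Sum>i=1..n. D 1 (V i \<omega>)) = n * a - T n \<omega>"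
      "(\<Sum>i=1..n. D 2 (V i \<omega>)) = Y n \<omega> - n * x" "(\<Sum>i=1..n. D 3 (V i \<omega>)) = n * x - Y n \<omega>" for n \<omega>
      by (auto simp: D_def renewal_time_def Y_def S_def X_def sum_subtractf)
    have meas_n: "(\<lambda>\<omega>. ?w n \<omega>) \<in> borel_measurable M" for n
      by (intro borel_measurable_prod_ennreal measurable_compose[OF V_measurable]) auto
    have bad_meas: "{\<omega>\<in>space M. \<delta> * real n \<le> (\<Sum>i=1..n. D j (V i \<omega>))} \<in> sets M" for n j
    proof -
      have "(\<lambda>\<omega>. \<Sum>i=1..n. D j (V i \<omega>)) \<in> borel_measurable M"
        by (intro borel_measurable_sum measurable_compose[OF V_measurable D_meas]) auto
      then show ?thesis by measurable
    qed
    have main: "m ^ n \<le> exp (n * (\<zeta> * a + k * x + (\<bar>\<zeta>\<bar> + \<bar>k\<bar>) * \<delta>)) * prob (G n) + 4 * (m * exp (- \<kappa>)) ^ n" for n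
    proof -
      let ?e = "exp (n * (\<zeta> * a + k * x + (\<bar>\<zeta>\<bar> + \<bar>k\<bar>) * \<delta>))"
      have "ennreal (m ^ n) = (\<integral>\<^sup>+\<omega>. ennreal (w (V 1 \<omega>)) \<partial>M) ^ n"
        using m \<open>ennreal m = (\<integral>\<^sup>+\<omega>. ennreal (w (V 1 \<omega>)) \<partial>M)\<close> by (simp add: ennreal_power[symmetric])
      also have "\<dots> = (\<integral>\<^sup>+\<omega>. ?w n \<omega> \<partial>M)"
        by (rule nn_integral_power_V[symmetric]) measurable
      also have "\<dots> \<le> (\<integral>\<^sup>+\<omega>. ennreal ?e * indicator (G n) \<omega> +
          (\<Sum>j\<in>{0,1,2,3}. ?w n \<omega> * indicator {\<omega>\<in>space M. \<omega> \<in> ?Bad n j} \<omega>) \<partial>M)"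
      proof (intro nn_integral_mono)
        fix \<omega> assume \<omega>: "\<omega> \<in> space M"
        show "?w n \<omega> \<le> ennreal ?e * indicator (G n) \<omega> +
          (\<Sum>j\<in>{0,1,2,3}. ?w n \<omega> * indicator {\<omega>\<in>space M. \<omega> \<in> ?Bad n j} \<omega>)"
        proof (cases "\<omega> \<in> G n")
          case True
          have "?w n \<omega> = ennreal (\<Prod>i=1..n. w (V i \<omega>))"
            using w_nonneg by (simp add: prod_ennreal)
          also have "\<dots> \<le> ennreal (\<Prod>i=1..n. exp (\<zeta> * S i \<omega> + k * X i \<omega>))"
            unfolding S_def X_def using w_nonneg w_le by (intro ennreal_leI prod_mono) auto
          also have "(\<Prod>i=1..n. exp (\<zeta> * S i \<omega> + k * X i \<omega>)) = exp (\<zeta> * T n \<omega> + k * Y n \<omega>)"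
            by (simp add: exp_sum[symmetric] sum.distrib sum_distrib_left renewal_time_def Y_def)
          also have "\<zeta> * T n \<omega> + k * Y n \<omega> = n * (\<zeta> * a + k * x) + (\<zeta> * (T n \<omega> - n * a) + k * (Y n \<omega> - n * x))"
            by (simp add: algebra_simps)
          also have "\<dots> \<le> n * (\<zeta> * a + k * x) + (\<bar>\<zeta>\<bar> * (\<delta> * n) + \<bar>k\<bar> * (\<delta> * n))"
            using True unfolding G_def by (intro add_left_mono add_mono mult_le_abs_mult) auto
          also have "\<dots> = n * (\<zeta> * a + k * x + (\<bar>\<zeta>\<bar> + \<bar>k\<bar>) * \<delta>)"
            by (simp add: algebra_simps)
          finally have "?w n \<omega> \<le> ennreal ?e * indicator (G n) \<omega>"
            using True by (simp add: ennreal_leI)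
          then show ?thesis by (rule order_trans) simp
        next
          case False
          then have "\<exists>j\<in>{0,1,2,3}. \<omega> \<in> ?Bad n j"
            using \<omega> sumD[of \<omega> n] by (auto simp: G_def not_le abs_le_iff abs_less_iff)
          then obtain j where j: "j \<in> {0,1,2,3}" "\<omega> \<in> ?Bad n j" by blast
          then have "?w n \<omega> = ?w n \<omega> * indicator {\<omega>\<in>space M. \<omega> \<in> ?Bad n j} \<omega>"
            using \<omega> by simp
          also have "\<dots> \<le> (\<Sum>j\<in>{0,1,2,3}. ?w n \<omega> * indicator {\<omega>\<in>space M. \<omega> \<in> ?Bad n j} \<omega>)"
            by (rule member_le_sum[OF j(1)]) auto
          finally show ?thesis using False by simp
        qed
      qed
      also have "\<dots> = ennreal ?e * emeasure M (G n) +
          (\<Sum>j\<in>{0,1,2,3}. \<integral>\<^sup>+\<omega>. ?w n \<omega> * indicator {\<omega>\<in>space M. \<omega> \<in> ?Bad n j} \<omega> \<partial>M)"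
      proof -
        have wb_meas: "(\<lambda>\<omega>. ?w n \<omega> * indicator {\<omega>\<in>space M. \<omega> \<in> ?Bad n j} \<omega>) \<in> borel_measurable M" for j
          using bad_meas[of n j]
          by (intro borel_measurable_times_ennreal meas_n borel_measurable_indicator) simp
        have G_meas': "(\<lambda>\<omega>. ennreal ?e * indicator (G n) \<omega>) \<in> borel_measurable M"
          by measurable
        have "(\<integral>\<^sup>+\<omega>. ennreal ?e * indicator (G n) \<omega> \<partial>M) = ennreal ?e * emeasure M (G n)"
          by (rule nn_integral_cmult_indicator) (rule G_meas)
        moreover have "(\<integral>\<^sup>+\<omega>. (\<Sum>j\<in>{0,1,2,3}. ?w n \<omega> * indicator {\<omega>\<in>space M. \<omega> \<in> ?Bad n j} \<omega>) \<partial>M)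
          = (\<Sum>j\<in>{0,1,2,3}. \<integral>\<^sup>+\<omega>. ?w n \<omega> * indicator {\<omega>\<in>space M. \<omega> \<in> ?Bad n j} \<omega> \<partial>M)"
          by (rule nn_integral_sum[OF wb_meas])
        ultimately show ?thesis
          by (simp only: nn_integral_add[OF G_meas' borel_measurable_sum[OF wb_meas]])
      qed
      also have "\<dots> \<le> ennreal ?e * emeasure M (G n) + (\<Sum>j\<in>{0,1,2,3::nat}. ennreal ((m * exp (- \<kappa>)) ^ n))"
        by (intro add_left_mono sum_mono order_trans[OF _ dev] nn_integral_mono mult_left_mono)
          (auto simp: indicator_def)
      also have "\<dots> = ennreal (?e * prob (G n) + 4 * (m * exp (- \<kappa>)) ^ n)"
      proof -
        have "ennreal (u * v + 4 * z) = ennreal u * ennreal v + 4 * ennreal z"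
          if "0 \<le> u" "0 \<le> v" "0 \<le> z" for u v z :: real
          using that by (simp add: ennreal_mult)
        from this[of ?e "prob (G n)" "(m * exp (- \<kappa>)) ^ n"] show ?thesis
          using m by (simp add: emeasure_eq_measure)
      qed
      finally show ?thesis
        using m by (subst (asm) ennreal_le_iff) auto
    qed
    have geom: "\<forall>\<^sub>F n in sequentially. exp (- y) ^ n < z" if "0 < y" "0 < z" for y z :: real
      using LIMSEQ_realpow_zero[of "exp (- y)"] that by (intro order_tendstoD(2)[of _ 0]) auto
    have "\<forall>\<^sub>F n in sequentially. exp (- \<kappa>) ^ n < 1/8" "\<forall>\<^sub>F n in sequentially. exp (- \<delta>) ^ n < 1/2"
      using geom[of \<kappa> "1/8"] geom[of \<delta> "1/2"] \<kappa> \<delta> by simp_all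
    then show "\<forall>\<^sub>F n in sequentially. exp (- (n * (\<zeta> * a + k * x + (\<bar>\<zeta>\<bar> + \<bar>k\<bar> + 1) * \<delta>))) \<le>
      prob {\<omega>\<in>space M. \<bar>T n \<omega> - n * a\<bar> \<le> \<delta> * n \<and> \<bar>Y n \<omega> - n * x\<bar> \<le> \<delta> * n}"
    proof eventually_elim
      case (elim n)
      let ?E = "n * (\<zeta> * a + k * x + (\<bar>\<zeta>\<bar> + \<bar>k\<bar>) * \<delta>)"
      have "4 * (m * exp (- \<kappa>)) ^ n \<le> m ^ n / 2"
        using elim(1) m by (simp add: power_mult_distrib)
      with main[of n] have "m ^ n / 2 \<le> exp ?E * prob (G n)"
        by linarith
      moreover have "1 \<le> m ^ n" using m by simp
      ultimately have half: "1 / 2 \<le> exp ?E * prob (G n)"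
        by linarith
      have "exp (- (n * (\<zeta> * a + k * x + (\<bar>\<zeta>\<bar> + \<bar>k\<bar> + 1) * \<delta>))) = exp (- ?E) * exp (- \<delta>) ^ n"
        by (simp add: exp_of_nat_mult[symmetric] exp_add[symmetric] algebra_simps)
      also have "\<dots> \<le> exp (- ?E) * (exp ?E * prob (G n))"
        using elim(2) half by (intro mult_left_mono) auto
      also have "\<dots> = prob (G n)"
        by (simp add: exp_minus)
      finally show ?case by (simp add: G_def)
    qed
  qed
qed

section \<open>Attainable speeds and their costs\<close>

definition window :: "nat \<Rightarrow> real \<Rightarrow> real \<Rightarrow> real \<Rightarrow> 'a set" where
  "window n t x e = {\<omega>\<in>space M. \<bar>T n \<omega> - t\<bar> \<le> e \<and> \<bar>Y n \<omega> - x\<bar> \<le> e}"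

text \<open>
  The second component is an upper bound for the exponential cost of the speed \<open>w\<close> at cycle
  boundaries.  Working with this set instead of a rate function defined by limits makes
  closedness and convexity direct consequences of the quantifiers.
\<close>

definition attainable :: "(real \<times> real) set" where
  "attainable = {(w, r). \<forall>\<delta>>0. \<forall>\<^sub>F t in at_top. \<exists>n. exp (- ((r + \<delta>) * t)) \<le> prob (window n t (w * t) (\<delta> * t))}"

lemma window_measurable [measurable]: "window n t x e \<in> sets M"
  unfolding window_def by measurable

lemma sum_V: "(\<Sum>i\<in>I. V i \<omega>) = (\<Sum>i\<in>I. S i \<omega>, \<Sum>i\<in>I. X i \<omega>, \<Sum>i\<in>I. R i \<omega>)"
  by (simp add: prod_eq_iff fst_sum snd_sum S_def X_def R_def)

lemma sum_split_blocks: "(\<Sum>i=1..n+m. g i) = (\<Sum>i=1..n. g i) + (\<Sum>i=Suc n..n+m. g i)" for g :: "nat \<Rightarrow> 'b::comm_monoid_add"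
  using sum.ub_add_nat[of 1 n g m] by (simp only: Suc_eq_plus1 le_add2)

lemma closed_window_set: "{v::real\<times>real\<times>real. \<bar>fst v - t\<bar> \<le> e \<and> \<bar>fst (snd v) - x\<bar> \<le> e} \<in> sets borel"
  by (intro borel_closed closed_Collect_conj closed_Collect_le continuous_intros)

lemma prob_window_mult:
  "prob (window n s x d) * prob (window m t y e) \<le> prob (window (n + m) (s + t) (x + y) (d + e))"
proof -
  let ?A = "\<lambda>t x e. {v::real\<times>real\<times>real. \<bar>fst v - t\<bar> \<le> e \<and> \<bar>fst (snd v) - x\<bar> \<le> e}"
  have window: "window n t x e = {\<omega>\<in>space M. (\<Sum>i=1..n. V i \<omega>) \<in> ?A t x e}" for n t x e
    by (simp add: window_def sum_V renewal_time_def Y_def)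
  have "prob (window n s x d) * prob (window m t y e)
    = prob {\<omega>\<in>space M. (\<Sum>i=1..n. V i \<omega>) \<in> ?A s x d \<and> (\<Sum>i=Suc n..n+m. V i \<omega>) \<in> ?A t y e}"
    unfolding window by (rule prob_blocks[symmetric]; rule closed_window_set)
  also have "\<dots> \<le> prob (window (n + m) (s + t) (x + y) (d + e))"
  proof (intro finite_measure_mono subsetI)
    fix \<omega> assume "\<omega> \<in> {\<omega>\<in>space M. (\<Sum>i=1..n. V i \<omega>) \<in> ?A s x d \<and> (\<Sum>i=Suc n..n+m. V i \<omega>) \<in> ?A t y e}"
    then show "\<omega> \<in> window (n + m) (s + t) (x + y) (d + e)"
      unfolding window_def renewal_time_def Y_def sum_split_blocks by (auto simp: sum_V)
  qed simp
  finally show ?thesis .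
qed

lemma attainable_nonneg:
  assumes "(w, r) \<in> attainable" shows "0 \<le> r"
proof (rule ccontr)
  assume "\<not> 0 \<le> r"
  then have "\<forall>\<^sub>F t in at_top. \<exists>n. exp (- ((r + (- r / 2)) * t)) \<le> prob (window n t (w * t) (- r / 2 * t))"
    using assms unfolding attainable_def by (auto elim!: allE[of _ "- r / 2"])
  with eventually_gt_at_top[of 0] have "\<forall>\<^sub>F t::real in at_top. False"
  proof eventually_elim
    case (elim t)
    then obtain n where "exp (- ((r + (- r / 2)) * t)) \<le> prob (window n t (w * t) (- r / 2 * t))" by blast
    also have "\<dots> \<le> 1" by (rule prob_le_1)
    finally show False using elim(1) \<open>\<not> 0 \<le> r\<close> by (simp add: mult_le_0_iff zero_le_mult_iff)
  qed
  then show False by simp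
qed

lemma attainable_upward:
  assumes "(w, r) \<in> attainable" "r \<le> r'" shows "(w, r') \<in> attainable"
  unfolding attainable_def
proof safe
  fix \<delta> :: real assume "\<delta> > 0"
  then have "\<forall>\<^sub>F t in at_top. \<exists>n. exp (- ((r + \<delta>) * t)) \<le> prob (window n t (w * t) (\<delta> * t))"
    using assms by (auto simp: attainable_def)
  with eventually_gt_at_top[of 0]
  show "\<forall>\<^sub>F t in at_top. \<exists>n. exp (- ((r' + \<delta>) * t)) \<le> prob (window n t (w * t) (\<delta> * t))"
  proof eventually_elim
    case (elim t)
    then obtain n where n: "exp (- ((r + \<delta>) * t)) \<le> prob (window n t (w * t) (\<delta> * t))" by blast
    have "exp (- ((r' + \<delta>) * t)) \<le> exp (- ((r + \<delta>) * t))"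
      using elim(1) assms by (simp add: mult_right_mono)
    with n show ?case by (intro exI[of _ n]) linarith
  qed
qed

text \<open>
  To reach time \<open>t\<close> at the mixed speed, run at speed \<open>w1\<close> until time \<open>(1 - u) t\<close> and at speed
  \<open>w2\<close> afterwards.
\<close>

lemma convex_attainable: "convex attainable"
proof -
  have "((1 - u) * w1 + u * w2, (1 - u) * r1 + u * r2) \<in> attainable"
    if 1: "(w1, r1) \<in> attainable" and 2: "(w2, r2) \<in> attainable" and u: "0 \<le> u" "u \<le> 1" for w1 r1 w2 r2 u
  proof -
    consider "u = 0" | "u = 1" | "0 < u" "u < 1" using u by linarith
    then show ?thesis
    proof cases
      case 3
      show ?thesis unfolding attainable_def
      proof safe
        fix \<delta> :: real assume \<delta>: "\<delta> > 0"
        have ev: "\<forall>\<^sub>F t in at_top. \<exists>n. exp (- ((r + \<delta>) * (v * t))) \<le> prob (window n (v * t) (w * (v * t)) (\<delta> * (v * t)))"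
          if "(w, r) \<in> attainable" "v > 0" for w r v
        proof -
          have "\<forall>\<^sub>F t in at_top. \<exists>n. exp (- ((r + \<delta>) * t)) \<le> prob (window n t (w * t) (\<delta> * t))"
            using that \<delta> by (auto simp: attainable_def)
          moreover have "filterlim (\<lambda>t. v * t) at_top at_top"
            by (rule filterlim_tendsto_pos_mult_at_top[OF tendsto_const that(2) filterlim_ident])
          ultimately show ?thesis by (rule eventually_compose_filterlim)
        qed
        from ev[OF 1, of "1 - u"] ev[OF 2, of u] 3
        have "\<forall>\<^sub>F t in at_top. \<exists>n. exp (- ((r1 + \<delta>) * ((1 - u) * t))) \<le> prob (window n ((1 - u) * t) (w1 * ((1 - u) * t)) (\<delta> * ((1 - u) * t)))"
          "\<forall>\<^sub>F t in at_top. \<exists>n. exp (- ((r2 + \<delta>) * (u * t))) \<le> prob (window n (u * t) (w2 * (u * t)) (\<delta> * (u * t)))"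
          by auto
        then show "\<forall>\<^sub>F t in at_top. \<exists>n. exp (- (((1 - u) * r1 + u * r2 + \<delta>) * t))
            \<le> prob (window n t (((1 - u) * w1 + u * w2) * t) (\<delta> * t))"
        proof eventually_elim
          case (elim t)
          then obtain n m where
            n: "exp (- ((r1 + \<delta>) * ((1 - u) * t))) \<le> prob (window n ((1 - u) * t) (w1 * ((1 - u) * t)) (\<delta> * ((1 - u) * t)))"
            and m: "exp (- ((r2 + \<delta>) * (u * t))) \<le> prob (window m (u * t) (w2 * (u * t)) (\<delta> * (u * t)))"
            by blast
          have "exp (- (((1 - u) * r1 + u * r2 + \<delta>) * t)) = exp (- ((r1 + \<delta>) * ((1 - u) * t))) * exp (- ((r2 + \<delta>) * (u * t)))"
            by (simp add: exp_add[symmetric] algebra_simps)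
          also have "\<dots> \<le> prob (window n ((1 - u) * t) (w1 * ((1 - u) * t)) (\<delta> * ((1 - u) * t))) * prob (window m (u * t) (w2 * (u * t)) (\<delta> * (u * t)))"
            using n m by (intro mult_mono) auto
          also have "\<dots> \<le> prob (window (n + m) ((1 - u) * t + u * t) (w1 * ((1 - u) * t) + w2 * (u * t)) (\<delta> * ((1 - u) * t) + \<delta> * (u * t)))"
            by (rule prob_window_mult)
          finally show ?case
            by (intro exI[of _ "n + m"]) (simp add: algebra_simps)
        qed
      qed
    qed (use 1 2 in auto)
  qed
  then show ?thesis by (auto simp: convex_alt)
qed

lemma closed_attainable: "closed attainable"
  unfolding closed_sequential_limits
proof safe
  fix z w r assume z: "\<forall>j. z j \<in> attainable" and lim: "z \<longlonglongrightarrow> (w, r)"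
  show "(w, r) \<in> attainable"
    unfolding attainable_def
  proof safe
    fix \<delta> :: real assume \<delta>: "\<delta> > 0"
    have "\<forall>\<^sub>F j in sequentially. dist (fst (z j)) w < \<delta> / 2" "\<forall>\<^sub>F j in sequentially. dist (snd (z j)) r < \<delta> / 2"
      using tendstoD[OF tendsto_fst[OF lim] half_gt_zero[OF \<delta>]] tendstoD[OF tendsto_snd[OF lim] half_gt_zero[OF \<delta>]]
      by simp_all
    then have "\<forall>\<^sub>F j in sequentially. \<bar>fst (z j) - w\<bar> < \<delta> / 2 \<and> \<bar>snd (z j) - r\<bar> < \<delta> / 2"
      by eventually_elim (simp add: dist_real_def)
    then obtain j where j: "\<bar>fst (z j) - w\<bar> < \<delta> / 2" "\<bar>snd (z j) - r\<bar> < \<delta> / 2"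
      by (auto dest!: eventually_happens)
    define w' r' where "w' = fst (z j)" and "r' = snd (z j)"
    have "(w', r') \<in> attainable" using z by (simp add: w'_def r'_def)
    then have "\<forall>\<^sub>F t in at_top. \<exists>n. exp (- ((r' + \<delta> / 2) * t)) \<le> prob (window n t (w' * t) (\<delta> / 2 * t))"
      using half_gt_zero[OF \<delta>] unfolding attainable_def by blast
    with eventually_gt_at_top[of 0]
    show "\<forall>\<^sub>F t in at_top. \<exists>n. exp (- ((r + \<delta>) * t)) \<le> prob (window n t (w * t) (\<delta> * t))"
    proof eventually_elim
      case (elim t)
      then obtain n where n: "exp (- ((r' + \<delta> / 2) * t)) \<le> prob (window n t (w' * t) (\<delta> / 2 * t))" by blast
      have "exp (- ((r + \<delta>) * t)) \<le> exp (- ((r' + \<delta> / 2) * t))"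
      proof -
        have "r' + \<delta> / 2 \<le> r + \<delta>" using j(2) unfolding r'_def by linarith
        then show ?thesis using elim(1) by (simp add: mult_right_mono)
      qed
      also have "\<dots> \<le> prob (window n t (w' * t) (\<delta> / 2 * t))" by (rule n)
      also have "\<dots> \<le> prob (window n t (w * t) (\<delta> * t))"
      proof (intro finite_measure_mono window_measurable subsetI)
        fix \<omega> assume "\<omega> \<in> window n t (w' * t) (\<delta> / 2 * t)"
        moreover have "\<bar>w' * t - w * t\<bar> \<le> \<delta> / 2 * t"
          using j elim(1) unfolding w'_def[symmetric] by (simp add: left_diff_distrib[symmetric] abs_mult mult_right_mono)
        moreover have "0 \<le> \<delta> * t" using \<delta> elim(1) by simp
        ultimately show "\<omega> \<in> window n t (w * t) (\<delta> * t)"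
          unfolding window_def mem_Collect_eq by linarith
      qed
      finally show ?case by blast
    qed
  qed
qed

text \<open>
  About \<open>t / a\<close> cycles of mean duration \<open>a\<close> and mean reward \<open>x\<close> fill the time \<open>t\<close> and produce
  the speed \<open>x / a\<close>.
\<close>

lemma attainable_of_moment_gt_1:
  assumes gt1: "exp_moment M (\<lambda>\<omega>. \<zeta> * S 1 \<omega> + k * X 1 \<omega>) > 1"
  shows "\<exists>w. (w, \<zeta> + k * w) \<in> attainable"
proof (rule tilted_concentration[OF gt1])
  fix a x :: real
  assume a: "a > 0" and conc: "\<And>\<delta>::real. \<delta> > 0 \<Longrightarrow> \<forall>\<^sub>F n in sequentially.
       exp (- (n * (\<zeta> * a + k * x + (\<bar>\<zeta>\<bar> + \<bar>k\<bar> + 1) * \<delta>)))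
        \<le> prob {\<omega>\<in>space M. \<bar>T n \<omega> - n * a\<bar> \<le> \<delta> * n \<and> \<bar>Y n \<omega> - n * x\<bar> \<le> \<delta> * n}"
  have "(x / a, \<zeta> + k * (x / a)) \<in> attainable"
    unfolding attainable_def
  proof safe
    fix \<delta> :: real assume \<delta>: "\<delta> > 0"
    define N where "N t = nat \<lfloor>t / a\<rfloor>" for t
    \<comment> \<open>tolerance per cycle whose total effect on the exponent over \<open>t / a\<close> cycles is \<open>\<delta> t / 2\<close>\<close>
    define \<eta> where "\<eta> = \<delta> * a / (2 * (\<bar>\<zeta>\<bar> + \<bar>k\<bar> + 1))"
    define c where "c = \<bar>\<zeta> * a + k * x\<bar>"
    have \<eta>: "\<eta> > 0" using \<delta> a by (auto simp: \<eta>_def intro!: divide_pos_pos add_nonneg_pos)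
    have \<eta>2: "\<eta> \<le> \<delta> * a / 2" "(\<bar>\<zeta>\<bar> + \<bar>k\<bar> + 1) * \<eta> = \<delta> * a / 2"
      using \<delta> a by (auto simp: \<eta>_def field_simps add_nonneg_eq_0_iff add_nonneg_pos)
    have "filterlim (\<lambda>t::real. 1 / a * t) at_top at_top"
      by (rule filterlim_tendsto_pos_mult_at_top[OF tendsto_const _ filterlim_ident]) (use a in simp)
    then have "filterlim N sequentially at_top"
      unfolding N_def
      by (intro filterlim_compose[OF filterlim_nat_sequentially] filterlim_compose[OF filterlim_floor_sequentially]) simp
    then have "\<forall>\<^sub>F t in at_top. exp (- (N t * (\<zeta> * a + k * x + (\<bar>\<zeta>\<bar> + \<bar>k\<bar> + 1) * \<eta>)))
        \<le> prob {\<omega>\<in>space M. \<bar>T (N t) \<omega> - N t * a\<bar> \<le> \<eta> * N t \<and> \<bar>Y (N t) \<omega> - N t * x\<bar> \<le> \<eta> * N t}"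
      by (rule eventually_compose_filterlim[OF conc[OF \<eta>]])
    moreover have "\<forall>\<^sub>F t in at_top. t > 0 \<and> t > 2 * a / \<delta> \<and> t > 2 * \<bar>x\<bar> / \<delta> \<and> t > 2 * c / \<delta>"
      by (intro eventually_conj eventually_gt_at_top)
    ultimately show "\<forall>\<^sub>F t in at_top. \<exists>n. exp (- ((\<zeta> + k * (x / a) + \<delta>) * t)) \<le> prob (window n t (x / a * t) (\<delta> * t))"
    proof eventually_elim
      case (elim t)
      have t: "t > 0" "2 * a < \<delta> * t" "2 * \<bar>x\<bar> < \<delta> * t" "2 * c < \<delta> * t"
        using elim(2) \<delta> by (auto simp: field_simps)
      define q where "q = t / a - N t"
      have q: "0 \<le> q" "q \<le> 1"
        using t(1) a unfolding q_def N_def by (auto simp: of_nat_nat) linarith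
      have Na: "N t * a = t - q * a" and Nx: "N t * x = x / a * t - q * x"
        using a by (auto simp: q_def field_simps)
      have Nle: "\<eta> * N t \<le> \<delta> / 2 * t"
      proof -
        have "\<eta> * N t \<le> \<delta> * a / 2 * N t" using \<eta>2 by (intro mult_right_mono) auto
        also have "\<dots> = \<delta> / 2 * (N t * a)" by simp
        also have "\<dots> \<le> \<delta> / 2 * t" using \<delta> q a by (intro mult_left_mono) (auto simp: Na)
        finally show ?thesis .
      qed
      have qa: "\<bar>q * y\<bar> \<le> \<bar>y\<bar>" for y using q by (auto simp: abs_mult mult_left_le_one_le)
      have "- (N t * (\<zeta> * a + k * x)) \<ge> - ((\<zeta> + k * (x / a)) * t) - c"
      proof -
        have "N t * (\<zeta> * a + k * x) = (\<zeta> + k * (x / a)) * t - q * (\<zeta> * a + k * x)"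
          using a by (simp add: q_def field_simps)
        then show ?thesis using qa[of "\<zeta> * a + k * x"] unfolding c_def by linarith
      qed
      moreover have "N t * ((\<bar>\<zeta>\<bar> + \<bar>k\<bar> + 1) * \<eta>) \<le> \<delta> / 2 * t"
      proof -
        have "N t * ((\<bar>\<zeta>\<bar> + \<bar>k\<bar> + 1) * \<eta>) = \<delta> / 2 * (N t * a)" unfolding \<eta>2 by simp
        also have "\<dots> \<le> \<delta> / 2 * t" using \<delta> q a by (intro mult_left_mono) (auto simp: Na)
        finally show ?thesis .
      qed
      ultimately have "- ((\<zeta> + k * (x / a) + \<delta>) * t) \<le> - (N t * (\<zeta> * a + k * x + (\<bar>\<zeta>\<bar> + \<bar>k\<bar> + 1) * \<eta>))"
        using t(4) unfolding distrib_left distrib_right[of _ \<delta>] by linarith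
      then have "exp (- ((\<zeta> + k * (x / a) + \<delta>) * t)) \<le> exp (- (N t * (\<zeta> * a + k * x + (\<bar>\<zeta>\<bar> + \<bar>k\<bar> + 1) * \<eta>)))"
        by simp
      also note elim(1)
      also have "prob {\<omega>\<in>space M. \<bar>T (N t) \<omega> - N t * a\<bar> \<le> \<eta> * N t \<and> \<bar>Y (N t) \<omega> - N t * x\<bar> \<le> \<eta> * N t}
        \<le> prob (window (N t) t (x / a * t) (\<delta> * t))"
      proof (intro finite_measure_mono window_measurable subsetI)
        fix \<omega> assume \<omega>: "\<omega> \<in> {\<omega>\<in>space M. \<bar>T (N t) \<omega> - N t * a\<bar> \<le> \<eta> * N t \<and> \<bar>Y (N t) \<omega> - N t * x\<bar> \<le> \<eta> * N t}"
        have "\<bar>T (N t) \<omega> - t\<bar> \<le> \<delta> * t"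
          using \<omega> qa[of a] t a Nle unfolding Na mem_Collect_eq by linarith
        moreover have "\<bar>Y (N t) \<omega> - x / a * t\<bar> \<le> \<delta> * t"
          using \<omega> qa[of x] t Nle unfolding Nx mem_Collect_eq by linarith
        ultimately show "\<omega> \<in> window (N t) t (x / a * t) (\<delta> * t)"
          using \<omega> by (simp add: window_def)
      qed
      finally show ?case by blast
    qed
  qed
  then show "\<exists>w. (w, \<zeta> + k * w) \<in> attainable" by blast
qed

definition cycle_phi :: "real \<Rightarrow> ereal" where
  "cycle_phi k = Sup {ereal \<zeta> | \<zeta>. exp_moment M (\<lambda>\<omega>. \<zeta> * S 1 \<omega> + k * X 1 \<omega>) \<le> 1}"

definition rate :: "real \<Rightarrow> ereal" where
  "rate w = (SUP k::real. ereal (w * k) + cycle_phi k)"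

text \<open>
  Convex duality.  A line of slope \<open>k\<close> below the attainable set excludes
  \<open>E exp (\<zeta> S + k X) > 1\<close> for all \<open>\<zeta> < r0 - k w0\<close>, which is a lower bound for \<open>\<phi>(k)\<close>.
\<close>

lemma attainable_of_rate_less:
  assumes "rate w0 < ereal r0"
  shows "(w0, r0) \<in> attainable"
proof (rule ccontr)
  assume "(w0, r0) \<notin> attainable"
  then have "\<exists>k. \<forall>(w, r)\<in>attainable. r0 + k * (w - w0) \<le> r"
    by (intro supporting_line[OF convex_attainable closed_attainable]) (auto intro: attainable_nonneg attainable_upward)
  then obtain k where k: "\<And>w r. (w, r) \<in> attainable \<Longrightarrow> r0 + k * (w - w0) \<le> r"
    by blast
  have "ereal (r0 - k * w0) \<le> cycle_phi k"
  proof (rule dense_le)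
    fix y assume y: "y < ereal (r0 - k * w0)"
    show "y \<le> cycle_phi k"
    proof (cases y)
      case (real \<zeta>)
      have "exp_moment M (\<lambda>\<omega>. \<zeta> * S 1 \<omega> + k * X 1 \<omega>) \<le> 1"
      proof (rule ccontr)
        assume "\<not> ?thesis"
        then obtain w where "(w, \<zeta> + k * w) \<in> attainable"
          using attainable_of_moment_gt_1 by (auto simp: not_le)
        from k[OF this] y show False by (simp add: real algebra_simps)
      qed
      then show ?thesis
        unfolding cycle_phi_def real by (intro Sup_upper) blast
    qed (use y in auto)
  qed
  then have "ereal (w0 * k) + ereal (r0 - k * w0) \<le> ereal (w0 * k) + cycle_phi k"
    by (intro add_left_mono)
  also have "\<dots> \<le> rate w0"
    unfolding rate_def by (rule SUP_upper) simp
  finally show False using assms by (simp add: mult.commute)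
qed

section \<open>Exponential moments of a cycle\<close>

lemma V1_measurable [measurable]: "V 1 \<in> borel_measurable M"
  and S1_measurable [measurable]: "S 1 \<in> borel_measurable M"
  and X1_measurable [measurable]: "X 1 \<in> borel_measurable M"
  and R1_measurable [measurable]: "R 1 \<in> borel_measurable M"
  by (auto intro: V_measurable S_measurable X_measurable R_measurable)

lemma R_moment_finite: "0 \<le> \<rho> \<Longrightarrow> exp_moment M (\<lambda>\<omega>. \<rho> * R 1 \<omega>) < \<infinity>"
  using R_moments[of \<rho>] by (cases "\<rho> = 0") (auto simp: exp_moment_def emeasure_space_1)

lemma exp_moment_mono:
  assumes "AE \<omega> in M. U \<omega> \<le> W \<omega>"
  shows "exp_moment M U \<le> exp_moment M W"
  unfolding exp_moment_def using assms by (intro nn_integral_mono_AE) (auto intro: ennreal_leI)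

text \<open>
  Strictness comes from \<open>S\<close> not being almost surely zero.
\<close>

lemma exp_moment_strict:
  assumes "\<zeta> < \<zeta>'" "exp_moment M (\<lambda>\<omega>. \<zeta>' * S 1 \<omega> + k * X 1 \<omega>) \<le> 1"
  shows "exp_moment M (\<lambda>\<omega>. \<zeta> * S 1 \<omega> + k * X 1 \<omega>) < 1"
proof -
  have le: "AE \<omega> in M. \<zeta> * S 1 \<omega> + k * X 1 \<omega> \<le> \<zeta>' * S 1 \<omega> + k * X 1 \<omega>"
    using S_nonneg[of 1] assms(1) by (intro AE_I2) (simp add: mult_right_mono)
  have "exp_moment M (\<lambda>\<omega>. \<zeta> * S 1 \<omega> + k * X 1 \<omega>) < exp_moment M (\<lambda>\<omega>. \<zeta>' * S 1 \<omega> + k * X 1 \<omega>)"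
    unfolding exp_moment_def
  proof (rule nn_integral_less)
    have "exp_moment M (\<lambda>\<omega>. \<zeta> * S 1 \<omega> + k * X 1 \<omega>) \<le> 1"
      using exp_moment_mono[OF le] assms(2) by (rule order_trans)
    then show "(\<integral>\<^sup>+\<omega>. ennreal (exp (\<zeta> * S 1 \<omega> + k * X 1 \<omega>)) \<partial>M) \<noteq> \<infinity>"
      unfolding exp_moment_def by (auto simp: top_unique)
    show "AE \<omega> in M. ennreal (exp (\<zeta> * S 1 \<omega> + k * X 1 \<omega>)) \<le> ennreal (exp (\<zeta>' * S 1 \<omega> + k * X 1 \<omega>))"
      using le by (auto intro: ennreal_leI)
    show "\<not> (AE \<omega> in M. ennreal (exp (\<zeta>' * S 1 \<omega> + k * X 1 \<omega>)) \<le> ennreal (exp (\<zeta> * S 1 \<omega> + k * X 1 \<omega>)))"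
    proof
      assume "AE \<omega> in M. ennreal (exp (\<zeta>' * S 1 \<omega> + k * X 1 \<omega>)) \<le> ennreal (exp (\<zeta> * S 1 \<omega> + k * X 1 \<omega>))"
      then have "AE \<omega> in M. S 1 \<omega> = 0"
        using AE_space
      proof eventually_elim
        case (elim \<omega>)
        then have "\<zeta>' * S 1 \<omega> \<le> \<zeta> * S 1 \<omega>" by simp
        then show ?case
          using S_nonneg[of 1 \<omega>] elim(2) assms(1) by (auto simp: mult_le_cancel_right)
      qed
      then have "prob {\<omega> \<in> space M. S 1 \<omega> = 0} = 1"
        by (subst prob_Collect_eq_1) auto
      then show False using S_nontrivial by simp
    qed
  qed measurable
  then show ?thesis using assms(2) by (rule less_le_trans)
qed

text \<open>
  As \<open>\<zeta> \<rightarrow> -\<infinity>\<close> only the cycles of length zero survive, and they have reward zero and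
  probability less than one.
\<close>

lemma exp_moment_eventually_le_1: "\<exists>\<zeta>. exp_moment M (\<lambda>\<omega>. \<zeta> * S 1 \<omega> + k * X 1 \<omega>) \<le> 1"
proof -
  have "(\<lambda>j. \<integral>\<^sup>+\<omega>. ennreal (exp (- real j * S 1 \<omega> + k * X 1 \<omega>)) \<partial>M) \<longlonglongrightarrow> (\<integral>\<^sup>+\<omega>. indicator {\<omega>\<in>space M. S 1 \<omega> = 0} \<omega> \<partial>M)"
  proof (rule nn_integral_dominated_convergence[where w = "\<lambda>\<omega>. ennreal (exp (\<bar>k\<bar> * R 1 \<omega>))"])
    show "(\<integral>\<^sup>+\<omega>. ennreal (exp (\<bar>k\<bar> * R 1 \<omega>)) \<partial>M) < \<infinity>"
      using R_moment_finite[of "\<bar>k\<bar>"] by (simp add: exp_moment_def)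
    show "AE \<omega> in M. ennreal (exp (- real j * S 1 \<omega> + k * X 1 \<omega>)) \<le> ennreal (exp (\<bar>k\<bar> * R 1 \<omega>))" for j
    proof (intro AE_I2 ennreal_leI, unfold exp_le_cancel_iff)
      fix \<omega> assume \<omega>: "\<omega> \<in> space M"
      have "k * X 1 \<omega> \<le> \<bar>k\<bar> * R 1 \<omega>" using X_le_R[of 1 \<omega>] \<omega> by (intro mult_le_abs_mult) auto
      moreover have "0 \<le> real j * S 1 \<omega>" using S_nonneg[of 1 \<omega>] \<omega> by simp
      ultimately show "- real j * S 1 \<omega> + k * X 1 \<omega> \<le> \<bar>k\<bar> * R 1 \<omega>" by simp
    qed
    show "AE \<omega> in M. (\<lambda>j. ennreal (exp (- real j * S 1 \<omega> + k * X 1 \<omega>))) \<longlonglongrightarrow> indicator {\<omega>\<in>space M. S 1 \<omega> = 0} \<omega>"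
    proof (intro AE_I2)
      fix \<omega> assume \<omega>: "\<omega> \<in> space M"
      show "(\<lambda>j. ennreal (exp (- real j * S 1 \<omega> + k * X 1 \<omega>))) \<longlonglongrightarrow> indicator {\<omega>\<in>space M. S 1 \<omega> = 0} \<omega>"
      proof (cases "S 1 \<omega> = 0")
        case True
        then show ?thesis using X_zero[of 1 \<omega>] \<omega> by simp
      next
        case False
        then have "0 < S 1 \<omega>" using S_nonneg[of 1 \<omega>] \<omega> by simp
        then have "(\<lambda>j. exp (k * X 1 \<omega>) * exp (- S 1 \<omega>) ^ j) \<longlonglongrightarrow> exp (k * X 1 \<omega>) * 0"
          by (intro tendsto_mult_left LIMSEQ_realpow_zero) auto
        then have "(\<lambda>j. ennreal (exp (- real j * S 1 \<omega> + k * X 1 \<omega>))) \<longlonglongrightarrow> ennreal 0"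
          by (intro tendsto_ennrealI) (simp add: exp_add[symmetric] exp_of_nat_mult[symmetric] add.commute)
        then show ?thesis using False by simp
      qed
    qed
  qed measurable
  moreover have "(\<integral>\<^sup>+\<omega>. indicator {\<omega>\<in>space M. S 1 \<omega> = 0} \<omega> \<partial>M) < 1"
    using S_nontrivial by (simp add: emeasure_eq_measure flip: ennreal_1) (metis ennreal_1 ennreal_lessI zero_less_one)
  ultimately have "\<forall>\<^sub>F j in sequentially. (\<integral>\<^sup>+\<omega>. ennreal (exp (- real j * S 1 \<omega> + k * X 1 \<omega>)) \<partial>M) < 1"
    by (rule order_tendstoD(2))
  then obtain j where "(\<integral>\<^sup>+\<omega>. ennreal (exp (- real j * S 1 \<omega> + k * X 1 \<omega>)) \<partial>M) < 1"
    by (auto dest: eventually_happens)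
  then show ?thesis
    unfolding exp_moment_def by (intro exI[of _ "- real j"]) simp
qed

lemma cycle_phi_gt_MInf: "cycle_phi k > -\<infinity>"
proof -
  obtain \<zeta> where "exp_moment M (\<lambda>\<omega>. \<zeta> * S 1 \<omega> + k * X 1 \<omega>) \<le> 1"
    using exp_moment_eventually_le_1 by blast
  then have "ereal \<zeta> \<le> cycle_phi k" unfolding cycle_phi_def by (intro Sup_upper) blast
  then show ?thesis by (metis MInfty_neq_ereal(1) ereal_infty_less(2) ereal_infty_less_eq(2) )
qed

text \<open>
  Either the exponent is already below \<open>\<zeta>' S + k X\<close>, or \<open>S\<close> is bounded by a multiple of \<open>R\<close>
  and the exponent by \<open>\<rho> R\<close>.
\<close>

lemma last_cycle_moment_finite:
  assumes "\<zeta> < \<zeta>'" "exp_moment M (\<lambda>\<omega>. \<zeta>' * S 1 \<omega> + k * X 1 \<omega>) \<le> 1"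
  shows "exp_moment M (\<lambda>\<omega>. max 0 \<zeta> * S 1 \<omega> + \<bar>k\<bar> * R 1 \<omega>) < \<infinity>"
proof (cases "\<zeta> \<le> 0")
  case True
  then show ?thesis using R_moment_finite[of "\<bar>k\<bar>"] by (simp add: max_def)
next
  case False
  define \<rho> where "\<rho> = \<zeta> * (2 * \<bar>k\<bar> / (\<zeta>' - \<zeta>)) + \<bar>k\<bar>"
  have \<rho>: "0 \<le> \<rho>" using False assms(1) by (auto simp: \<rho>_def)
  have "exp_moment M (\<lambda>\<omega>. max 0 \<zeta> * S 1 \<omega> + \<bar>k\<bar> * R 1 \<omega>)
    \<le> (\<integral>\<^sup>+\<omega>. ennreal (exp (\<zeta>' * S 1 \<omega> + k * X 1 \<omega>)) + ennreal (exp (\<rho> * R 1 \<omega>)) \<partial>M)"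
    unfolding exp_moment_def
  proof (intro nn_integral_mono)
    fix \<omega> assume \<omega>: "\<omega> \<in> space M"
    have kX: "- (k * X 1 \<omega>) \<le> \<bar>k\<bar> * R 1 \<omega>"
      using mult_le_abs_mult[of "- X 1 \<omega>" "R 1 \<omega>" k] X_le_R[of 1 \<omega>] \<omega> by simp
    have "max 0 \<zeta> * S 1 \<omega> + \<bar>k\<bar> * R 1 \<omega> \<le> \<zeta>' * S 1 \<omega> + k * X 1 \<omega> \<or> max 0 \<zeta> * S 1 \<omega> + \<bar>k\<bar> * R 1 \<omega> \<le> \<rho> * R 1 \<omega>"
    proof (rule disjCI)
      assume "\<not> max 0 \<zeta> * S 1 \<omega> + \<bar>k\<bar> * R 1 \<omega> \<le> \<rho> * R 1 \<omega>"
      then have "\<zeta> * (2 * \<bar>k\<bar> / (\<zeta>' - \<zeta>) * R 1 \<omega>) < \<zeta> * S 1 \<omega>"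
        using False unfolding \<rho>_def distrib_right mult.assoc by (simp add: max_def)
      then have "2 * \<bar>k\<bar> / (\<zeta>' - \<zeta>) * R 1 \<omega> \<le> S 1 \<omega>"
        using False by (simp only: mult_less_cancel_left_pos not_le less_imp_le)
      then have "2 * \<bar>k\<bar> * R 1 \<omega> \<le> (\<zeta>' - \<zeta>) * S 1 \<omega>"
        using assms(1) by (simp add: field_simps)
      then show "max 0 \<zeta> * S 1 \<omega> + \<bar>k\<bar> * R 1 \<omega> \<le> \<zeta>' * S 1 \<omega> + k * X 1 \<omega>"
        using kX False by (simp add: max_def algebra_simps)
    qed
    then show "ennreal (exp (max 0 \<zeta> * S 1 \<omega> + \<bar>k\<bar> * R 1 \<omega>))
      \<le> ennreal (exp (\<zeta>' * S 1 \<omega> + k * X 1 \<omega>)) + ennreal (exp (\<rho> * R 1 \<omega>))"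
      by (subst ennreal_plus[symmetric]) (auto intro!: ennreal_leI intro: add_increasing add_increasing2)
  qed
  also have "\<dots> = exp_moment M (\<lambda>\<omega>. \<zeta>' * S 1 \<omega> + k * X 1 \<omega>) + exp_moment M (\<lambda>\<omega>. \<rho> * R 1 \<omega>)"
    unfolding exp_moment_def by (rule nn_integral_add) measurable
  also have "\<dots> < \<infinity>"
    using assms(2) R_moment_finite[OF \<rho>] by (auto simp: less_top[symmetric] top_unique)
  finally show ?thesis .
qed

lemma prob_T_le:
  "ennreal (prob {\<omega>\<in>space M. T n \<omega> \<le> y}) \<le> ennreal (exp y) * exp_moment M (\<lambda>\<omega>. - S 1 \<omega>) ^ n"
proof -
  have "emeasure M {\<omega>\<in>space M. - y \<le> (\<Sum>i=1..n. - fst (V i \<omega>))} \<le> ennreal (exp (- (- y))) * exp_moment M (\<lambda>\<omega>. - fst (V 1 \<omega>)) ^ n"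
    by (rule chernoff[where h = "\<lambda>v. - fst v"]) (use fst_borel in measurable)
  then show ?thesis
    by (simp add: emeasure_eq_measure sum_negf renewal_time_def S_def)
qed

lemma prob_sum_R_ge:
  "ennreal (prob {\<omega>\<in>space M. y \<le> (\<Sum>i=1..n. R i \<omega>)}) \<le> ennreal (exp (- y)) * exp_moment M (R 1) ^ n"
  using chernoff[where h = "\<lambda>v. snd (snd v)" and x = y and n = n] snd_snd_borel
  by (simp add: emeasure_eq_measure R_def)

lemma exp_moment_neg_S_less_1: "exp_moment M (\<lambda>\<omega>. - S 1 \<omega>) < 1"
proof -
  have "exp_moment M (\<lambda>\<omega>. 0 * S 1 \<omega> + 0 * X 1 \<omega>) \<le> 1"
    by (simp add: exp_moment_def emeasure_space_1)
  from exp_moment_strict[OF _ this, of "-1"] show ?thesis by simp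
qed

lemma AE_T_unbounded: "AE \<omega> in M. \<forall>t. \<exists>n. t < T n \<omega>"
proof -
  obtain q where q: "exp_moment M (\<lambda>\<omega>. - S 1 \<omega>) = ennreal q" "0 \<le> q" "q < 1"
    using exp_moment_neg_S_less_1 by (cases "exp_moment M (\<lambda>\<omega>. - S 1 \<omega>)") (auto simp flip: ennreal_1 simp: ennreal_less_iff)
  have "AE \<omega> in M. \<exists>n. real j < T n \<omega>" for j :: nat
  proof -
    let ?N = "{\<omega>\<in>space M. \<forall>n. T n \<omega> \<le> real j}"
    have "prob ?N \<le> exp (real j) * q ^ n" for n
    proof -
      have "prob ?N \<le> prob {\<omega>\<in>space M. T n \<omega> \<le> real j}"
        by (intro finite_measure_mono) auto
      also have "\<dots> \<le> exp (real j) * q ^ n"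
        using prob_T_le[of n "real j"] q by (simp add: ennreal_power flip: ennreal_mult)
      finally show ?thesis .
    qed
    moreover have "(\<lambda>n. exp (real j) * q ^ n) \<longlonglongrightarrow> exp (real j) * 0"
      using q by (intro tendsto_mult_left LIMSEQ_realpow_zero) auto
    ultimately have "prob ?N \<le> 0"
      by (intro LIMSEQ_le_const[of "\<lambda>n. exp (real j) * q ^ n" 0 "prob ?N"]) auto
    then have "prob ?N = 0" by (intro antisym) auto
    then have "emeasure M ?N = 0" by (simp add: emeasure_eq_measure)
    then show ?thesis
      by (intro AE_I[of _ _ ?N]) (auto simp: not_less)
  qed
  then have "AE \<omega> in M. \<forall>j::nat. \<exists>n. real j < T n \<omega>"
    by (simp add: AE_all_countable)
  then show ?thesis
    by eventually_elim (meson less_trans reals_Archimedean2)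
qed

lemma T_0 [simp]: "T 0 \<omega> = 0"
  and T_Suc: "T (Suc n) \<omega> = T n \<omega> + S (Suc n) \<omega>"
  by (simp_all add: renewal_time_def)

end

section \<open>The exponential moment of the functional\<close>

text \<open>
  All that is used of the process under resetting is its comparison with the partial sums at
  cycle boundaries.
\<close>

locale renewal_reward_process = renewal_rewards +
  fixes F :: "real \<Rightarrow> 'a \<Rightarrow> real"
  assumes F_measurable [measurable]: "\<And>t. F t \<in> borel_measurable M"
    and F_between: "AE \<omega> in M. \<forall>t\<ge>0. \<forall>n m. renewal_time S n \<omega> \<le> t \<longrightarrow> t < renewal_time S m \<omega> \<longrightarrow>
      \<bar>F t \<omega> - (\<Sum>i=1..n. X i \<omega>)\<bar> \<le> (\<Sum>i=Suc n..m. R i \<omega>)"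

context renewal_reward_process
begin

text \<open>
  On the event \<open>T n \<le> t < T (n + 1)\<close>,
  \<open>k F t + \<zeta> t \<le> (\<zeta> T n + k Y n) + (max 0 \<zeta> * S (n + 1) + \<bar>k\<bar> * R (n + 1))\<close>,
  and the two brackets are independent.
\<close>

lemma exp_moment_F_le:
  assumes "ereal \<zeta> < cycle_phi k"
  shows "\<exists>C. C > 0 \<and> (\<forall>t\<ge>0. exp_moment M (\<lambda>\<omega>. k * F t \<omega>) \<le> ennreal (C * exp (- (\<zeta> * t))))"
proof -
  obtain \<zeta>' where \<zeta>': "\<zeta> < \<zeta>'" "exp_moment M (\<lambda>\<omega>. \<zeta>' * S 1 \<omega> + k * X 1 \<omega>) \<le> 1"
    using assms unfolding cycle_phi_def less_Sup_iff by auto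
  obtain q where q: "exp_moment M (\<lambda>\<omega>. \<zeta> * S 1 \<omega> + k * X 1 \<omega>) = ennreal q" "0 \<le> q" "q < 1"
    using exp_moment_strict[OF \<zeta>']
    by (cases "exp_moment M (\<lambda>\<omega>. \<zeta> * S 1 \<omega> + k * X 1 \<omega>)") (auto simp flip: ennreal_1 simp: ennreal_less_iff)
  obtain c where c: "exp_moment M (\<lambda>\<omega>. max 0 \<zeta> * S 1 \<omega> + \<bar>k\<bar> * R 1 \<omega>) = ennreal c" "0 \<le> c"
    using last_cycle_moment_finite[OF \<zeta>']
    by (cases "exp_moment M (\<lambda>\<omega>. max 0 \<zeta> * S 1 \<omega> + \<bar>k\<bar> * R 1 \<omega>)") auto
  define g where "g v = ennreal (exp (\<zeta> * fst v + k * fst (snd v)))" for v :: "real \<times> real \<times> real"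
  define h where "h v = ennreal (exp (max 0 \<zeta> * fst v + \<bar>k\<bar> * snd (snd v)))" for v :: "real \<times> real \<times> real"
  note [measurable] = fst_borel fst_snd_borel snd_snd_borel
  have [measurable]: "g \<in> borel_measurable borel" "h \<in> borel_measurable borel"
    unfolding g_def[abs_def] h_def[abs_def] by measurable
  define contrib where "contrib n \<omega> = (\<Prod>i=1..n. g (V i \<omega>)) * h (V (Suc n) \<omega>)" for n \<omega>
  have [measurable]: "contrib n \<in> borel_measurable M" for n
    unfolding contrib_def[abs_def]
    by (intro borel_measurable_times_ennreal borel_measurable_prod_ennreal measurable_compose[OF V_measurable]) auto
  have int_contrib: "(\<integral>\<^sup>+\<omega>. contrib n \<omega> \<partial>M) = ennreal (q ^ n * c)" for n
  proof -
    have "(\<integral>\<^sup>+\<omega>. contrib n \<omega> \<partial>M) = (\<integral>\<^sup>+\<omega>. (\<Prod>i=1..Suc n. (if i \<le> n then g else h) (V i \<omega>)) \<partial>M)"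
      unfolding contrib_def by (intro nn_integral_cong) (simp add: prod.cl_ivl_Suc)
    also have "\<dots> = (\<Prod>i=1..Suc n. \<integral>\<^sup>+\<omega>. (if i \<le> n then g else h) (V 1 \<omega>) \<partial>M)"
      by (rule nn_integral_prod_V) auto
    also have "\<dots> = (\<integral>\<^sup>+\<omega>. g (V 1 \<omega>) \<partial>M) ^ n * (\<integral>\<^sup>+\<omega>. h (V 1 \<omega>) \<partial>M)"
      by (simp add: prod.cl_ivl_Suc)
    also have "(\<integral>\<^sup>+\<omega>. g (V 1 \<omega>) \<partial>M) = ennreal q"
      using q(1) by (simp add: g_def exp_moment_def S_def X_def)
    also have "(\<integral>\<^sup>+\<omega>. h (V 1 \<omega>) \<partial>M) = ennreal c"
      using c(1) by (simp add: h_def exp_moment_def S_def R_def)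
    finally show ?thesis using q c by (simp add: ennreal_power ennreal_mult)
  qed
  have "exp_moment M (\<lambda>\<omega>. k * F t \<omega>) \<le> ennreal ((c / (1 - q) + 1) * exp (- (\<zeta> * t)))" if t: "t \<ge> 0" for t
  proof -
    have "exp_moment M (\<lambda>\<omega>. k * F t \<omega>) \<le> (\<integral>\<^sup>+\<omega>. ennreal (exp (- (\<zeta> * t))) * (\<Sum>n. contrib n \<omega>) \<partial>M)"
      unfolding exp_moment_def
    proof (rule nn_integral_mono_AE)
      show "AE \<omega> in M. ennreal (exp (k * F t \<omega>)) \<le> ennreal (exp (- (\<zeta> * t))) * (\<Sum>n. contrib n \<omega>)"
        using F_between AE_T_unbounded AE_space
      proof eventually_elim
        case (elim \<omega>)
        define m where "m = (LEAST m. t < T m \<omega>)"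
        have m: "t < T m \<omega>" "\<And>j. j < m \<Longrightarrow> T j \<omega> \<le> t"
          using elim(2) unfolding m_def by (auto intro: LeastI dest: not_less_Least simp: not_less)
        have "m \<noteq> 0" using m(1) t by (cases m) auto
        then obtain n where n: "m = Suc n" by (cases m) auto
        have Tn: "T n \<omega> \<le> t" "t < T (Suc n) \<omega>" using m n by auto
        have "\<bar>F t \<omega> - Y n \<omega>\<bar> \<le> R (Suc n) \<omega>"
          using elim(1) t Tn unfolding Y_def by fastforce
        then have "k * (F t \<omega> - Y n \<omega>) \<le> \<bar>k\<bar> * R (Suc n) \<omega>"
          by (rule mult_le_abs_mult)
        moreover have "\<zeta> * (t - T n \<omega>) \<le> max 0 \<zeta> * S (Suc n) \<omega>"
        proof -
          have "\<zeta> * (t - T n \<omega>) \<le> max 0 \<zeta> * (t - T n \<omega>)" using Tn by (intro mult_right_mono) auto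
          also have "\<dots> \<le> max 0 \<zeta> * S (Suc n) \<omega>" using Tn T_Suc[of n \<omega>] by (intro mult_left_mono) auto
          finally show ?thesis .
        qed
        ultimately have "k * F t \<omega> \<le> - (\<zeta> * t) + ((\<zeta> * T n \<omega> + k * Y n \<omega>) + (max 0 \<zeta> * S (Suc n) \<omega> + \<bar>k\<bar> * R (Suc n) \<omega>))"
          by (simp add: algebra_simps)
        then have "exp (k * F t \<omega>) \<le> exp (- (\<zeta> * t)) * (exp (\<zeta> * T n \<omega> + k * Y n \<omega>) * exp (max 0 \<zeta> * S (Suc n) \<omega> + \<bar>k\<bar> * R (Suc n) \<omega>))"
          by (simp only: exp_add[symmetric] exp_le_cancel_iff)
        then have "ennreal (exp (k * F t \<omega>)) \<le> ennreal (exp (- (\<zeta> * t))) * (ennreal (exp (\<zeta> * T n \<omega> + k * Y n \<omega>)) * h (V (Suc n) \<omega>))"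
          by (simp add: h_def S_def R_def ennreal_leI flip: ennreal_mult)
        also have "ennreal (exp (\<zeta> * T n \<omega> + k * Y n \<omega>)) = (\<Prod>i=1..n. g (V i \<omega>))"
          by (simp add: g_def prod_ennreal exp_sum[symmetric] sum.distrib sum_distrib_left renewal_time_def Y_def S_def X_def)
        also have "(\<Prod>i=1..n. g (V i \<omega>)) * h (V (Suc n) \<omega>) = contrib n \<omega>"
          by (simp add: contrib_def)
        also have "contrib n \<omega> \<le> (\<Sum>n. contrib n \<omega>)"
          using sum_le_suminf[of "\<lambda>n. contrib n \<omega>" "{n}"] by simp
        finally show ?case by (simp add: mult_left_mono)
      qed
    qed
    also have "\<dots> = ennreal (exp (- (\<zeta> * t))) * (\<Sum>n. ennreal (q ^ n * c))"
      by (subst nn_integral_cmult) (auto simp: nn_integral_suminf int_contrib)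
    also have "(\<Sum>n. ennreal (q ^ n * c)) = ennreal (1 / (1 - q) * c)"
    proof (rule suminf_ennreal_eq)
      show "(\<lambda>n. q ^ n * c) sums (1 / (1 - q) * c)"
        using q by (intro sums_mult2 geometric_sums) auto
    qed (use q c in auto)
    also have "ennreal (exp (- (\<zeta> * t))) * ennreal (1 / (1 - q) * c) = ennreal (c / (1 - q) * exp (- (\<zeta> * t)))"
      using q c by (simp add: ennreal_mult[symmetric] mult.commute)
    also have "\<dots> \<le> ennreal ((c / (1 - q) + 1) * exp (- (\<zeta> * t)))"
      by (intro ennreal_leI mult_right_mono) auto
    finally show ?thesis .
  qed
  then show ?thesis
    using q c by (intro exI[of _ "c / (1 - q) + 1"]) (auto intro!: add_nonneg_pos)
qed
end

context renewal_rewards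
begin

section \<open>From cycle boundaries to fixed times\<close>

text \<open>
  A number of cycles proportional to \<open>\<delta> t\<close>, with a large factor, lasts longer than \<open>2 \<delta> t\<close> with
  high probability, and for small \<open>\<delta>\<close> its absolute reward is below \<open>\<epsilon> t\<close> with high probability.
\<close>

lemma negligible_short_block:
  assumes \<epsilon>: "\<epsilon> > 0"
  obtains \<delta>0 where "\<delta>0 > 0"
    "\<And>\<delta>. 0 < \<delta> \<Longrightarrow> \<delta> \<le> \<delta>0 \<Longrightarrow>
      \<forall>\<^sub>F t in at_top. \<exists>m. 1 / 2 \<le> prob {\<omega>\<in>space M. 2 * \<delta> * t < T m \<omega> \<and> (\<Sum>i=1..m. R i \<omega>) \<le> \<epsilon> * t}"
proof -
  obtain q where q: "exp_moment M (\<lambda>\<omega>. - S 1 \<omega>) = ennreal q" "0 \<le> q" "q < 1"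
    using exp_moment_neg_S_less_1 by (cases "exp_moment M (\<lambda>\<omega>. - S 1 \<omega>)") (auto simp flip: ennreal_1 simp: ennreal_less_iff)
  obtain b where b: "exp_moment M (R 1) = ennreal b" "0 \<le> b"
    using R_moment_finite[of 1] by (cases "exp_moment M (R 1)") auto
  \<comment> \<open>\<open>q\<close> may vanish, hence the maximum\<close>
  define y where "y = max q (exp (- 1))"
  have y: "0 < y" "y < 1" "q \<le> y"
    using q by (auto simp: y_def less_max_iff_disj)
  define L where "L = - ln y"
  have L: "L > 0" "q \<le> exp (- L)"
    using y by (auto simp: L_def)
  define K where "K = ln (max b 1)"
  have K: "K \<ge> 0" "b \<le> exp K"
    by (auto simp: K_def)
  define \<delta>0 where "\<delta>0 = \<epsilon> / (2 * (3 * K / L + 1))"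
  have pos: "3 * K / L + 1 > 0"
    using L K by (intro add_nonneg_pos) auto
  show ?thesis
  proof (rule that)
    show "\<delta>0 > 0" using \<epsilon> pos by (simp add: \<delta>0_def)
    fix \<delta> :: real assume \<delta>: "0 < \<delta>" "\<delta> \<le> \<delta>0"
    have \<delta>K: "3 * K / L * \<delta> \<le> \<epsilon> / 2"
    proof -
      have "3 * K / L * \<delta> \<le> (3 * K / L + 1) * \<delta>0"
        using \<delta> L K by (intro mult_mono) auto
      also have "\<dots> = \<epsilon> / 2"
      proof -
        have "d * (\<epsilon> / (2 * d)) = \<epsilon> / 2" if "d > 0" for d :: real using that by simp
        from this[OF pos] show ?thesis unfolding \<delta>0_def .
      qed
      finally show ?thesis .
    qed
    have "\<forall>\<^sub>F t in at_top. ln 4 \<le> \<delta> * t" "\<forall>\<^sub>F t in at_top. K + ln 4 + 1 \<le> \<epsilon> / 2 * t"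
      using eventually_linear_ge[of \<delta> "ln 4"] eventually_linear_ge[of "\<epsilon> / 2" "K + ln 4 + 1"] \<delta> \<epsilon> by simp_all
    with eventually_gt_at_top[of 0]
    show "\<forall>\<^sub>F t in at_top. \<exists>m. 1 / 2 \<le> prob {\<omega>\<in>space M. 2 * \<delta> * t < T m \<omega> \<and> (\<Sum>i=1..m. R i \<omega>) \<le> \<epsilon> * t}"
    proof eventually_elim
      case (elim t)
      \<comment> \<open>the factor \<open>3 / L\<close> makes \<open>exp (2 \<delta> t) * exp (- L m)\<close> at most \<open>exp (- \<delta> t)\<close>\<close>
      define m where "m = nat \<lceil>3 * \<delta> / L * t\<rceil>"
      have m: "3 * \<delta> / L * t \<le> m" "m \<le> 3 * \<delta> / L * t + 1"
        using elim(1) \<delta> L unfolding m_def by (auto simp: of_nat_nat intro: real_nat_ceiling_ge)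
      have R_meas: "(\<lambda>\<omega>. \<Sum>i=1..m. R i \<omega>) \<in> borel_measurable M"
        by (intro borel_measurable_sum R_measurable) auto
      note [measurable] = R_meas
      have T_le: "prob {\<omega>\<in>space M. T m \<omega> \<le> 2 * \<delta> * t} \<le> 1 / 4"
      proof -
        have "prob {\<omega>\<in>space M. T m \<omega> \<le> 2 * \<delta> * t} \<le> exp (2 * \<delta> * t) * q ^ m"
          using prob_T_le[of m "2 * \<delta> * t"] q by (simp add: ennreal_power flip: ennreal_mult)
        also have "\<dots> \<le> exp (2 * \<delta> * t) * exp (- L) ^ m"
          using L q by (intro mult_left_mono power_mono) auto
        also have "\<dots> = exp (2 * \<delta> * t - L * m)"
          by (simp add: exp_of_nat_mult[symmetric] exp_add[symmetric] mult.commute)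
        also have "\<dots> \<le> exp (- (\<delta> * t))"
          using m(1) L by (simp add: field_simps)
        also have "\<dots> \<le> exp (- ln 4)" using elim(2) by simp
        also have "\<dots> = 1 / 4" by (simp add: exp_minus)
        finally show ?thesis .
      qed
      have R_ge: "prob {\<omega>\<in>space M. \<epsilon> * t \<le> (\<Sum>i=1..m. R i \<omega>)} \<le> 1 / 4"
      proof -
        have "prob {\<omega>\<in>space M. \<epsilon> * t \<le> (\<Sum>i=1..m. R i \<omega>)} \<le> exp (- (\<epsilon> * t)) * b ^ m"
          using prob_sum_R_ge[of "\<epsilon> * t" m] b by (simp add: ennreal_power flip: ennreal_mult)
        also have "\<dots> \<le> exp (- (\<epsilon> * t)) * exp K ^ m"
          using K b by (intro mult_left_mono power_mono) auto
        also have "\<dots> = exp (- (\<epsilon> * t) + K * m)"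
          by (simp add: exp_of_nat_mult[symmetric] exp_add[symmetric] mult.commute)
        also have "\<dots> \<le> exp (- ln 4)"
        proof -
          have "K * m \<le> K * (3 * \<delta> / L * t + 1)" using m(2) K by (intro mult_left_mono) auto
          also have "\<dots> = (3 * K / L * \<delta>) * t + K" by (simp add: algebra_simps)
          also have "\<dots> \<le> \<epsilon> / 2 * t + K" using \<delta>K elim(1) by (intro add_right_mono mult_right_mono) auto
          finally show ?thesis using elim(3) by simp
        qed
        also have "\<dots> = 1 / 4" by (simp add: exp_minus)
        finally show ?thesis .
      qed
      have "1 = prob (space M)" by (simp add: prob_space)
      also have "\<dots> \<le> prob ({\<omega>\<in>space M. 2 * \<delta> * t < T m \<omega> \<and> (\<Sum>i=1..m. R i \<omega>) \<le> \<epsilon> * t}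
          \<union> ({\<omega>\<in>space M. T m \<omega> \<le> 2 * \<delta> * t} \<union> {\<omega>\<in>space M. \<epsilon> * t \<le> (\<Sum>i=1..m. R i \<omega>)}))"
        by (intro finite_measure_mono) auto
      also have "\<dots> \<le> prob {\<omega>\<in>space M. 2 * \<delta> * t < T m \<omega> \<and> (\<Sum>i=1..m. R i \<omega>) \<le> \<epsilon> * t}
          + (prob {\<omega>\<in>space M. T m \<omega> \<le> 2 * \<delta> * t} + prob {\<omega>\<in>space M. \<epsilon> * t \<le> (\<Sum>i=1..m. R i \<omega>)})"
        by (intro order_trans[OF measure_Un_le] add_left_mono measure_Un_le) measurable
      finally show ?case using T_le R_ge by (intro exI[of _ m]) linarith
    qed
  qed
qed

end

context renewal_reward_process
begin

text \<open>
  An attainable block ends near time \<open>t\<close>; the remaining time is covered by an independent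
  negligible block.
\<close>

lemma prob_F_near_ge:
  assumes att: "(w, r) \<in> attainable" and \<epsilon>: "\<epsilon> > 0"
  shows "\<forall>\<^sub>F t in at_top. exp (- ((r + \<epsilon>) * t)) \<le> prob {\<omega>\<in>space M. \<bar>F t \<omega> - w * t\<bar> \<le> \<epsilon> * t}"
proof -
  have "\<epsilon> / 2 > 0" using \<epsilon> by simp
  then obtain \<delta>0 where \<delta>0: "\<delta>0 > 0" and block: "\<And>\<delta>. 0 < \<delta> \<Longrightarrow> \<delta> \<le> \<delta>0 \<Longrightarrow>
      \<forall>\<^sub>F t in at_top. \<exists>m. 1 / 2 \<le> prob {\<omega>\<in>space M. 2 * \<delta> * t < T m \<omega> \<and> (\<Sum>i=1..m. R i \<omega>) \<le> \<epsilon> / 2 * t}"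
    by (rule negligible_short_block) blast
  define \<delta> where "\<delta> = min \<delta>0 (\<epsilon> / (2 * (1 + \<bar>w\<bar>)))"
  have \<delta>: "0 < \<delta>" "\<delta> \<le> \<delta>0" using \<delta>0 \<epsilon> by (auto simp: \<delta>_def)
  have w\<delta>: "\<delta> + \<bar>w\<bar> * \<delta> \<le> \<epsilon> / 2"
  proof -
    have "(1 + \<bar>w\<bar>) * \<delta> \<le> (1 + \<bar>w\<bar>) * (\<epsilon> / (2 * (1 + \<bar>w\<bar>)))"
      by (intro mult_left_mono) (auto simp: \<delta>_def)
    also have "\<dots> = \<epsilon> / 2" by (simp add: field_simps add_nonneg_eq_0_iff)
    finally show ?thesis by (simp add: algebra_simps)
  qed
  then have \<delta>2: "\<delta> \<le> \<epsilon> / 2" using \<delta> by (smt (verit) abs_ge_zero mult_nonneg_nonneg)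
  \<comment> \<open>aiming at time \<open>u t\<close> ensures \<open>T n \<le> t\<close> in spite of the error \<open>\<delta> u t\<close>\<close>
  define u where "u = 1 / (1 + \<delta>)"
  have u: "0 < u" "u \<le> 1" "u * (1 + \<delta>) = 1" using \<delta> by (auto simp: u_def)
  have u1: "1 - u = u * \<delta>" "u * \<delta> \<le> \<delta>" using u \<delta> by (auto simp: algebra_simps mult_left_le_one_le)
  have r: "0 \<le> r" by (rule attainable_nonneg[OF att])
  have "filterlim (\<lambda>t::real. u * t) at_top at_top"
    by (rule filterlim_tendsto_pos_mult_at_top[OF tendsto_const u(1) filterlim_ident])
  moreover have "\<forall>\<^sub>F t in at_top. \<exists>n. exp (- ((r + \<delta>) * t)) \<le> prob (window n t (w * t) (\<delta> * t))"
    using att \<delta> unfolding attainable_def by blast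
  ultimately have "\<forall>\<^sub>F t in at_top. \<exists>n. exp (- ((r + \<delta>) * (u * t))) \<le> prob (window n (u * t) (w * (u * t)) (\<delta> * (u * t)))"
    by (auto intro: eventually_compose_filterlim)
  moreover have "\<forall>\<^sub>F t in at_top. ln 2 \<le> \<epsilon> / 2 * t"
    using eventually_linear_ge[of "\<epsilon> / 2" "ln 2"] \<epsilon> by simp
  ultimately have "\<forall>\<^sub>F t in at_top. (\<exists>n. exp (- ((r + \<delta>) * (u * t))) \<le> prob (window n (u * t) (w * (u * t)) (\<delta> * (u * t))))
      \<and> ln 2 \<le> \<epsilon> / 2 * t"
    by (rule eventually_conj)
  with block[OF \<delta>] eventually_gt_at_top[of 0] show ?thesis
  proof eventually_elim
    case (elim t)
    obtain m where m: "1 / 2 \<le> prob {\<omega>\<in>space M. 2 * \<delta> * t < T m \<omega> \<and> (\<Sum>i=1..m. R i \<omega>) \<le> \<epsilon> / 2 * t}"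
      using elim(1) by blast
    obtain n where n: "exp (- ((r + \<delta>) * (u * t))) \<le> prob (window n (u * t) (w * (u * t)) (\<delta> * (u * t)))"
      using elim(3) by blast
    let ?A = "{v::real\<times>real\<times>real. \<bar>fst v - u * t\<bar> \<le> \<delta> * (u * t) \<and> \<bar>fst (snd v) - w * (u * t)\<bar> \<le> \<delta> * (u * t)}"
    let ?C = "{v::real\<times>real\<times>real. 2 * \<delta> * t < fst v \<and> snd (snd v) \<le> \<epsilon> / 2 * t}"
    have C_meas: "?C \<in> sets borel"
      using fst_borel snd_snd_borel by measurable
    have "exp (- ((r + \<epsilon>) * t)) = exp (- (r * t) - \<epsilon> / 2 * t) * exp (- (\<epsilon> / 2 * t))"
      by (simp add: exp_add[symmetric] algebra_simps)
    also have "\<dots> \<le> exp (- ((r + \<delta>) * (u * t))) * exp (- ln 2)"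
    proof (intro mult_mono)
      have "(r + \<delta>) * (u * t) \<le> (r + \<epsilon> / 2) * (1 * t)"
        using \<delta>2 r u elim(2) \<delta> by (intro mult_mono) auto
      then show "exp (- (r * t) - \<epsilon> / 2 * t) \<le> exp (- ((r + \<delta>) * (u * t)))"
        by (simp add: algebra_simps)
      show "exp (- (\<epsilon> / 2 * t)) \<le> exp (- ln 2)" using elim(3) by simp
    qed auto
    also have "exp (- ln 2) = 1 / (2::real)" by (simp add: exp_minus)
    also have "exp (- ((r + \<delta>) * (u * t))) * (1 / 2)
       \<le> prob (window n (u * t) (w * (u * t)) (\<delta> * (u * t))) * prob {\<omega>\<in>space M. 2 * \<delta> * t < T m \<omega> \<and> (\<Sum>i=1..m. R i \<omega>) \<le> \<epsilon> / 2 * t}"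
      using n m by (intro mult_mono) auto
    also have "\<dots> = prob {\<omega>\<in>space M. (\<Sum>i=1..n. V i \<omega>) \<in> ?A} * prob {\<omega>\<in>space M. (\<Sum>i=1..m. V i \<omega>) \<in> ?C}"
      by (simp add: window_def sum_V renewal_time_def Y_def)
    also have "\<dots> = prob {\<omega>\<in>space M. (\<Sum>i=1..n. V i \<omega>) \<in> ?A \<and> (\<Sum>i=Suc n..n+m. V i \<omega>) \<in> ?C}"
      by (rule prob_blocks[symmetric, OF closed_window_set C_meas])
    also have "\<dots> \<le> prob {\<omega>\<in>space M. \<bar>F t \<omega> - w * t\<bar> \<le> \<epsilon> * t}"
    proof (rule finite_measure_mono_AE)
      show "AE \<omega> in M. \<omega> \<in> {\<omega>\<in>space M. (\<Sum>i=1..n. V i \<omega>) \<in> ?A \<and> (\<Sum>i=Suc n..n+m. V i \<omega>) \<in> ?C} \<longrightarrow>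
         \<omega> \<in> {\<omega>\<in>space M. \<bar>F t \<omega> - w * t\<bar> \<le> \<epsilon> * t}"
        using F_between
      proof eventually_elim
        case (elim \<omega>)
        show ?case
        proof
          assume "\<omega> \<in> {\<omega>\<in>space M. (\<Sum>i=1..n. V i \<omega>) \<in> ?A \<and> (\<Sum>i=Suc n..n+m. V i \<omega>) \<in> ?C}"
          then have \<omega>: "\<omega> \<in> space M" and TY: "\<bar>T n \<omega> - u * t\<bar> \<le> \<delta> * (u * t)" "\<bar>Y n \<omega> - w * (u * t)\<bar> \<le> \<delta> * (u * t)"
            and TR: "2 * \<delta> * t < (\<Sum>i=Suc n..n+m. S i \<omega>)" "(\<Sum>i=Suc n..n+m. R i \<omega>) \<le> \<epsilon> / 2 * t"
            by (auto simp: sum_V renewal_time_def Y_def)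
          have ut: "\<delta> * (u * t) \<le> \<delta> * t" "t - u * t = \<delta> * (u * t)"
          proof -
            show "\<delta> * (u * t) \<le> \<delta> * t" using u \<delta> \<open>0 < t\<close> by (intro mult_left_mono) auto
            have "t - u * t = (1 - u) * t" by (simp add: algebra_simps)
            then show "t - u * t = \<delta> * (u * t)" using u1 by simp
          qed
          have "T n \<omega> \<le> t" using TY(1) ut by linarith
          moreover have "t < T (n + m) \<omega>"
          proof -
            have "T (n + m) \<omega> = T n \<omega> + (\<Sum>i=Suc n..n+m. S i \<omega>)"
              unfolding renewal_time_def by (rule sum_split_blocks)
            then show ?thesis using TY(1) TR(1) ut by linarith
          qed
          ultimately have "\<bar>F t \<omega> - Y n \<omega>\<bar> \<le> \<epsilon> / 2 * t"
            using elim[rule_format, of t n "n + m"] \<open>0 < t\<close> TR(2) unfolding Y_def by linarith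
          moreover have "\<bar>w * (u * t) - w * t\<bar> \<le> \<bar>w\<bar> * \<delta> * t"
          proof -
            have "w * (u * t) - w * t = - (w * (t - u * t))" by (simp add: algebra_simps)
            then have "\<bar>w * (u * t) - w * t\<bar> = \<bar>w\<bar> * (\<delta> * (u * t))"
              using ut u \<delta> \<open>0 < t\<close> by (simp add: abs_mult)
            also have "\<dots> \<le> \<bar>w\<bar> * (\<delta> * t)" by (rule mult_left_mono[OF ut(1)]) simp
            finally show ?thesis by simp
          qed
          moreover have "(\<delta> + \<bar>w\<bar> * \<delta>) * t \<le> \<epsilon> / 2 * t"
            using w\<delta> \<open>0 < t\<close> by (intro mult_right_mono) auto
          ultimately have "\<bar>F t \<omega> - w * t\<bar> \<le> \<epsilon> * t"
            using TY(2) ut unfolding distrib_right by linarith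
          then show "\<omega> \<in> {\<omega>\<in>space M. \<bar>F t \<omega> - w * t\<bar> \<le> \<epsilon> * t}" using \<omega> by simp
        qed
      qed
    qed measurable
    finally show ?case .
  qed
qed

end

context renewal_rewards
begin

section \<open>The large deviation principle for renewal rewards\<close>

text \<open>
  Otherwise, letting \<open>\<zeta> \<rightarrow> \<infinity>\<close>, monotone convergence forces \<open>S = 0\<close> almost surely.
\<close>

lemma exp_moment_eventually_gt_1: "\<exists>\<zeta>. exp_moment M (\<lambda>\<omega>. \<zeta> * S 1 \<omega> + k * X 1 \<omega>) > 1"
proof (rule ccontr)
  assume no: "\<not> ?thesis"
  let ?u = "\<lambda>j::nat. \<lambda>\<omega>. ennreal (exp (real j * S 1 \<omega> + k * X 1 \<omega>))"
  have le1: "(\<integral>\<^sup>+\<omega>. ?u j \<omega> \<partial>M) \<le> 1" for j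
    using no by (auto simp: exp_moment_def not_less)
  have "(\<integral>\<^sup>+\<omega>. (SUP j. ?u j \<omega>) \<partial>M) = (SUP j. \<integral>\<^sup>+\<omega>. ?u j \<omega> \<partial>M)"
  proof (rule nn_integral_monotone_convergence_SUP_AE)
    show "AE \<omega> in M. ?u j \<omega> \<le> ?u (Suc j) \<omega>" for j
      using S_nonneg[of 1] by (intro AE_I2 ennreal_leI) (simp add: mult_right_mono)
  qed measurable
  also have "\<dots> \<le> 1" by (intro SUP_least le1)
  finally have "(\<integral>\<^sup>+\<omega>. (SUP j. ?u j \<omega>) \<partial>M) \<noteq> \<infinity>" by (auto simp: top_unique)
  then have "AE \<omega> in M. (SUP j. ?u j \<omega>) \<noteq> \<infinity>"
    by (intro nn_integral_PInf_AE) measurable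
  then have "AE \<omega> in M. S 1 \<omega> = 0"
    using AE_space
  proof eventually_elim
    case (elim \<omega>)
    show ?case
    proof (rule ccontr)
      assume "S 1 \<omega> \<noteq> 0"
      then have S: "S 1 \<omega> > 0" using S_nonneg[of 1 \<omega>] elim(2) by simp
      obtain b where b: "(SUP j. ?u j \<omega>) = ennreal b" "0 \<le> b"
        using elim(1) by (cases "SUP j. ?u j \<omega>") auto
      obtain j :: nat where "(b - k * X 1 \<omega>) / S 1 \<omega> < real j" using reals_Archimedean2 by blast
      then have "b < real j * S 1 \<omega> + k * X 1 \<omega>" using S by (simp add: field_simps)
      also have "\<dots> < exp (real j * S 1 \<omega> + k * X 1 \<omega>)"
        by (smt (verit) exp_ge_add_one_self)
      finally have "ennreal b < ?u j \<omega>" using b(2) by (simp add: ennreal_less_iff)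
      also have "\<dots> \<le> (SUP j. ?u j \<omega>)" by (rule SUP_upper) simp
      finally show False using b by simp
    qed
  qed
  then have "prob {\<omega> \<in> space M. S 1 \<omega> = 0} = 1"
    by (subst prob_Collect_eq_1) auto
  then show False using S_nontrivial by simp
qed

lemma cycle_phi_real: obtains p where "\<And>k. cycle_phi k = ereal (p k)"
proof -
  have "cycle_phi k \<noteq> \<infinity>" for k
  proof -
    obtain \<zeta>0 where \<zeta>0: "exp_moment M (\<lambda>\<omega>. \<zeta>0 * S 1 \<omega> + k * X 1 \<omega>) > 1"
      using exp_moment_eventually_gt_1 by blast
    have "cycle_phi k \<le> ereal \<zeta>0"
      unfolding cycle_phi_def
    proof (rule Sup_least, safe)
      fix \<zeta> assume "exp_moment M (\<lambda>\<omega>. \<zeta> * S 1 \<omega> + k * X 1 \<omega>) \<le> 1"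
      then have "\<not> \<zeta>0 < \<zeta>"
        using exp_moment_strict[of \<zeta>0 \<zeta> k] \<zeta>0 by auto
      then show "ereal \<zeta> \<le> ereal \<zeta>0" by simp
    qed
    then show ?thesis by auto
  qed
  then have "cycle_phi k = ereal (real_of_ereal (cycle_phi k))" for k
    using cycle_phi_gt_MInf[of k] by (cases "cycle_phi k") auto
  then show ?thesis by (rule that)
qed

lemma rate_gt_iff:
  assumes "\<And>k. cycle_phi k = ereal (p k)"
  shows "ereal a < rate w \<longleftrightarrow> (\<exists>k. a < w * k + p k)"
  by (simp add: rate_def assms less_SUP_iff)

lemma lower_semicontinuous_rate: "lower_semicontinuous rate"
  unfolding lower_semicontinuous_def le_Liminf_iff
proof (intro allI impI)
  fix w y assume "y < rate w"
  then obtain k where k: "y < ereal (w * k) + cycle_phi k"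
    unfolding rate_def less_SUP_iff by blast
  obtain p where p: "\<And>k. cycle_phi k = ereal (p k)" using cycle_phi_real by blast
  have "((\<lambda>v. ereal (v * k + p k)) \<longlongrightarrow> ereal (w * k + p k)) (at w)"
    by (intro tendsto_intros)
  then have "\<forall>\<^sub>F v in at w. y < ereal (v * k + p k)"
    using k p by (intro order_tendstoD(1)) auto
  then show "\<forall>\<^sub>F v in at w. y < rate v"
  proof eventually_elim
    case (elim v)
    also have "ereal (v * k + p k) \<le> rate v"
      unfolding rate_def using p by (intro SUP_upper2[of k]) auto
    finally show ?case .
  qed
qed

lemma good_rate_rate: "good_rate rate"
  unfolding good_rate_def
proof (intro allI impI)
  fix a :: real
  obtain p where p: "\<And>k. cycle_phi k = ereal (p k)" using cycle_phi_real by blast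
  have eq: "{w. rate w \<le> ereal a} = (\<Inter>k. {w. w * k + p k \<le> a})"
    by (auto simp: rate_def SUP_le_iff p)
  have "closed {w. rate w \<le> ereal a}"
    unfolding eq by (intro closed_INT ballI closed_Collect_le continuous_intros)
  moreover have "{w. rate w \<le> ereal a} \<subseteq> {p (- 1) - a..a - p 1}"
    unfolding eq by (force dest: spec[of _ 1] spec[of _ "- 1"])
  ultimately show "compact {w. rate w \<le> ereal a}"
    using compact_Int_closed[of "{p (- 1) - a..a - p 1}" "{w. rate w \<le> ereal a}"] by (simp add: Int_absorb1)
qed

end

context renewal_reward_process
begin

text \<open>
  From below, restrict the expectation to \<open>F t \<approx> w t\<close> for the speed \<open>w\<close> found by tilting with
  \<open>\<zeta>\<close> slightly above \<open>\<phi>(k)\<close>; from above, use \<open>exp_moment_F_le\<close> with \<open>\<zeta>\<close> slightly below.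
\<close>

lemma scaled_log_moment_tendsto:
  "((\<lambda>t. ereal (1 / t) * ext_ln (exp_moment M (\<lambda>\<omega>. k * F t \<omega>))) \<longlongrightarrow> - cycle_phi k) at_top"
proof (rule order_tendstoI)
  fix y assume "y < - cycle_phi k"
  then obtain c where c: "y < ereal c" "ereal c < - cycle_phi k" using ereal_dense2 by blast
  then have "cycle_phi k < ereal (- c)" by (metis ereal_less_uminus_reorder uminus_ereal.simps(1))
  then obtain \<zeta> where \<zeta>: "cycle_phi k < ereal \<zeta>" "\<zeta> < - c" using ereal_dense2 by fastforce
  have "exp_moment M (\<lambda>\<omega>. \<zeta> * S 1 \<omega> + k * X 1 \<omega>) > 1"
  proof (rule ccontr)
    assume "\<not> ?thesis"
    then have "ereal \<zeta> \<le> cycle_phi k" unfolding cycle_phi_def by (intro Sup_upper) auto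
    then show False using \<zeta>(1) by simp
  qed
  then obtain w where w: "(w, \<zeta> + k * w) \<in> attainable" using attainable_of_moment_gt_1 by blast
  define \<epsilon> where "\<epsilon> = (- c - \<zeta>) / (1 + \<bar>k\<bar>)"
  have \<epsilon>: "\<epsilon> > 0" "\<epsilon> + \<bar>k\<bar> * \<epsilon> = - c - \<zeta>"
    using \<zeta>(2) by (auto simp: \<epsilon>_def field_simps add_nonneg_eq_0_iff intro!: divide_pos_pos)
  from prob_F_near_ge[OF w \<epsilon>(1)] eventually_gt_at_top[of 0]
  show "\<forall>\<^sub>F t in at_top. y < ereal (1 / t) * ext_ln (exp_moment M (\<lambda>\<omega>. k * F t \<omega>))"
  proof eventually_elim
    case (elim t)
    let ?A = "{\<omega>\<in>space M. \<bar>F t \<omega> - w * t\<bar> \<le> \<epsilon> * t}"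
    have "exp (c * t) = exp (k * (w * t) - \<bar>k\<bar> * (\<epsilon> * t)) * exp (- ((\<zeta> + k * w + \<epsilon>) * t))"
    proof -
      have "c * t = - (\<epsilon> + \<bar>k\<bar> * \<epsilon> + \<zeta>) * t" using \<epsilon>(2) by simp
      then show ?thesis by (simp add: exp_add[symmetric] algebra_simps)
    qed
    also have "\<dots> \<le> exp (k * (w * t) - \<bar>k\<bar> * (\<epsilon> * t)) * prob ?A"
      using elim(1) by (intro mult_left_mono) auto
    finally have "ennreal (exp (c * t)) \<le> ennreal (exp (k * (w * t) - \<bar>k\<bar> * (\<epsilon> * t))) * emeasure M ?A"
      by (simp add: emeasure_eq_measure ennreal_leI flip: ennreal_mult)
    also have "\<dots> = (\<integral>\<^sup>+\<omega>. ennreal (exp (k * (w * t) - \<bar>k\<bar> * (\<epsilon> * t))) * indicator ?A \<omega> \<partial>M)"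
      by (rule nn_integral_cmult_indicator[symmetric]) measurable
    also have "\<dots> \<le> exp_moment M (\<lambda>\<omega>. k * F t \<omega>)"
      unfolding exp_moment_def
    proof (intro nn_integral_mono)
      fix \<omega> assume "\<omega> \<in> space M"
      show "ennreal (exp (k * (w * t) - \<bar>k\<bar> * (\<epsilon> * t))) * indicator ?A \<omega> \<le> ennreal (exp (k * F t \<omega>))"
      proof (cases "\<omega> \<in> ?A")
        case True
        then have "- k * (F t \<omega> - w * t) \<le> \<bar>- k\<bar> * (\<epsilon> * t)" by (intro mult_le_abs_mult) simp
        then show ?thesis using True by (auto intro!: ennreal_leI simp: algebra_simps)
      qed simp
    qed
    finally have "ereal c \<le> ereal (1 / t) * ext_ln (exp_moment M (\<lambda>\<omega>. k * F t \<omega>))"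
      using le_scaled_ext_ln_iff[OF elim(2)] by blast
    with c(1) show ?case by (rule less_le_trans)
  qed
next
  fix y assume "- cycle_phi k < y"
  then obtain c where c: "- cycle_phi k < ereal c" "ereal c < y" using ereal_dense2 by blast
  then have "ereal (- c) < cycle_phi k" by (metis ereal_uminus_less_reorder uminus_ereal.simps(1))
  then obtain \<zeta> where \<zeta>: "- c < \<zeta>" "ereal \<zeta> < cycle_phi k" using ereal_dense2 by fastforce
  obtain C where C: "C > 0" "\<And>t. t \<ge> 0 \<Longrightarrow> exp_moment M (\<lambda>\<omega>. k * F t \<omega>) \<le> ennreal (C * exp (- (\<zeta> * t)))"
    using exp_moment_F_le[OF \<zeta>(2)] by blast
  have "\<forall>\<^sub>F t in at_top. ln C \<le> (c + \<zeta>) * t"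
    by (rule eventually_linear_ge) (use \<zeta> in simp)
  with eventually_gt_at_top[of 0]
  show "\<forall>\<^sub>F t in at_top. ereal (1 / t) * ext_ln (exp_moment M (\<lambda>\<omega>. k * F t \<omega>)) < y"
  proof eventually_elim
    case (elim t)
    have "C * exp (- (\<zeta> * t)) = exp (ln C - \<zeta> * t)" using C(1) by (simp add: exp_diff exp_minus field_simps)
    also have "\<dots> \<le> exp (c * t)" using elim(2) by (simp add: algebra_simps)
    finally have "exp_moment M (\<lambda>\<omega>. k * F t \<omega>) \<le> ennreal (exp (c * t))"
      using C(2)[of t] elim(1) by (meson ennreal_leI less_imp_le order_trans)
    then have "ereal (1 / t) * ext_ln (exp_moment M (\<lambda>\<omega>. k * F t \<omega>)) \<le> ereal c"
      using scaled_ext_ln_le_iff[OF elim(1)] by blast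
    then show ?case using c(2) by (rule le_less_trans)
  qed
qed

lemma LDP_lower:
  assumes G: "open G"
  shows "- (INF w\<in>G. rate w) \<le> Liminf at_top (\<lambda>t. ereal (1 / t) * ext_ln (emeasure M {\<omega> \<in> space M. F t \<omega> / t \<in> G}))"
  unfolding le_Liminf_iff
proof (intro allI impI)
  fix y assume "y < - (INF w\<in>G. rate w)"
  then have "(INF w\<in>G. rate w) < - y" by (metis ereal_less_uminus_reorder)
  then obtain w where w: "w \<in> G" "rate w < - y" unfolding INF_less_iff by blast
  then obtain r where r: "rate w < ereal r" "ereal r < - y" using ereal_dense2 by blast
  then obtain r' where r': "r < r'" "ereal r' < - y" using ereal_dense2 by fastforce
  obtain \<rho> where \<rho>: "\<rho> > 0" "ball w \<rho> \<subseteq> G" using G w(1) openE by blast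
  define \<epsilon> where "\<epsilon> = min (r' - r) (\<rho> / 2)"
  have \<epsilon>: "\<epsilon> > 0" "\<epsilon> \<le> r' - r" "\<epsilon> < \<rho>" using \<rho> r' by (auto simp: \<epsilon>_def min_def)
  from prob_F_near_ge[OF attainable_of_rate_less[OF r(1)] \<epsilon>(1)] eventually_gt_at_top[of 0]
  show "\<forall>\<^sub>F t in at_top. y < ereal (1 / t) * ext_ln (emeasure M {\<omega> \<in> space M. F t \<omega> / t \<in> G})"
  proof eventually_elim
    case (elim t)
    have "exp (- r' * t) \<le> exp (- ((r + \<epsilon>) * t))"
      using \<epsilon>(2) elim(2) by (simp add: mult_right_mono)
    also note elim(1)
    also have "prob {\<omega>\<in>space M. \<bar>F t \<omega> - w * t\<bar> \<le> \<epsilon> * t} \<le> prob {\<omega> \<in> space M. F t \<omega> / t \<in> G}"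
    proof (intro finite_measure_mono subsetI)
      fix \<omega> assume \<omega>: "\<omega> \<in> {\<omega>\<in>space M. \<bar>F t \<omega> - w * t\<bar> \<le> \<epsilon> * t}"
      have "\<bar>F t \<omega> / t - w\<bar> = \<bar>F t \<omega> - w * t\<bar> / t" using elim(2) by (simp add: field_simps abs_divide flip: abs_mult)
      also have "\<dots> \<le> \<epsilon>" using \<omega> elim(2) by (simp add: divide_le_eq)
      finally have "F t \<omega> / t \<in> ball w \<rho>" using \<epsilon>(3) by (simp add: dist_real_def abs_minus_commute)
      then show "\<omega> \<in> {\<omega> \<in> space M. F t \<omega> / t \<in> G}" using \<rho>(2) \<omega> by auto
    next
      have [measurable]: "G \<in> sets borel" using G by simp
      show "{\<omega> \<in> space M. F t \<omega> / t \<in> G} \<in> sets M" by measurable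
    qed
    finally have "ereal (- r') \<le> ereal (1 / t) * ext_ln (emeasure M {\<omega> \<in> space M. F t \<omega> / t \<in> G})"
      unfolding le_scaled_ext_ln_iff[OF elim(2)] by (simp add: emeasure_eq_measure ennreal_leI)
    moreover have "y < ereal (- r')" using r'(2) by (metis ereal_less_uminus_reorder uminus_ereal.simps(1))
    ultimately show ?case by simp
  qed
qed

text \<open>
  Chernoff's bound on the half-line on which the \<open>k\<close>-th affine minorant of the rate exceeds \<open>\<alpha>\<close>.
\<close>

lemma half_line_bound:
  assumes p: "cycle_phi k = ereal p" and "\<beta> < \<alpha>"
  shows "\<forall>\<^sub>F t in at_top. prob {\<omega> \<in> space M. \<alpha> < F t \<omega> / t * k + p} \<le> exp (- (\<beta> * t))"
proof -
  define \<zeta> where "\<zeta> = p - (\<alpha> - \<beta>) / 2"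
  have "ereal \<zeta> < cycle_phi k" using assms by (simp add: \<zeta>_def)
  then obtain C where C: "C > 0" "\<And>t. t \<ge> 0 \<Longrightarrow> exp_moment M (\<lambda>\<omega>. k * F t \<omega>) \<le> ennreal (C * exp (- (\<zeta> * t)))"
    using exp_moment_F_le by blast
  have "\<forall>\<^sub>F t in at_top. ln C \<le> (\<alpha> - \<beta>) / 2 * t"
    by (rule eventually_linear_ge) (use assms in simp)
  with eventually_gt_at_top[of 0] show ?thesis
  proof eventually_elim
    case (elim t)
    let ?A = "{\<omega> \<in> space M. \<alpha> < F t \<omega> / t * k + p}"
    have "ennreal (exp ((\<alpha> - p) * t)) * emeasure M ?A = (\<integral>\<^sup>+\<omega>. ennreal (exp ((\<alpha> - p) * t)) * indicator ?A \<omega> \<partial>M)"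
      by (rule nn_integral_cmult_indicator[symmetric]) measurable
    also have "\<dots> \<le> exp_moment M (\<lambda>\<omega>. k * F t \<omega>)"
      unfolding exp_moment_def
    proof (intro nn_integral_mono)
      fix \<omega>
      show "ennreal (exp ((\<alpha> - p) * t)) * indicator ?A \<omega> \<le> ennreal (exp (k * F t \<omega>))"
      proof (cases "\<omega> \<in> ?A")
        case True
        then have "(\<alpha> - p) * t \<le> (F t \<omega> / t * k) * t" using elim(1) by (intro mult_right_mono) auto
        then show ?thesis using True elim(1) by (auto intro!: ennreal_leI simp: mult.commute)
      qed simp
    qed
    also have "\<dots> \<le> ennreal (C * exp (- (\<zeta> * t)))" using C(2) elim(1) by simp
    finally have "exp ((\<alpha> - p) * t) * prob ?A \<le> C * exp (- (\<zeta> * t))"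
      using C(1) by (simp add: emeasure_eq_measure flip: ennreal_mult)
    also have "\<dots> = exp (ln C - \<zeta> * t)" using C(1) by (simp add: exp_diff exp_minus field_simps)
    also have "\<dots> \<le> exp ((\<alpha> - p) * t - \<beta> * t)"
    proof -
      have "ln C - \<zeta> * t \<le> (\<alpha> - p) * t - \<beta> * t"
        using elim(2) by (simp add: \<zeta>_def field_simps)
      then show ?thesis by simp
    qed
    also have "\<dots> = exp ((\<alpha> - p) * t) * exp (- (\<beta> * t))" by (simp add: exp_add[symmetric])
    finally show ?case by simp
  qed
qed

text \<open>
  Below the infimum of the rate over \<open>K\<close>, the half-lines of \<open>half_line_bound\<close> cover \<open>K\<close>.  Those
  with \<open>k = 1\<close> and \<open>k = - 1\<close> contain all of \<open>K\<close> but a compact part, so that finitely many suffice.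
\<close>

lemma LDP_upper:
  assumes K: "closed K"
  shows "Limsup at_top (\<lambda>t. ereal (1 / t) * ext_ln (emeasure M {\<omega> \<in> space M. F t \<omega> / t \<in> K})) \<le> - (INF w\<in>K. rate w)"
  unfolding Limsup_le_iff
proof (intro allI impI)
  fix y assume "- (INF w\<in>K. rate w) < y"
  then have "- y < (INF w\<in>K. rate w)" by (metis ereal_uminus_less_reorder)
  then obtain \<alpha> where \<alpha>: "- y < ereal \<alpha>" "ereal \<alpha> < (INF w\<in>K. rate w)" using ereal_dense2 by blast
  then obtain \<beta> where \<beta>: "- y < ereal \<beta>" "\<beta> < \<alpha>" using ereal_dense2 by fastforce
  obtain p where p: "\<And>k. cycle_phi k = ereal (p k)" using cycle_phi_real by blast
  define U where "U k = {w. \<alpha> < w * k + p k}" for k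
  have "open (U k)" for k
    unfolding U_def by (intro open_Collect_less continuous_intros)
  moreover have cov: "K \<subseteq> (\<Union>k. U k)"
  proof
    fix w assume "w \<in> K"
    then have "ereal \<alpha> < rate w" using \<alpha>(2) by (meson INF_lower less_le_trans)
    then show "w \<in> (\<Union>k. U k)" using rate_gt_iff[OF p] by (auto simp: U_def)
  qed
  moreover have "compact ({p (- 1) - \<alpha>..\<alpha> - p 1} \<inter> K)"
    using K by (intro compact_Int_closed) auto
  ultimately obtain D where D: "finite D" "{p (- 1) - \<alpha>..\<alpha> - p 1} \<inter> K \<subseteq> (\<Union>k\<in>D. U k)"
    by (elim compactE_image[where C = UNIV and f = U]) auto
  define D' where "D' = insert 1 (insert (- 1) D)"
  have D': "finite D'" "K \<subseteq> (\<Union>k\<in>D'. U k)"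
  proof -
    show "finite D'" using D by (simp add: D'_def)
    show "K \<subseteq> (\<Union>k\<in>D'. U k)"
    proof
      fix w assume "w \<in> K"
      consider "w < p (- 1) - \<alpha>" | "\<alpha> - p 1 < w" | "w \<in> {p (- 1) - \<alpha>..\<alpha> - p 1}" by fastforce
      then show "w \<in> (\<Union>k\<in>D'. U k)"
        using D(2) \<open>w \<in> K\<close> by cases (auto simp: D'_def U_def)
    qed
  qed
  define \<gamma> where "\<gamma> = (\<alpha> + \<beta>) / 2"
  have \<gamma>: "\<beta> < \<gamma>" "\<gamma> < \<alpha>" using \<beta> by (auto simp: \<gamma>_def)
  have "\<forall>\<^sub>F t in at_top. \<forall>k\<in>D'. prob {\<omega> \<in> space M. F t \<omega> / t \<in> U k} \<le> exp (- (\<gamma> * t))"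
    using half_line_bound[OF p \<gamma>(2)] D' by (intro eventually_ball_finite) (auto simp: U_def)
  moreover have "\<forall>\<^sub>F t in at_top. ln (card D') \<le> (\<gamma> - \<beta>) * t"
    by (rule eventually_linear_ge) (use \<gamma> in simp)
  ultimately show "\<forall>\<^sub>F t in at_top. ereal (1 / t) * ext_ln (emeasure M {\<omega> \<in> space M. F t \<omega> / t \<in> K}) < y"
    using eventually_gt_at_top[of 0]
  proof eventually_elim
    case (elim t)
    have U_meas [measurable]: "U k \<in> sets borel" for k using \<open>\<And>k. open (U k)\<close> by simp
    have "prob {\<omega> \<in> space M. F t \<omega> / t \<in> K} \<le> prob (\<Union>k\<in>D'. {\<omega> \<in> space M. F t \<omega> / t \<in> U k})"
      using D' by (intro finite_measure_mono sets.finite_UN) auto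
    also have "\<dots> \<le> (\<Sum>k\<in>D'. prob {\<omega> \<in> space M. F t \<omega> / t \<in> U k})"
      using D' by (intro measure_UNION_le) auto
    also have "\<dots> \<le> (\<Sum>k\<in>D'. exp (- (\<gamma> * t)))"
      using elim(1) by (intro sum_mono) auto
    also have "\<dots> = exp (ln (card D') - \<gamma> * t)"
    proof -
      have "card D' > 0" using D'(1) by (auto simp: card_gt_0_iff D'_def)
      then show ?thesis by (simp add: exp_diff exp_minus field_simps)
    qed
    also have "\<dots> \<le> exp (- \<beta> * t)" using elim(2) by (simp add: algebra_simps)
    finally have "ereal (1 / t) * ext_ln (emeasure M {\<omega> \<in> space M. F t \<omega> / t \<in> K}) \<le> ereal (- \<beta>)"
      unfolding scaled_ext_ln_le_iff[OF elim(3)] by (simp add: emeasure_eq_measure ennreal_leI)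
    also have "ereal (- \<beta>) < y" using \<beta>(1) by (metis ereal_uminus_less_reorder uminus_ereal.simps(1))
    finally show ?case .
  qed
qed

lemma full_LDP_F: "full_LDP M F rate"
  unfolding full_LDP_def using lower_semicontinuous_rate LDP_lower LDP_upper by blast

end

section \<open>Time integrals as functions of the path\<close>

text \<open>
  The function \<open>p\<close> is \<open>E(g | W)\<close> written as a function on the range of \<open>W\<close>.
\<close>

lemma (in prob_space) conditional_density:
  assumes W [measurable]: "W \<in> measurable M N" and g [measurable]: "g \<in> borel_measurable M"
  obtains p :: "'b \<Rightarrow> ennreal" where "p \<in> borel_measurable N"
    "\<And>v. v \<in> borel_measurable N \<Longrightarrow> (\<integral>\<^sup>+\<omega>. g \<omega> * v (W \<omega>) \<partial>M) = (\<integral>\<^sup>+e. p e * v e \<partial>distr M N W)"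
proof -
  let ?Q = "distr M N W" and ?\<nu> = "distr (density M g) N W"
  interpret Q: prob_space ?Q by (rule prob_space_distr) fact
  have "absolutely_continuous ?Q ?\<nu>"
    unfolding absolutely_continuous_def
  proof
    fix E assume "E \<in> null_sets ?Q"
    then have E [measurable]: "E \<in> sets N" and 0: "emeasure M (W -` E \<inter> space M) = 0"
      by (auto simp: null_sets_def emeasure_distr)
    have "emeasure ?\<nu> E = (\<integral>\<^sup>+\<omega>. g \<omega> * indicator (W -` E \<inter> space M) \<omega> \<partial>M)"
      by (simp add: emeasure_distr emeasure_density)
    also have "\<dots> = 0"
    proof (subst nn_integral_0_iff_AE)
      have "W -` E \<inter> space M \<in> null_sets M" using 0 by (auto simp: null_sets_def)
      then show "AE \<omega> in M. g \<omega> * indicator (W -` E \<inter> space M) \<omega> = 0"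
        by (rule AE_mp[OF AE_not_in]) auto
    qed measurable
    finally show "E \<in> null_sets ?\<nu>" by (simp add: null_sets_def)
  qed
  moreover have "sets ?\<nu> = sets ?Q" by simp
  ultimately obtain p where p: "p \<in> borel_measurable ?Q" "density ?Q p = ?\<nu>"
    using Q.Radon_Nikodym by blast
  have p_meas [measurable]: "p \<in> borel_measurable N" using p(1) by simp
  show ?thesis
  proof (rule that[OF p_meas])
    fix v :: "'b \<Rightarrow> ennreal" assume v [measurable]: "v \<in> borel_measurable N"
    have "(\<integral>\<^sup>+\<omega>. g \<omega> * v (W \<omega>) \<partial>M) = (\<integral>\<^sup>+\<omega>. v (W \<omega>) \<partial>density M g)"
      by (simp add: nn_integral_density)
    also have "\<dots> = (\<integral>\<^sup>+e. v e \<partial>?\<nu>)"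
      by (subst nn_integral_distr) auto
    also have "\<dots> = (\<integral>\<^sup>+e. p e * v e \<partial>?Q)"
      unfolding p(2)[symmetric] using p(1) by (subst nn_integral_density) auto
    finally show "(\<integral>\<^sup>+\<omega>. g \<omega> * v (W \<omega>) \<partial>M) = (\<integral>\<^sup>+e. p e * v e \<partial>distr M N W)" .
  qed
qed

text \<open>
  No \<open>H\<close> can be written down: for path-valued \<open>W\<close> the map \<open>e \<mapsto> \<integral> u \<tau> e d\<tau>\<close> is not measurable on
  \<open>N\<close>, and only the integrand is jointly measurable after composition with \<open>W n\<close>.  Let \<open>A n\<close>
  denote the time integral.  By Fubini's theorem \<open>E(A n * v (W n))\<close> depends on the law of
  \<open>W n\<close> only, so one function \<open>H\<close> represents \<open>E(A n | W n)\<close> for all \<open>n\<close>.  For an event \<open>E\<close> with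
  conditional probability \<open>p (W n)\<close>, Fubini's theorem once more gives
  \<open>E(A n * 1\<^sub>E) = E(A n * p (W n)) = E(H (W n) * p (W n)) = E(H (W n) * 1\<^sub>E)\<close>, and hence
  \<open>A n = H (W n)\<close> almost surely.
\<close>

lemma (in prob_space) time_integral_factorises:
  fixes W :: "'i \<Rightarrow> 'a \<Rightarrow> 'b" and u :: "real \<Rightarrow> 'b \<Rightarrow> ennreal"
  assumes rv: "\<And>n. n \<in> I \<Longrightarrow> W n \<in> measurable M N"
    and ident: "\<And>n. n \<in> I \<Longrightarrow> distr M N (W n) = Q"
    and u: "\<And>\<tau>. u \<tau> \<in> borel_measurable N"
    and joint: "\<And>n. n \<in> I \<Longrightarrow> (\<lambda>(\<tau>, \<omega>). u \<tau> (W n \<omega>)) \<in> borel_measurable (lborel \<Otimes>\<^sub>M M)"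
  obtains H where "H \<in> borel_measurable N"
    "\<And>n. n \<in> I \<Longrightarrow> AE \<omega> in M. (\<integral>\<^sup>+\<tau>. u \<tau> (W n \<omega>) \<partial>lborel) = H (W n \<omega>)"
proof (cases "I = {}")
  case True
  then show ?thesis by (intro that[of "\<lambda>_. 0"]) auto
next
  case False
  then obtain n0 where n0: "n0 \<in> I" by blast
  interpret pair: pair_sigma_finite lborel M ..
  let ?A = "\<lambda>n \<omega>. \<integral>\<^sup>+\<tau>. u \<tau> (W n \<omega>) \<partial>lborel"
  have swap: "(\<integral>\<^sup>+\<omega>. ?A n \<omega> * g \<omega> \<partial>M) = (\<integral>\<^sup>+\<tau>. \<integral>\<^sup>+\<omega>. u \<tau> (W n \<omega>) * g \<omega> \<partial>M \<partial>lborel)"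
    if n: "n \<in> I" and [measurable]: "g \<in> borel_measurable M" for n g
  proof -
    note [measurable] = joint[OF n]
    have "(\<integral>\<^sup>+\<omega>. ?A n \<omega> * g \<omega> \<partial>M) = (\<integral>\<^sup>+\<omega>. \<integral>\<^sup>+\<tau>. u \<tau> (W n \<omega>) * g \<omega> \<partial>lborel \<partial>M)"
      using joint[OF n] by (intro nn_integral_cong nn_integral_multc[symmetric]) (auto dest: measurable_Pair1')
    also have "\<dots> = (\<integral>\<^sup>+\<tau>. \<integral>\<^sup>+\<omega>. u \<tau> (W n \<omega>) * g \<omega> \<partial>M \<partial>lborel)"
      by (rule pair.Fubini') measurable
    finally show ?thesis .
  qed
  have A_meas: "?A n \<in> borel_measurable M" if n: "n \<in> I" for n
  proof -
    have "(\<lambda>(\<omega>, \<tau>). u \<tau> (W n \<omega>)) \<in> borel_measurable (M \<Otimes>\<^sub>M lborel)"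
      using measurable_pair_swap[OF joint[OF n]] by (simp add: case_prod_beta')
    then show ?thesis by (rule lborel.borel_measurable_nn_integral)
  qed
  let ?J = "\<lambda>v. \<integral>\<^sup>+\<tau>. \<integral>\<^sup>+e. u \<tau> e * v e \<partial>Q \<partial>lborel"
  have sets_Q [measurable_cong]: "sets Q = sets N" using ident[OF n0] by (metis sets_distr)
  have J: "(\<integral>\<^sup>+\<omega>. ?A n \<omega> * v (W n \<omega>) \<partial>M) = ?J v" if n: "n \<in> I" and [measurable]: "v \<in> borel_measurable N" for n v
  proof -
    note [measurable] = rv[OF n] u
    show ?thesis
      unfolding ident[OF n, symmetric]
      by (subst swap[OF n]) (auto simp: nn_integral_distr intro!: nn_integral_cong)
  qed
  obtain H where H [measurable]: "H \<in> borel_measurable N"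
    and H_eq: "\<And>v. v \<in> borel_measurable N \<Longrightarrow> (\<integral>\<^sup>+\<omega>. ?A n0 \<omega> * v (W n0 \<omega>) \<partial>M) = (\<integral>\<^sup>+e. H e * v e \<partial>Q)"
    using conditional_density[OF rv[OF n0] A_meas[OF n0]] unfolding ident[OF n0] by blast
  show ?thesis
  proof (rule that[OF H])
    fix n assume n: "n \<in> I"
    note [measurable] = rv[OF n] u A_meas[OF n]
    have "emeasure (density M (?A n)) E = emeasure (density M (\<lambda>\<omega>. H (W n \<omega>))) E" if E [measurable]: "E \<in> sets M" for E
    proof -
      obtain p where p [measurable]: "p \<in> borel_measurable N"
        and p_eq: "\<And>v. v \<in> borel_measurable N \<Longrightarrow> (\<integral>\<^sup>+\<omega>. indicator E \<omega> * v (W n \<omega>) \<partial>M) = (\<integral>\<^sup>+e. p e * v e \<partial>Q)"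
        using conditional_density[OF rv[OF n], of "indicator E"] unfolding ident[OF n] by (metis E borel_measurable_indicator)
      have "emeasure (density M (?A n)) E = (\<integral>\<^sup>+\<omega>. ?A n \<omega> * indicator E \<omega> \<partial>M)"
        by (rule emeasure_density) measurable
      also have "\<dots> = (\<integral>\<^sup>+\<tau>. \<integral>\<^sup>+\<omega>. indicator E \<omega> * u \<tau> (W n \<omega>) \<partial>M \<partial>lborel)"
        by (subst swap[OF n]) (auto simp: mult.commute)
      also have "\<dots> = ?J p"
        by (simp add: p_eq[OF u] mult.commute)
      also have "\<dots> = (\<integral>\<^sup>+e. p e * H e \<partial>Q)"
        using J[OF n0 p] H_eq[OF p] by (simp add: mult.commute)
      also have "\<dots> = (\<integral>\<^sup>+\<omega>. H (W n \<omega>) * indicator E \<omega> \<partial>M)"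
        using p_eq[OF H] by (simp add: mult.commute)
      also have "\<dots> = emeasure (density M (\<lambda>\<omega>. H (W n \<omega>))) E"
        by (rule emeasure_density[symmetric]) measurable
      finally show ?thesis .
    qed
    then have "density M (?A n) = density M (\<lambda>\<omega>. H (W n \<omega>))"
      by (intro measure_eqI) auto
    then show "AE \<omega> in M. ?A n \<omega> = H (W n \<omega>)"
      by (intro density_unique) measurable
  qed
qed

context stochastic_resetting
begin

section \<open>Independence and equality in law of the cycles\<close>

definition cycle_data :: "nat \<Rightarrow> 'a \<Rightarrow> real \<times> (real \<Rightarrow> real)" where
  "cycle_data n \<omega> = (S n \<omega>, path_of B n \<omega>)"

lemma S_measurable: "n \<ge> 1 \<Longrightarrow> S n \<in> borel_measurable M"
  using S_indep by (auto simp: indep_vars_def)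

lemma path_measurable: "n \<ge> 1 \<Longrightarrow> path_of B n \<in> measurable M path_space"
  using B_indep by (auto simp: indep_vars_def)

lemma cycle_data_measurable: "n \<ge> 1 \<Longrightarrow> cycle_data n \<in> measurable M (borel \<Otimes>\<^sub>M path_space)"
  unfolding cycle_data_def[abs_def] by (intro measurable_Pair S_measurable path_measurable)

lemma prob_S_path:
  assumes J: "finite J" "J \<subseteq> {1..}" and A: "\<And>j. j \<in> J \<Longrightarrow> A j \<in> sets borel" and C: "\<And>j. j \<in> J \<Longrightarrow> C j \<in> sets path_space"
  shows "prob ({\<omega>\<in>space M. \<forall>j\<in>J. S j \<omega> \<in> A j} \<inter> {\<omega>\<in>space M. \<forall>j\<in>J. path_of B j \<omega> \<in> C j})
    = (\<Prod>j\<in>J. prob {\<omega>\<in>space M. S j \<omega> \<in> A j}) * (\<Prod>j\<in>J. prob {\<omega>\<in>space M. path_of B j \<omega> \<in> C j})"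
proof -
  let ?E = "{\<omega>\<in>space M. \<forall>j\<in>J. S j \<omega> \<in> A j}" and ?D = "{\<omega>\<in>space M. \<forall>j\<in>J. path_of B j \<omega> \<in> C j}"
  have gen: "{\<omega>\<in>space M. \<forall>j\<in>J. Z j \<omega> \<in> G j} \<in> sets (vimage_algebra (space M) (\<lambda>\<omega>. \<lambda>n\<in>{1..}. Z n \<omega>) (PiM {1..} (\<lambda>_. N)))"
    if Z: "\<And>n. n \<ge> 1 \<Longrightarrow> Z n \<in> measurable M N" and G: "\<And>j. j \<in> J \<Longrightarrow> G j \<in> sets N" for Z :: "nat \<Rightarrow> 'a \<Rightarrow> 'c" and N G
  proof -
    let ?G = "{z \<in> space (PiM {1..} (\<lambda>_. N)). \<forall>j\<in>J. z j \<in> G j}"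
    have "?G \<in> sets (PiM {1..} (\<lambda>_. N))"
    proof (rule sets.sets_Collect_finite_All[OF _ J(1)])
      fix j assume j: "j \<in> J"
      then have "(\<lambda>z. z j) \<in> measurable (PiM {1..} (\<lambda>_. N)) N" using J by (intro measurable_component_singleton) auto
      from measurable_sets[OF this G[OF j]]
      show "{z \<in> space (PiM {1..} (\<lambda>_. N)). z j \<in> G j} \<in> sets (PiM {1..} (\<lambda>_. N))"
        by (simp add: vimage_def Int_def conj_commute)
    qed
    then have "(\<lambda>\<omega>. \<lambda>n\<in>{1..}. Z n \<omega>) -` ?G \<inter> space M \<in> sets (vimage_algebra (space M) (\<lambda>\<omega>. \<lambda>n\<in>{1..}. Z n \<omega>) (PiM {1..} (\<lambda>_. N)))"
      by (rule in_vimage_algebra)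
    also have "(\<lambda>\<omega>. \<lambda>n\<in>{1..}. Z n \<omega>) -` ?G \<inter> space M = {\<omega>\<in>space M. \<forall>j\<in>J. Z j \<omega> \<in> G j}"
      using J Z by (auto simp: space_PiM subset_iff dest: measurable_space)
    finally show ?thesis .
  qed
  have "prob (?E \<inter> ?D) = prob ?E * prob ?D"
    by (rule indep_setD[OF S_B_indep]; rule gen) (use S_measurable path_measurable A C in auto)
  moreover have "prob {\<omega>\<in>space M. \<forall>j\<in>J. Z j \<omega> \<in> G j} = (\<Prod>j\<in>J. prob {\<omega>\<in>space M. Z j \<omega> \<in> G j})"
    if Z: "indep_vars (\<lambda>_. N) Z {1..}" and G: "\<And>j. j \<in> J \<Longrightarrow> G j \<in> sets N" for Z :: "nat \<Rightarrow> 'a \<Rightarrow> 'c" and N G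
  proof (cases "J = {}")
    case False
    have "prob (\<Inter>j\<in>J. Z j -` G j \<inter> space M) = (\<Prod>j\<in>J. prob (Z j -` G j \<inter> space M))"
      by (rule indep_varsD[OF Z False J(1,2)]) (use G in auto)
    moreover have "(\<Inter>j\<in>J. Z j -` G j \<inter> space M) = {\<omega>\<in>space M. \<forall>j\<in>J. Z j \<omega> \<in> G j}"
      using False by auto
    moreover have "Z j -` G j \<inter> space M = {\<omega>\<in>space M. Z j \<omega> \<in> G j}" for j by auto
    ultimately show ?thesis by simp
  qed (simp add: prob_space)
  from this[OF S_indep A] this[OF B_indep C] have "prob ?E = (\<Prod>j\<in>J. prob {\<omega>\<in>space M. S j \<omega> \<in> A j})"
    "prob ?D = (\<Prod>j\<in>J. prob {\<omega>\<in>space M. path_of B j \<omega> \<in> C j})" by auto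
  ultimately show ?thesis by simp
qed

lemma distr_cycle_data_eq_pair:
  assumes "n \<ge> 1"
  shows "distr M borel (S n) \<Otimes>\<^sub>M distr M path_space (path_of B n) = distr M (borel \<Otimes>\<^sub>M path_space) (cycle_data n)"
proof (rule pair_measure_eqI)
  note S [measurable] = S_measurable[OF assms]
  note P [measurable] = path_measurable[OF assms]
  note W [measurable] = cycle_data_measurable[OF assms]
  show "sigma_finite_measure (distr M borel (S n))" "sigma_finite_measure (distr M path_space (path_of B n))"
    by (auto intro!: prob_space_imp_sigma_finite prob_space_distr S P)
  show "sets (distr M borel (S n) \<Otimes>\<^sub>M distr M path_space (path_of B n)) = sets (distr M (borel \<Otimes>\<^sub>M path_space) (cycle_data n))"
    by (simp cong: sets_pair_measure_cong)
  fix A C assume "A \<in> sets (distr M borel (S n))" "C \<in> sets (distr M path_space (path_of B n))"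
  then have A: "A \<in> sets borel" and C: "C \<in> sets path_space" by auto
  have "emeasure (distr M borel (S n)) A * emeasure (distr M path_space (path_of B n)) C
    = ennreal (prob {\<omega>\<in>space M. S n \<omega> \<in> A} * prob {\<omega>\<in>space M. path_of B n \<omega> \<in> C})"
    using A C S P by (simp add: emeasure_distr emeasure_eq_measure vimage_def Int_def conj_commute ennreal_mult)
  also have "prob {\<omega>\<in>space M. S n \<omega> \<in> A} * prob {\<omega>\<in>space M. path_of B n \<omega> \<in> C}
    = prob {\<omega>\<in>space M. cycle_data n \<omega> \<in> A \<times> C}"
  proof -
    have "{\<omega>\<in>space M. cycle_data n \<omega> \<in> A \<times> C} = {\<omega>\<in>space M. \<forall>j\<in>{n}. S j \<omega> \<in> A} \<inter> {\<omega>\<in>space M. \<forall>j\<in>{n}. path_of B j \<omega> \<in> C}"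
      by (auto simp: cycle_data_def)
    then show ?thesis
      using prob_S_path[of "{n}" "\<lambda>_. A" "\<lambda>_. C"] assms A C by simp
  qed
  also have "ennreal \<dots> = emeasure (distr M (borel \<Otimes>\<^sub>M path_space) (cycle_data n)) (A \<times> C)"
    using A C W by (simp add: emeasure_distr emeasure_eq_measure vimage_def Int_def conj_commute)
  finally show "emeasure (distr M borel (S n)) A * emeasure (distr M path_space (path_of B n)) C
    = emeasure (distr M (borel \<Otimes>\<^sub>M path_space) (cycle_data n)) (A \<times> C)" .
qed

lemma distr_cycle_data: "n \<ge> 1 \<Longrightarrow> distr M (borel \<Otimes>\<^sub>M path_space) (cycle_data n) = distr M (borel \<Otimes>\<^sub>M path_space) (cycle_data 1)"
  using distr_cycle_data_eq_pair[of n] distr_cycle_data_eq_pair[of 1] S_ident[of n] B_ident[of n] by simp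

lemma indep_cycle_data: "indep_vars (\<lambda>_. borel \<Otimes>\<^sub>M path_space) cycle_data {1..}"
proof -
  define \<R> where "\<R> n = {{\<omega>\<in>space M. S n \<omega> \<in> A \<and> path_of B n \<omega> \<in> C} | A C. A \<in> sets borel \<and> C \<in> sets path_space}" for n
  have sigma: "sigma_sets (space M) {cycle_data n -` D \<inter> space M |D. D \<in> sets (borel \<Otimes>\<^sub>M path_space)} = sigma_sets (space M) (\<R> n)" if n: "n \<ge> 1" for n
  proof -
    have "cycle_data n \<in> space M \<rightarrow> space borel \<times> space path_space"
      using measurable_space[OF path_measurable[OF n]] by (auto simp: cycle_data_def)
    then have "{cycle_data n -` D \<inter> space M |D. D \<in> sets (borel \<Otimes>\<^sub>M path_space)}
      = sigma_sets (space M) {cycle_data n -` D \<inter> space M |D. D \<in> {a \<times> b |a b. a \<in> sets borel \<and> b \<in> sets path_space}}"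
      unfolding sets_pair_measure by (rule sigma_sets_vimage_commute)
    also have "{cycle_data n -` D \<inter> space M |D. D \<in> {a \<times> b |a b. a \<in> sets borel \<and> b \<in> sets path_space}} = \<R> n"
      by (auto simp: \<R>_def cycle_data_def vimage_def Int_def conj_ac) blast+
    finally show ?thesis by (simp only: sigma_sets_sigma_sets_eq) (auto simp: \<R>_def intro!: sigma_sets_sigma_sets_eq)
  qed
  have "indep_sets \<R> {1..}"
  proof (rule indep_setsI)
    fix n :: nat assume "n \<in> {1..}"
    then have "n \<ge> 1" by simp
    show "\<R> n \<subseteq> events"
    proof
      fix a assume "a \<in> \<R> n"
      then obtain A C where "a = S n -` A \<inter> space M \<inter> (path_of B n -` C \<inter> space M)" "A \<in> sets borel" "C \<in> sets path_space"
        by (auto simp: \<R>_def)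
      then show "a \<in> events"
        using measurable_sets[OF S_measurable[OF \<open>n \<ge> 1\<close>]] measurable_sets[OF path_measurable[OF \<open>n \<ge> 1\<close>]] by auto
    qed
  next
    fix E J assume J: "J \<noteq> {}" "J \<subseteq> {1..}" "finite J" and "\<forall>j\<in>J. E j \<in> \<R> j"
    then have ex: "\<forall>j\<in>J. \<exists>A C. E j = {\<omega>\<in>space M. S j \<omega> \<in> A \<and> path_of B j \<omega> \<in> C} \<and> A \<in> sets borel \<and> C \<in> sets path_space"
      by (simp add: \<R>_def)
    obtain A where ex_C: "\<forall>j\<in>J. \<exists>C. E j = {\<omega>\<in>space M. S j \<omega> \<in> A j \<and> path_of B j \<omega> \<in> C} \<and> A j \<in> sets borel \<and> C \<in> sets path_space"
      using bchoice[OF ex] ..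
    obtain C where "\<forall>j\<in>J. E j = {\<omega>\<in>space M. S j \<omega> \<in> A j \<and> path_of B j \<omega> \<in> C j} \<and> A j \<in> sets borel \<and> C j \<in> sets path_space"
      using bchoice[OF ex_C] ..
    then have E: "\<And>j. j \<in> J \<Longrightarrow> E j = {\<omega>\<in>space M. S j \<omega> \<in> A j \<and> path_of B j \<omega> \<in> C j}"
      and A: "\<And>j. j \<in> J \<Longrightarrow> A j \<in> sets borel" and C: "\<And>j. j \<in> J \<Longrightarrow> C j \<in> sets path_space"
      by auto
    have "(\<Inter>j\<in>J. E j) = {\<omega>\<in>space M. \<forall>j\<in>J. S j \<omega> \<in> A j} \<inter> {\<omega>\<in>space M. \<forall>j\<in>J. path_of B j \<omega> \<in> C j}"
      using J(1) E by auto
    then have "prob (\<Inter>j\<in>J. E j) = (\<Prod>j\<in>J. prob {\<omega>\<in>space M. S j \<omega> \<in> A j}) * (\<Prod>j\<in>J. prob {\<omega>\<in>space M. path_of B j \<omega> \<in> C j})"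
      using prob_S_path[OF J(3,2) A C] by simp
    also have "\<dots> = (\<Prod>j\<in>J. prob (E j))"
      unfolding prod.distrib[symmetric]
    proof (intro prod.cong refl)
      fix j assume j: "j \<in> J"
      have "E j = {\<omega>\<in>space M. \<forall>j\<in>{j}. S j \<omega> \<in> A j} \<inter> {\<omega>\<in>space M. \<forall>j\<in>{j}. path_of B j \<omega> \<in> C j}"
        using E[OF j] by auto
      then show "prob {\<omega>\<in>space M. S j \<omega> \<in> A j} * prob {\<omega>\<in>space M. path_of B j \<omega> \<in> C j} = prob (E j)"
        using prob_S_path[of "{j}" A C] J j A C by auto
    qed
    finally show "prob (\<Inter>j\<in>J. E j) = (\<Prod>j\<in>J. prob (E j))" .
  qed
  then have "indep_sets (\<lambda>n. sigma_sets (space M) (\<R> n)) {1..}"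
  proof (rule indep_sets_sigma)
    fix n :: nat
    show "Int_stable (\<R> n)"
      unfolding Int_stable_def
    proof (intro ballI)
      fix a b assume "a \<in> \<R> n" "b \<in> \<R> n"
      then obtain A C A' C' where "a = {\<omega>\<in>space M. S n \<omega> \<in> A \<and> path_of B n \<omega> \<in> C}" "A \<in> sets borel" "C \<in> sets path_space"
        "b = {\<omega>\<in>space M. S n \<omega> \<in> A' \<and> path_of B n \<omega> \<in> C'}" "A' \<in> sets borel" "C' \<in> sets path_space"
        by (auto simp: \<R>_def)
      then have "a \<inter> b = {\<omega>\<in>space M. S n \<omega> \<in> A \<inter> A' \<and> path_of B n \<omega> \<in> C \<inter> C'}" "A \<inter> A' \<in> sets borel" "C \<inter> C' \<in> sets path_space"
        by auto
      then show "a \<inter> b \<in> \<R> n" unfolding \<R>_def by blast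
    qed
  qed
  also have "?this \<longleftrightarrow> indep_sets (\<lambda>n. sigma_sets (space M) {cycle_data n -` D \<inter> space M |D. D \<in> sets (borel \<Otimes>\<^sub>M path_space)}) {1..}"
    by (rule indep_sets_cong) (simp_all add: sigma)
  finally show ?thesis
    unfolding indep_vars_def using cycle_data_measurable by simp
qed

text \<open>
  Joint measurability of \<open>B n\<close> is available for nonnegative times only; clamping the time gives
  a function that is measurable on the whole line and has the same values there.
\<close>

definition B_clamped :: "nat \<Rightarrow> real \<Rightarrow> 'a \<Rightarrow> real" where
  "B_clamped n \<tau> \<omega> = B n (max 0 \<tau>) \<omega>"

lemma B_clamped_measurable:
  assumes n: "n \<ge> 1" and u: "u \<in> borel_measurable N" and v: "v \<in> measurable N M"
  shows "(\<lambda>x. B_clamped n (u x) (v x)) \<in> borel_measurable N"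
proof -
  have "(\<lambda>x. (max 0 (u x), v x)) \<in> measurable N (restrict_space borel {0..} \<Otimes>\<^sub>M M)"
    using u v by (intro measurable_Pair measurable_restrict_space2) auto
  from measurable_compose[OF this B_measurable[OF n]] show ?thesis
    by (simp add: B_clamped_def)
qed

text \<open>
  Positive part of the reward for \<open>g = f\<close>, negative part for \<open>g = - f\<close>: \<^const>\<open>ennreal\<close>
  truncates negative values to zero.
\<close>

definition occupation :: "(real \<Rightarrow> real) \<Rightarrow> nat \<Rightarrow> 'a \<Rightarrow> ennreal" where
  "occupation g n \<omega> = (\<integral>\<^sup>+\<tau>. ennreal (indicator {0..S n \<omega>} \<tau> * g (B n \<tau> \<omega>)) \<partial>lborel)"

lemma occupation_factorises:
  assumes g [measurable]: "g \<in> borel_measurable borel"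
  obtains H where "H \<in> borel_measurable (borel \<Otimes>\<^sub>M path_space)"
    "\<And>n. n \<ge> 1 \<Longrightarrow> AE \<omega> in M. occupation g n \<omega> = H (cycle_data n \<omega>)"
proof -
  define u where "u \<tau> e = (if 0 \<le> \<tau> \<and> \<tau> \<le> fst e then ennreal (g (snd e \<tau>)) else 0)" for \<tau> :: real and e :: "real \<times> (real \<Rightarrow> real)"
  have u_meas: "u \<tau> \<in> borel_measurable (borel \<Otimes>\<^sub>M path_space)" for \<tau>
  proof (cases "0 \<le> \<tau>")
    case True
    then have "(\<lambda>b. b \<tau>) \<in> borel_measurable path_space"
      unfolding path_space_def by (intro measurable_component_singleton) auto
    note [measurable] = measurable_compose[OF measurable_snd this]
    show ?thesis unfolding u_def[abs_def] by measurable
  qed (simp add: u_def[abs_def])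
  have joint: "(\<lambda>(\<tau>, \<omega>). u \<tau> (cycle_data n \<omega>)) \<in> borel_measurable (lborel \<Otimes>\<^sub>M M)" if n: "n \<in> {1..}" for n
  proof -
    have [measurable]: "S n \<in> borel_measurable M" using n by (intro S_measurable) simp
    have [measurable]: "(\<lambda>x. B_clamped n (fst x) (snd x)) \<in> borel_measurable (lborel \<Otimes>\<^sub>M M)"
      using n by (intro B_clamped_measurable) auto
    have "(\<lambda>(\<tau>, \<omega>). u \<tau> (cycle_data n \<omega>)) = (\<lambda>x. if 0 \<le> fst x \<and> fst x \<le> S n (snd x) then ennreal (g (B_clamped n (fst x) (snd x))) else 0)"
      by (auto simp: fun_eq_iff u_def cycle_data_def path_of_def B_clamped_def)
    also have "\<dots> \<in> borel_measurable (lborel \<Otimes>\<^sub>M M)" by measurable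
    finally show ?thesis .
  qed
  have occ: "occupation g n \<omega> = (\<integral>\<^sup>+\<tau>. u \<tau> (cycle_data n \<omega>) \<partial>lborel)" for n \<omega>
    unfolding occupation_def by (intro nn_integral_cong) (auto simp: u_def cycle_data_def path_of_def indicator_def)
  show ?thesis
  proof (rule time_integral_factorises[where I = "{1..}" and W = cycle_data and u = u])
    show "cycle_data n \<in> measurable M (borel \<Otimes>\<^sub>M path_space)" if "n \<in> {1..}" for n
      using that by (intro cycle_data_measurable) simp
    show "distr M (borel \<Otimes>\<^sub>M path_space) (cycle_data n) = distr M (borel \<Otimes>\<^sub>M path_space) (cycle_data 1)"
      if "n \<in> {1..}" for n
      using that by (intro distr_cycle_data) simp
    fix H assume "H \<in> borel_measurable (borel \<Otimes>\<^sub>M path_space)"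
      "\<And>n. n \<in> {1..} \<Longrightarrow> AE \<omega> in M. (\<integral>\<^sup>+\<tau>. u \<tau> (cycle_data n \<omega>) \<partial>lborel) = H (cycle_data n \<omega>)"
    then show thesis
      by (intro that[of H]) (simp_all add: occ)
  qed (fact u_meas joint)+
qed

lemma rewards_eq_occupation:
  assumes "set_integrable lborel {0..S n \<omega>} (\<lambda>\<tau>. f (B n \<tau> \<omega>))"
  shows "cycle_reward S B f n \<omega> = enn2real (occupation f n \<omega>) - enn2real (occupation (\<lambda>x. - f x) n \<omega>)"
    and "cycle_abs_reward S B f n \<omega> = enn2real (occupation f n \<omega>) + enn2real (occupation (\<lambda>x. - f x) n \<omega>)"
proof -
  let ?h = "\<lambda>\<tau>. indicator {0..S n \<omega>} \<tau> * f (B n \<tau> \<omega>)"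
  have h: "integrable lborel ?h" using assms by (simp add: set_integrable_def)
  then have [measurable]: "?h \<in> borel_measurable lborel" by auto
  have occ: "occupation f n \<omega> = (\<integral>\<^sup>+\<tau>. ennreal (?h \<tau>) \<partial>lborel)" "occupation (\<lambda>x. - f x) n \<omega> = (\<integral>\<^sup>+\<tau>. ennreal (- ?h \<tau>) \<partial>lborel)"
    by (simp_all add: occupation_def)
  show "cycle_reward S B f n \<omega> = enn2real (occupation f n \<omega>) - enn2real (occupation (\<lambda>x. - f x) n \<omega>)"
    using real_lebesgue_integral_def[OF h] unfolding occ by (simp add: cycle_reward_def set_lebesgue_integral_def)
  have fin: "occupation f n \<omega> < \<infinity>" "occupation (\<lambda>x. - f x) n \<omega> < \<infinity>"
    unfolding occ using h by (auto simp: real_integrable_def less_top)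
  have "ennreal (cycle_abs_reward S B f n \<omega>) = (\<integral>\<^sup>+\<tau>. ennreal \<bar>?h \<tau>\<bar> \<partial>lborel)"
    using integrable_abs[OF h] unfolding cycle_abs_reward_def set_lebesgue_integral_def
    by (subst nn_integral_eq_integral) (auto simp: abs_mult)
  also have "\<dots> = (\<integral>\<^sup>+\<tau>. ennreal (?h \<tau>) + ennreal (- ?h \<tau>) \<partial>lborel)"
  proof (rule nn_integral_cong)
    have "ennreal \<bar>y\<bar> = ennreal y + ennreal (- y)" for y :: real
      by (cases "0 \<le> y") (simp_all add: ennreal_neg)
    then show "ennreal \<bar>?h \<tau>\<bar> = ennreal (?h \<tau>) + ennreal (- ?h \<tau>)" for \<tau> .
  qed
  also have "\<dots> = occupation f n \<omega> + occupation (\<lambda>x. - f x) n \<omega>"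
    unfolding occ by (rule nn_integral_add) measurable
  finally have "enn2real (ennreal (cycle_abs_reward S B f n \<omega>)) = enn2real (occupation f n \<omega> + occupation (\<lambda>x. - f x) n \<omega>)"
    by simp
  moreover have "0 \<le> cycle_abs_reward S B f n \<omega>"
    unfolding cycle_abs_reward_def set_lebesgue_integral_def by (intro integral_nonneg_AE) auto
  ultimately show "cycle_abs_reward S B f n \<omega> = enn2real (occupation f n \<omega>) + enn2real (occupation (\<lambda>x. - f x) n \<omega>)"
    using fin by (simp add: enn2real_plus)
qed

lemma cycle_reward_zero: "S n \<omega> = 0 \<Longrightarrow> cycle_reward S B f n \<omega> = 0"
proof -
  assume "S n \<omega> = 0"
  moreover have "(LINT \<tau>:{0}|lborel. f (B n \<tau> \<omega>)) = 0"
    unfolding set_lebesgue_integral_def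
  proof (rule integral_eq_zero_AE)
    show "AE \<tau> in lborel. indicator {0} \<tau> *\<^sub>R f (B n \<tau> \<omega>) = 0"
      using AE_lborel_singleton[of "0 :: real"] by eventually_elim (simp add: indicator_def)
  qed
  ultimately show ?thesis by (simp add: cycle_reward_def)
qed

text \<open>
  Replacing rewards by their versions \<open>H (cycle_data n)\<close> makes the triples exactly i.i.d. at the
  expense of a null set.
\<close>

lemma reward_triples:
  obtains V :: "nat \<Rightarrow> 'a \<Rightarrow> real \<times> real \<times> real" where
    "indep_vars (\<lambda>_. borel) V {1..}"
    "\<And>n. n \<ge> 1 \<Longrightarrow> distr M borel (V n) = distr M borel (V 1)"
    "\<And>n \<omega>. fst (V n \<omega>) = S n \<omega>"
    "\<And>n \<omega>. \<bar>fst (snd (V n \<omega>))\<bar> \<le> snd (snd (V n \<omega>))"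
    "\<And>n \<omega>. S n \<omega> = 0 \<Longrightarrow> fst (snd (V n \<omega>)) = 0"
    "AE \<omega> in M. \<forall>n\<ge>1. fst (snd (V n \<omega>)) = cycle_reward S B f n \<omega> \<and> snd (snd (V n \<omega>)) = cycle_abs_reward S B f n \<omega>"
proof -
  note [measurable] = f_measurable
  obtain H where H [measurable]: "H \<in> borel_measurable (borel \<Otimes>\<^sub>M path_space)"
    and H_eq: "\<And>n. n \<ge> 1 \<Longrightarrow> AE \<omega> in M. occupation f n \<omega> = H (cycle_data n \<omega>)"
    by (rule occupation_factorises[OF f_measurable]) blast
  have mf: "(\<lambda>x. - f x) \<in> borel_measurable borel" by measurable
  obtain H' where H' [measurable]: "H' \<in> borel_measurable (borel \<Otimes>\<^sub>M path_space)"
    and H'_eq: "\<And>n. n \<ge> 1 \<Longrightarrow> AE \<omega> in M. occupation (\<lambda>x. - f x) n \<omega> = H' (cycle_data n \<omega>)"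
    by (rule occupation_factorises[OF mf]) blast
  \<comment> \<open>the value zero for cycles of length zero holds everywhere, not only almost surely\<close>
  define \<Phi> where "\<Phi> e = (fst e, if fst e = 0 then 0 else enn2real (H e) - enn2real (H' e), enn2real (H e) + enn2real (H' e))" for e
  have \<Phi>_meas: "\<Phi> \<in> measurable (borel \<Otimes>\<^sub>M path_space) borel"
    unfolding \<Phi>_def[abs_def] borel_prod[symmetric] by measurable
  show ?thesis
  proof (rule that[of "\<lambda>n \<omega>. \<Phi> (cycle_data n \<omega>)"])
    show "indep_vars (\<lambda>_. borel) (\<lambda>n \<omega>. \<Phi> (cycle_data n \<omega>)) {1..}"
      by (rule indep_vars_compose2[OF indep_cycle_data \<Phi>_meas])
    show "distr M borel (\<lambda>\<omega>. \<Phi> (cycle_data n \<omega>)) = distr M borel (\<lambda>\<omega>. \<Phi> (cycle_data 1 \<omega>))" if "n \<ge> 1" for n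
      using distr_cycle_data[OF that] distr_distr[OF \<Phi>_meas cycle_data_measurable[OF that]] distr_distr[OF \<Phi>_meas cycle_data_measurable[of 1]]
      by (simp add: comp_def)
    show "fst (\<Phi> (cycle_data n \<omega>)) = S n \<omega>" for n \<omega> by (simp add: \<Phi>_def cycle_data_def)
    show "\<bar>fst (snd (\<Phi> (cycle_data n \<omega>)))\<bar> \<le> snd (snd (\<Phi> (cycle_data n \<omega>)))" for n \<omega>
      by (auto simp: \<Phi>_def abs_le_iff)
    show "S n \<omega> = 0 \<Longrightarrow> fst (snd (\<Phi> (cycle_data n \<omega>))) = 0" for n \<omega>
      by (simp add: \<Phi>_def cycle_data_def)
    have "AE \<omega> in M. n \<ge> 1 \<longrightarrow> fst (snd (\<Phi> (cycle_data n \<omega>))) = cycle_reward S B f n \<omega> \<and> snd (snd (\<Phi> (cycle_data n \<omega>))) = cycle_abs_reward S B f n \<omega>" for n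
    proof (cases "n \<ge> 1")
      case True
      show ?thesis
        using H_eq[OF True] H'_eq[OF True] f_B_integrable[OF True]
      proof eventually_elim
        case (elim \<omega>)
        then show ?case
          using rewards_eq_occupation[OF elim(3)] cycle_reward_zero[of n \<omega>] by (auto simp: \<Phi>_def cycle_data_def)
      qed
    qed simp
    then show "AE \<omega> in M. \<forall>n\<ge>1. fst (snd (\<Phi> (cycle_data n \<omega>))) = cycle_reward S B f n \<omega> \<and> snd (snd (\<Phi> (cycle_data n \<omega>))) = cycle_abs_reward S B f n \<omega>"
      by (simp add: AE_all_countable)
  qed
qed

end

section \<open>Decomposition of the functional into cycles\<close>

lemma renewal_time_Suc: "renewal_time S (Suc n) \<omega> = renewal_time S n \<omega> + S (Suc n) \<omega>"
  and renewal_time_0: "renewal_time S 0 \<omega> = 0"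
  by (simp_all add: renewal_time_def)

lemma renewal_time_mono:
  assumes "\<And>i. i \<ge> 1 \<Longrightarrow> 0 \<le> S i \<omega>" "n \<le> m"
  shows "renewal_time S n \<omega> \<le> renewal_time S m \<omega>"
  unfolding renewal_time_def using assms by (intro sum_mono2) auto

lemma renewal_count_eq:
  assumes S: "\<And>i. i \<ge> 1 \<Longrightarrow> 0 \<le> S i \<omega>"
    and \<tau>: "renewal_time S n \<omega> \<le> \<tau>" "\<tau> < renewal_time S (Suc n) \<omega>"
  shows "renewal_count S \<tau> \<omega> = n"
  unfolding renewal_count_def
proof (rule cSup_eq_maximum)
  show "n \<in> {m. renewal_time S m \<omega> \<le> \<tau>}" using \<tau> by simp
  fix m assume "m \<in> {m. renewal_time S m \<omega> \<le> \<tau>}"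
  then have "renewal_time S m \<omega> < renewal_time S (Suc n) \<omega>" using \<tau> by simp
  then show "m \<le> n" using renewal_time_mono[of S \<omega> "Suc n" m, OF S] by (meson not_less not_less_eq_eq)
qed

lemma set_integral_shift:
  fixes g :: "real \<Rightarrow> real"
  assumes g: "set_integrable lborel {0..s} g" and Z: "\<And>\<tau>. \<tau> \<in> {a..<a + s} \<Longrightarrow> Z \<tau> = g (\<tau> - a)"
  shows "set_integrable lborel {a..<a + s} Z" "(LINT \<tau>:{a..<a + s}|lborel. Z \<tau>) = (LINT \<tau>:{0..s}|lborel. g \<tau>)"
proof -
  have g': "set_integrable lborel {0..<s} g"
    using g by (rule set_integrable_subset) auto
  have eq: "indicator {a..<a + s} \<tau> *\<^sub>R Z \<tau> = indicator {0..<s} (- a + 1 * \<tau>) *\<^sub>R g (- a + 1 * \<tau>)" for \<tau>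
    using Z[of \<tau>] by (auto simp: indicator_def)
  show "set_integrable lborel {a..<a + s} Z"
    using lborel_integrable_real_affine[of "\<lambda>\<tau>. indicator {0..<s} \<tau> *\<^sub>R g \<tau>" 1 "- a"] g'
    unfolding set_integrable_def eq by simp
  have "(LINT \<tau>:{a..<a + s}|lborel. Z \<tau>) = (LINT \<tau>:{0..<s}|lborel. g \<tau>)"
    using lborel_integral_real_affine[of 1 "\<lambda>\<tau>. indicator {0..<s} \<tau> *\<^sub>R g \<tau>" "- a"]
    unfolding set_lebesgue_integral_def eq by simp
  also have "\<dots> = (LINT \<tau>:{0..s}|lborel. g \<tau>)"
    unfolding set_lebesgue_integral_def
  proof (rule integral_cong_AE)
    show "(\<lambda>\<tau>. indicator {0..<s} \<tau> *\<^sub>R g \<tau>) \<in> borel_measurable lborel" "(\<lambda>\<tau>. indicator {0..s} \<tau> *\<^sub>R g \<tau>) \<in> borel_measurable lborel"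
      using g g' by (auto simp: set_integrable_def)
    show "AE \<tau> in lborel. indicator {0..<s} \<tau> *\<^sub>R g \<tau> = indicator {0..s} \<tau> *\<^sub>R g \<tau>"
      using AE_lborel_singleton[of s] by eventually_elim (auto simp: indicator_def)
  qed
  finally show "(LINT \<tau>:{a..<a + s}|lborel. Z \<tau>) = (LINT \<tau>:{0..s}|lborel. g \<tau>)" .
qed

text \<open>
  Stated for an abstract integrand \<open>Z\<close> because it is used for \<open>f\<close> and for its absolute value
  along the path under resetting.
\<close>

lemma set_integral_cycles:
  fixes g :: "nat \<Rightarrow> real \<Rightarrow> real" and S :: "nat \<Rightarrow> 'a \<Rightarrow> real"
  assumes S: "\<And>i. i \<ge> 1 \<Longrightarrow> 0 \<le> S i \<omega>"
    and g: "\<And>i. i \<ge> 1 \<Longrightarrow> set_integrable lborel {0..S i \<omega>} (g i)"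
    and Z: "\<And>i \<tau>. renewal_time S i \<omega> \<le> \<tau> \<Longrightarrow> \<tau> < renewal_time S (Suc i) \<omega> \<Longrightarrow> Z \<tau> = g (Suc i) (\<tau> - renewal_time S i \<omega>)"
    and nm: "n \<le> m"
  shows "set_integrable lborel {renewal_time S n \<omega>..<renewal_time S m \<omega>} Z \<and>
    (LINT \<tau>:{renewal_time S n \<omega>..<renewal_time S m \<omega>}|lborel. Z \<tau>) = (\<Sum>i=Suc n..m. LINT \<tau>:{0..S i \<omega>}|lborel. g i \<tau>)"
  using nm
proof (induction m rule: dec_induct)
  case base
  then show ?case by (simp add: set_integrable_def set_lebesgue_integral_def)
next
  case (step m)
  let ?T = "\<lambda>n. renewal_time S n \<omega>"
  have mono: "?T n \<le> ?T m" "?T m \<le> ?T (Suc m)"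
    using step.hyps renewal_time_mono[of S \<omega>, OF S] by auto
  have c: "set_integrable lborel {?T m..<?T (Suc m)} Z"
    "(LINT \<tau>:{?T m..<?T (Suc m)}|lborel. Z \<tau>) = (LINT \<tau>:{0..S (Suc m) \<omega>}|lborel. g (Suc m) \<tau>)"
    using set_integral_shift[of "S (Suc m) \<omega>" "g (Suc m)" "?T m" Z] g[of "Suc m"] Z[of m] by (auto simp: renewal_time_Suc)
  have un: "{?T n..<?T (Suc m)} = {?T n..<?T m} \<union> {?T m..<?T (Suc m)}" using mono by auto
  show ?case
    unfolding un using step.IH c step.hyps
    by (auto simp: set_integral_Un intro!: set_integrable_Un)
qed

context stochastic_resetting
begin

lemma reset_functional_between:
  assumes \<omega>: "\<omega> \<in> space M" and int: "\<And>n. n \<ge> 1 \<Longrightarrow> set_integrable lborel {0..S n \<omega>} (\<lambda>\<tau>. f (B n \<tau> \<omega>))"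
    and t: "renewal_time S n \<omega> \<le> t" "t < renewal_time S m \<omega>"
  shows "\<bar>reset_functional S B f t \<omega> - (\<Sum>i=1..n. cycle_reward S B f i \<omega>)\<bar> \<le> (\<Sum>i=Suc n..m. cycle_abs_reward S B f i \<omega>)"
proof -
  let ?T = "\<lambda>n. renewal_time S n \<omega>" and ?Z = "\<lambda>\<tau>. f (reset_process S B \<tau> \<omega>)"
  have S: "\<And>i. i \<ge> 1 \<Longrightarrow> 0 \<le> S i \<omega>" using S_nonneg \<omega> by auto
  have nm: "n \<le> m" using t renewal_time_mono[of S \<omega> m n, OF S] by (meson linorder_not_le nat_le_linear order_trans)
  have Z: "?Z \<tau> = f (B (Suc i) (\<tau> - ?T i) \<omega>)" if "?T i \<le> \<tau>" "\<tau> < ?T (Suc i)" for i \<tau>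
    using renewal_count_eq[of S \<omega> i \<tau>, OF S that] by (simp add: reset_process_def flip: Suc_eq_plus1)
  have T0: "0 \<le> ?T n" using renewal_time_mono[of S \<omega> 0 n, OF S] by (simp add: renewal_time_0)
  have 1: "set_integrable lborel {0..<?T n} ?Z" "(LINT \<tau>:{0..<?T n}|lborel. ?Z \<tau>) = (\<Sum>i=1..n. cycle_reward S B f i \<omega>)"
    using set_integral_cycles[of S \<omega> "\<lambda>i \<tau>. f (B i \<tau> \<omega>)" ?Z 0 n, OF S int Z] by (simp_all add: renewal_time_0 cycle_reward_def One_nat_def)
  have 2: "set_integrable lborel {?T n..<?T m} ?Z"
    using set_integral_cycles[of S \<omega> "\<lambda>i \<tau>. f (B i \<tau> \<omega>)" ?Z n m, OF S int Z nm] by simp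
  have int_abs: "set_integrable lborel {0..S i \<omega>} (\<lambda>\<tau>. \<bar>f (B i \<tau> \<omega>)\<bar>)" if "i \<ge> 1" for i
    using int[OF that] by (rule set_integrable_abs)
  have 3: "set_integrable lborel {?T n..<?T m} (\<lambda>\<tau>. \<bar>?Z \<tau>\<bar>)" "(LINT \<tau>:{?T n..<?T m}|lborel. \<bar>?Z \<tau>\<bar>) = (\<Sum>i=Suc n..m. cycle_abs_reward S B f i \<omega>)"
    using set_integral_cycles[of S \<omega> "\<lambda>i \<tau>. \<bar>f (B i \<tau> \<omega>)\<bar>" "\<lambda>\<tau>. \<bar>?Z \<tau>\<bar>" n m, OF S int_abs _ nm] Z by (simp_all add: cycle_abs_reward_def)
  have 4: "set_integrable lborel {?T n..t} ?Z"
    using 2 by (rule set_integrable_subset) (use t in auto)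
  have "{0..t} = {0..<?T n} \<union> {?T n..t}" using T0 t by auto
  then have "reset_functional S B f t \<omega> = (LINT \<tau>:{0..<?T n}|lborel. ?Z \<tau>) + (LINT \<tau>:{?T n..t}|lborel. ?Z \<tau>)"
    unfolding reset_functional_def using set_integral_Un[OF _ 1(1) 4] by (simp add: ivl_disj_int)
  then have "\<bar>reset_functional S B f t \<omega> - (\<Sum>i=1..n. cycle_reward S B f i \<omega>)\<bar> = \<bar>LINT \<tau>:{?T n..t}|lborel. ?Z \<tau>\<bar>"
    using 1 by simp
  also have "\<dots> \<le> (LINT \<tau>:{?T n..<?T m}|lborel. \<bar>?Z \<tau>\<bar>)"
    unfolding set_lebesgue_integral_def
  proof (rule integral_abs_bound[THEN order_trans], rule integral_mono)
    show "integrable lborel (\<lambda>\<tau>. \<bar>indicator {?T n..t} \<tau> *\<^sub>R ?Z \<tau>\<bar>)"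
      using 4 by (intro integrable_abs) (simp add: set_integrable_def)
    show "integrable lborel (\<lambda>\<tau>. indicator {?T n..<?T m} \<tau> *\<^sub>R \<bar>?Z \<tau>\<bar>)"
      using 3 by (simp add: set_integrable_def)
    show "\<bar>indicator {?T n..t} \<tau> *\<^sub>R ?Z \<tau>\<bar> \<le> indicator {?T n..<?T m} \<tau> *\<^sub>R \<bar>?Z \<tau>\<bar>" for \<tau>
      using t by (auto simp: indicator_def)
  qed
  finally show ?thesis using 3 by simp
qed

text \<open>
  On the event that all renewal times are at most \<open>\<tau>\<close>, the number of renewals is the fixed
  default value of \<^const>\<open>Sup\<close> on an infinite set of naturals.  The time since that renewal is still
  nonnegative, so the functional is measurable without removing a null set.
\<close>

lemma reset_functional_measurable: "reset_functional S B f t \<in> borel_measurable M"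
proof -
  let ?M = "M \<Otimes>\<^sub>M lborel"
  have T_meas [measurable]: "renewal_time S n \<in> borel_measurable M" for n
    unfolding renewal_time_def[abs_def] by (intro borel_measurable_sum S_measurable) auto
  note [measurable] = f_measurable
  define N where "N x = (if \<forall>m. renewal_time S m (fst x) \<le> max 0 (snd x) then Sup UNIV
     else LEAST n. max 0 (snd x) < renewal_time S (Suc n) (fst x))" for x :: "'a \<times> real"
  have N_meas: "N \<in> measurable ?M (count_space UNIV)"
    unfolding N_def[abs_def] by measurable
  have N: "N (\<omega>, \<tau>) = renewal_count S \<tau> \<omega> \<and> renewal_time S (N (\<omega>, \<tau>)) \<omega> \<le> \<tau>" if \<omega>: "\<omega> \<in> space M" and \<tau>: "0 \<le> \<tau>" for \<omega> \<tau>
  proof (cases "\<forall>m. renewal_time S m \<omega> \<le> \<tau>")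
    case True
    then show ?thesis using \<tau> by (simp add: N_def renewal_count_def)
  next
    case False
    have S: "\<And>i. i \<ge> 1 \<Longrightarrow> 0 \<le> S i \<omega>" using S_nonneg \<omega> by auto
    define n where "n = (LEAST n. \<tau> < renewal_time S (Suc n) \<omega>)"
    obtain m where m: "\<tau> < renewal_time S m \<omega>" using False by (auto simp: not_le)
    then have "m \<noteq> 0" using \<tau> by (cases m) (auto simp: renewal_time_0)
    then obtain m' where "m = Suc m'" by (cases m) auto
    then have n: "\<tau> < renewal_time S (Suc n) \<omega>" using m unfolding n_def by (auto intro: LeastI)
    have "renewal_time S n \<omega> \<le> \<tau>"
    proof (cases n)
      case (Suc k)
      then have "\<not> \<tau> < renewal_time S (Suc k) \<omega>" unfolding n_def by (intro not_less_Least) simp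
      then show ?thesis using Suc by simp
    qed (use \<tau> in \<open>simp add: renewal_time_0\<close>)
    moreover have "N (\<omega>, \<tau>) = n" using False \<tau> unfolding N_def n_def by (auto simp: max_absorb2)
    ultimately show ?thesis using renewal_count_eq[of S \<omega> n \<tau>, OF S _ n] by simp
  qed
  have "(\<lambda>x. B_clamped (N x + 1) (snd x - renewal_time S (N x) (fst x)) (fst x)) \<in> borel_measurable ?M"
  proof (rule measurable_compose_countable[OF _ N_meas])
    show "(\<lambda>x. B_clamped (n + 1) (snd x - renewal_time S n (fst x)) (fst x)) \<in> borel_measurable ?M" for n
      by (rule B_clamped_measurable) auto
  qed
  then have [measurable]: "(\<lambda>x. f (B_clamped (N x + 1) (snd x - renewal_time S (N x) (fst x)) (fst x))) \<in> borel_measurable ?M"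
    by measurable
  have "(\<lambda>(\<omega>, \<tau>). indicator {0..t} \<tau> *\<^sub>R f (B_clamped (N (\<omega>, \<tau>) + 1) (\<tau> - renewal_time S (N (\<omega>, \<tau>)) \<omega>) \<omega>)) \<in> borel_measurable ?M"
    unfolding case_prod_beta' by simp measurable
  then have "(\<lambda>\<omega>. LINT \<tau>|lborel. indicator {0..t} \<tau> *\<^sub>R f (B_clamped (N (\<omega>, \<tau>) + 1) (\<tau> - renewal_time S (N (\<omega>, \<tau>)) \<omega>) \<omega>)) \<in> borel_measurable M"
    by (rule lborel.borel_measurable_lebesgue_integral)
  also have "?this \<longleftrightarrow> ?thesis"
    unfolding reset_functional_def[abs_def] set_lebesgue_integral_def
  proof (intro measurable_cong Bochner_Integration.integral_cong refl)
    fix \<omega> \<tau> assume "\<omega> \<in> space M"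
    then show "indicator {0..t} \<tau> *\<^sub>R f (B_clamped (N (\<omega>, \<tau>) + 1) (\<tau> - renewal_time S (N (\<omega>, \<tau>)) \<omega>) \<omega>)
      = indicator {0..t} \<tau> *\<^sub>R f (reset_process S B \<tau> \<omega>)"
      using N[of \<omega> \<tau>] by (cases "0 \<le> \<tau>") (auto simp: indicator_def reset_process_def B_clamped_def max_def)
  qed
  finally show ?thesis .
qed

end

section \<open>Stochastic resetting\<close>

theorem corollary3p1:
  fixes M :: "'a measure"
    and S :: "nat \<Rightarrow> 'a \<Rightarrow> real"
    and B :: "nat \<Rightarrow> real \<Rightarrow> 'a \<Rightarrow> real"
    and f :: "real \<Rightarrow> real"
    and l :: ereal
  assumes "stochastic_resetting M S B f"
    and "0 \<le> l"
    and "((\<lambda>s::real. - (ereal (1 / s) * ext_ln (emeasure M {\<omega> \<in> space M. S 1 \<omega> > s}))) \<longlongrightarrow> l) at_top"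
    and "\<And>\<rho>::real. \<rho> > 0 \<Longrightarrow> exp_moment M (\<lambda>\<omega>. \<rho> * cycle_abs_reward S B f 1 \<omega>) < \<infinity>"
  shows "full_LDP M (reset_functional S B f) (rate_function M S B f) \<and> good_rate (rate_function M S B f) \<and>
    (\<forall>k::real. ((\<lambda>t::real. ereal (1 / t) * ext_ln (exp_moment M (\<lambda>\<omega>. k * reset_functional S B f t \<omega>)))
        \<longlongrightarrow> - phi M S B f k) at_top)"
proof -
  interpret stochastic_resetting M S B f by fact
  obtain V :: "nat \<Rightarrow> 'a \<Rightarrow> real \<times> real \<times> real" where
    V_indep: "indep_vars (\<lambda>_. borel) V {1..}"
    and V_ident: "\<And>n. n \<ge> 1 \<Longrightarrow> distr M borel (V n) = distr M borel (V 1)"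
    and V_S: "\<And>n \<omega>. fst (V n \<omega>) = S n \<omega>"
    and V_le: "\<And>n \<omega>. \<bar>fst (snd (V n \<omega>))\<bar> \<le> snd (snd (V n \<omega>))"
    and V_zero: "\<And>n \<omega>. S n \<omega> = 0 \<Longrightarrow> fst (snd (V n \<omega>)) = 0"
    and V_rewards: "AE \<omega> in M. \<forall>n\<ge>1. fst (snd (V n \<omega>)) = cycle_reward S B f n \<omega> \<and>
      snd (snd (V n \<omega>)) = cycle_abs_reward S B f n \<omega>"
    by (rule reward_triples) blast
  have V_1: "AE \<omega> in M. fst (snd (V 1 \<omega>)) = cycle_reward S B f 1 \<omega> \<and> snd (snd (V 1 \<omega>)) = cycle_abs_reward S B f 1 \<omega>"
    using V_rewards by eventually_elim simp
  have int: "AE \<omega> in M. \<forall>n\<ge>1. set_integrable lborel {0..S n \<omega>} (\<lambda>\<tau>. f (B n \<tau> \<omega>))"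
    using f_B_integrable by (simp add: AE_all_countable AE_impI)
  interpret RR: renewal_reward_process M V "\<lambda>n \<omega>. fst (V n \<omega>)" "\<lambda>n \<omega>. fst (snd (V n \<omega>))"
    "\<lambda>n \<omega>. snd (snd (V n \<omega>))" "reset_functional S B f"
  proof unfold_locales
    show "indep_vars (\<lambda>_. borel) V {1..}" by (fact V_indep)
    show "distr M borel (V n) = distr M borel (V 1)" if "n \<ge> 1" for n using that by (rule V_ident)
    show "0 \<le> fst (V n \<omega>)" if "n \<ge> 1" "\<omega> \<in> space M" for n \<omega> using S_nonneg that by (simp add: V_S)
    show "\<bar>fst (snd (V n \<omega>))\<bar> \<le> snd (snd (V n \<omega>))" for n \<omega> by (rule V_le)
    show "fst (V n \<omega>) = 0 \<Longrightarrow> fst (snd (V n \<omega>)) = 0" for n \<omega> by (simp add: V_S V_zero)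
    show "prob {\<omega> \<in> space M. fst (V 1 \<omega>) = 0} < 1" using S_nontrivial by (simp add: V_S)
    show "exp_moment M (\<lambda>\<omega>. \<rho> * snd (snd (V 1 \<omega>))) < \<infinity>" if "\<rho> > 0" for \<rho>
    proof -
      have "exp_moment M (\<lambda>\<omega>. \<rho> * snd (snd (V 1 \<omega>))) = exp_moment M (\<lambda>\<omega>. \<rho> * cycle_abs_reward S B f 1 \<omega>)"
        unfolding exp_moment_def by (rule nn_integral_cong_AE) (use V_1 in \<open>eventually_elim, simp\<close>)
      then show ?thesis using assms(4)[OF that] by simp
    qed
    show "reset_functional S B f t \<in> borel_measurable M" for t by (rule reset_functional_measurable)
    show "AE \<omega> in M. \<forall>t\<ge>0. \<forall>n m. renewal_time (\<lambda>n \<omega>. fst (V n \<omega>)) n \<omega> \<le> t \<longrightarrow> t < renewal_time (\<lambda>n \<omega>. fst (V n \<omega>)) m \<omega> \<longrightarrow>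
      \<bar>reset_functional S B f t \<omega> - (\<Sum>i=1..n. fst (snd (V i \<omega>)))\<bar> \<le> (\<Sum>i=Suc n..m. snd (snd (V i \<omega>)))"
      using V_rewards int AE_space
    proof eventually_elim
      case (elim \<omega>)
      have sums: "(\<Sum>i=1..n. fst (snd (V i \<omega>))) = (\<Sum>i=1..n. cycle_reward S B f i \<omega>)"
        "(\<Sum>i=Suc n..m. snd (snd (V i \<omega>))) = (\<Sum>i=Suc n..m. cycle_abs_reward S B f i \<omega>)" for n m
        using elim(1) by (auto intro!: sum.cong)
      show ?case
        unfolding V_S sums using reset_functional_between[OF elim(3)] elim(2) by blast
    qed
  qed
  have phi: "phi M S B f k = RR.cycle_phi k" for k
  proof -
    have "exp_moment M (\<lambda>\<omega>. \<zeta> * S 1 \<omega> + k * cycle_reward S B f 1 \<omega>) = exp_moment M (\<lambda>\<omega>. \<zeta> * fst (V 1 \<omega>) + k * fst (snd (V 1 \<omega>)))" for \<zeta>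
      unfolding exp_moment_def V_S by (rule nn_integral_cong_AE) (use V_1 in \<open>eventually_elim, simp\<close>)
    then show ?thesis by (simp add: phi_def RR.cycle_phi_def)
  qed
  have rate: "rate_function M S B f = RR.rate"
    by (simp add: fun_eq_iff rate_function_def RR.rate_def phi)
  show ?thesis
    unfolding rate phi using RR.full_LDP_F RR.good_rate_rate RR.scaled_log_moment_tendsto by blast
qed

end
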